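(* Let $\nu,\mu\in\mathbb{C}$ with $\nu+\mu\notin-\mathbb{N}$ and $\nu+\frac12\notin\mathbb{Z}$. If $\pm\operatorname{Im}x>0$ (upper signs throughout when $\operatorname{Im}x>0$, lower signs throughout when $\operatorname{Im}x<0$), then $$\mathsf{Q}_\nu^\mu(x)=\sqrt{\pi}\,2^{-\nu-1}e^{\pm i\pi\mu}\left(\cos(\pi\mu)\mp i\frac{\sin(\pi(\mu-\nu))}{2\cos(\pi\nu)}\right)\frac{\Gamma(\nu+\mu+1)}{\Gamma(\nu+\frac32)}x^{-\nu-\mu-1}(1-x^2)^{\frac12\mu}{}_2F_1\!\left(\frac{\nu+\mu+1}{2},\frac{\nu+\mu+2}{2};\nu+\frac32;\frac{1}{x^2}\right)$$ $$+\,\pi^{\frac32}2^{\nu-1}\frac{e^{\pm\pi i(\frac12+\mu)}\sec(\pi\nu)}{\Gamma(\nu-\mu+1)\Gamma(\frac12-\nu)}x^{\nu-\mu}(1-x^2)^{\frac12\mu}{}_2F_1\!\left(\frac{\mu-\nu}{2},\frac{\mu-\nu+1}{2};\frac12-\nu;\frac{1}{x^2}\right).$$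
   Context: $\mathbb{N}=\{1,2,3,\dots\}$, $-\mathbb{N}=\{-1,-2,\dots\}$. $D_1=\mathbb{C}\setminus((-\infty,-1]\cup[1,\infty))$, $D_2=\mathbb{C}\setminus(-\infty,1]$. Complex powers are principal values. ${}_2F_1(a,b;c;w)$ is the Gauss hypergeometric function, principal branch on $\mathbb{C}\setminus[1,\infty)$ (the analytic continuation of $\sum_{n\ge0}\frac{(a)_n(b)_n}{(c)_n}\frac{w^n}{n!}$). $1/\Gamma$ is read as the entire function (zero at the poles of $\Gamma$). Associated Legendre function of the second kind: for $z\in D_2$, $\nu+\mu\in\mathbb{C}\setminus-\mathbb{N}$, $$Q_\nu^\mu(z)=\frac{\sqrt{\pi}\,e^{i\pi\mu}\Gamma(\nu+\mu+1)(z^2-1)^{\frac12\mu}}{2^{\nu+1}\Gamma(\nu+\frac32)z^{\nu+\mu+1}}\,{}_2F_1\!\left(\tfrac{\nu+\mu+2}{2},\tfrac{\nu+\mu+1}{2};\nu+\tfrac32;\tfrac1{z^2}\right),$$ where $(z^2-1)^\alpha:=(z+1)^\alpha(z-1)^\alpha$. Ferrers function of the second kind: for $x\in(-1,1)$, $$\mathsf{Q}_\nu^\mu(x)=\tfrac12\big[e^{-\frac12 i\pi\mu}\,e^{-i\pi\mu}Q_\nu^\mu(x+i0)+e^{\frac12 i\pi\mu}\,e^{-i\pi\mu}Q_\nu^\mu(x-i0)\big],$$ where $x\pm i0$ denotes the limit from the upper/lower half-plane, and $\mathsf{Q}_\nu^\mu$ is extended analytically to $D_1$. *)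

theory Defs
  imports "HOL-Complex_Analysis.Complex_Analysis"
begin

(* Principal branch of the Gauss hypergeometric function on C minus [1, oo).  The slit plane
   is connected, so the function chosen is determined by its power series there; its values
   on the cut are unspecified.  It is meaningful when c is not a nonpositive integer. *)
definition hyp2F1 :: "complex \<Rightarrow> complex \<Rightarrow> complex \<Rightarrow> complex \<Rightarrow> complex" where
  "hyp2F1 a b c = (SOME f. f holomorphic_on (UNIV - complex_of_real ` {1..}) \<and>
     (\<forall>w. norm w < 1 \<longrightarrow>
        (\<lambda>n. pochhammer a n * pochhammer b n / pochhammer c n * w ^ n / fact n) sums f w))"

(* Associated Legendre function of the second kind, for z outside (-oo, 1] and nu + mu not a
   negative integer.  rGamma is the entire function 1/Gamma; powr is the principal power.
   The power of z^2 - 1 is by convention the product of those of z + 1 and z - 1.  For nu + 3/2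
   a nonpositive integer the product of rGamma and hyp2F1 would have to be read as a limit;
   the definition does not cover that case. *)
definition legendreQ :: "complex \<Rightarrow> complex \<Rightarrow> complex \<Rightarrow> complex" where
  "legendreQ \<nu> \<mu> z =
     complex_of_real (sqrt pi) * exp (\<i> * pi * \<mu>) * Gamma (\<nu> + \<mu> + 1)
       * ((z + 1) powr (\<mu> / 2) * (z - 1) powr (\<mu> / 2))
       * rGamma (\<nu> + 3 / 2) / (2 powr (\<nu> + 1) * z powr (\<nu> + \<mu> + 1))
       * hyp2F1 ((\<nu> + \<mu> + 2) / 2) ((\<nu> + \<mu> + 1) / 2) (\<nu> + 3 / 2) (1 / z ^ 2)"

(* The two limits are the boundary values at t + i0 and t - i0. *)
definition ferrersQ_interval :: "complex \<Rightarrow> complex \<Rightarrow> real \<Rightarrow> complex" where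
  "ferrersQ_interval \<nu> \<mu> t = 1 / 2 *
     (exp (- \<i> * pi * \<mu> / 2) * exp (- \<i> * pi * \<mu>) *
        Lim (at (complex_of_real t) within {z. Im z > 0}) (legendreQ \<nu> \<mu>)
    + exp (\<i> * pi * \<mu> / 2) * exp (- \<i> * pi * \<mu>) *
        Lim (at (complex_of_real t) within {z. Im z < 0}) (legendreQ \<nu> \<mu>))"

(* Ferrers function of the second kind: the analytic extension from (-1, 1) to
   C minus (-oo, -1] and [1, oo), unique on this connected domain. *)
definition ferrersQ :: "complex \<Rightarrow> complex \<Rightarrow> complex \<Rightarrow> complex" where
  "ferrersQ \<nu> \<mu> = (SOME f. f holomorphic_on (UNIV - complex_of_real ` ({..-1} \<union> {1..})) \<and>
     (\<forall>t. -1 < t \<and> t < 1 \<longrightarrow> f (complex_of_real t) = ferrersQ_interval \<nu> \<mu> t))"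

end

(* After division by (1 - x^2)^(mu/2), the Ferrers function is the mean of the continuations of
   A(z) = z^(-p) 2F1(p/2, (p+1)/2; c; 1/z^2), p = nu + mu + 1, c = nu + 3/2, from the upper and the
   lower half-plane across (-1, 1).  A solves a second-order equation that is regular at 0, so in
   the upper half-disc it is a combination of the even and the odd solution, with coefficients
   lim A and lim A' at 0; in the lower half-plane A is A(-z) up to a phase.  The quadratic
   transformation evaluates lim A by Kummer's sum at -1 when Re(p - c) < -1, and a contiguous
   relation in c removes this restriction; A' is a multiple of A with p + 1 for p, which gives
   the odd coefficient.  The second function of the theorem is A with -nu - 1 for nu, so the claim
   becomes two identities between the coefficients, which follow from duplication and reflection
   of Gamma.  Both sides extend analytically from the unit disc to the half-planes. *)
theory Submission
  imports Defs
begin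

section \<open>Gauss hypergeometric series\<close>

text \<open>The point z = 0 corresponds to w = 1/z^2 = oo, which the series in w never reaches. The
  continuation is therefore realised by one explicit series whose argument tends to -1, a boundary
  point of its disc, as z tends to 0; this is where the sum at -1 enters. That A and A' have limits
  at 0 at all follows from regularity of the equation there, so the value of lim A may be computed
  along the positive imaginary axis alone, where every root and logarithm is real up to an explicit
  phase. The equation (1 - z^2) y'' = (p + q + 1) z y' + p q y is symmetric in p and q = \<mu> -
  \<nu> = p - 2c + 2. Its solutions behaving like z^(-p) and z^(-q) at infinity are the two
  functions of the theorem, and d = 2 - c = 1/2 - \<nu> is the lower parameter of the second. The
  condition on \<nu> + 1/2 keeps c and d away from the nonpositive integers and cos(pi \<nu>) away
  from 0. Both \<open>hyp2F1\<close> and \<open>ferrersQ\<close> are choices, so a function with the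
  required properties has to be exhibited before anything can be said about them.\<close>

definition hyp_fps :: "complex \<Rightarrow> complex \<Rightarrow> complex \<Rightarrow> complex fps" where
  "hyp_fps a b c = Abs_fps (\<lambda>n. pochhammer a n * pochhammer b n / (pochhammer c n * fact n))"

lemma hyp_fps_0 [simp]: "fps_nth (hyp_fps a b c) 0 = 1"
  by (simp add: hyp_fps_def)

lemma add_of_nat_neq_0: "(c::complex) \<notin> \<int>\<^sub>\<le>\<^sub>0 \<Longrightarrow> c + of_nat n \<noteq> 0"
  by (metis add_eq_0_iff2 minus_of_nat_in_nonpos_Ints)

lemma hyp_fps_rec:
  assumes "c \<notin> \<int>\<^sub>\<le>\<^sub>0"
  shows "(c + of_nat n) * (of_nat n + 1) * fps_nth (hyp_fps a b c) (Suc n) =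
    (a + of_nat n) * (b + of_nat n) * fps_nth (hyp_fps a b c) n"
proof -
  have "c + of_nat n \<noteq> 0" "of_nat n + 1 \<noteq> (0::complex)" "pochhammer c n \<noteq> 0"
    using add_of_nat_neq_0[OF assms, of n] of_nat_neq_0[of n] assms pochhammer_eq_0_imp_nonpos_Int[of c n]
    by (auto simp: add.commute)
  then show ?thesis
    by (simp add: hyp_fps_def pochhammer_Suc divide_simps) (simp add: algebra_simps)
qed

lemma hyp_fps_Suc:
  assumes "c \<notin> \<int>\<^sub>\<le>\<^sub>0"
  shows "fps_nth (hyp_fps a b c) (Suc n) =
    (a + of_nat n) * (b + of_nat n) / ((c + of_nat n) * (of_nat n + 1)) * fps_nth (hyp_fps a b c) n"
proof -
  have "c + of_nat n \<noteq> 0" "of_nat n + 1 \<noteq> (0::complex)"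
    using add_of_nat_neq_0[OF assms, of n] of_nat_neq_0[of n] by (auto simp: add.commute)
  then show ?thesis
    using hyp_fps_rec[OF assms, of n a b] by (simp add: eq_divide_eq mult_ac)
qed

text \<open>For an arbitrary series the hypergeometric operator acts on coefficients as a two-term
  recurrence. This one computation gives both that \<open>hyp_fps\<close> solves the equation and
  that a power series solution is unique.\<close>

lemma fps_nth_hyp_ode:
  fixes F :: "complex fps"
  shows "fps_nth (fps_X * (1 - fps_X) * fps_deriv (fps_deriv F)
        + (fps_const c - fps_const (a + b + 1) * fps_X) * fps_deriv F - fps_const (a * b) * F) n
     = (c + of_nat n) * (of_nat n + 1) * fps_nth F (Suc n) - (a + of_nat n) * (b + of_nat n) * fps_nth F n"
proof -
  have 1: "fps_X * (1 - fps_X) * G = fps_X * G - fps_X * (fps_X * G)" for G :: "complex fps"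
    by (simp add: algebra_simps)
  have 2: "(fps_const c - fps_const (a + b + 1) * fps_X) * G = fps_const c * G - fps_const (a + b + 1) * (fps_X * G)" for G :: "complex fps"
    by (simp add: algebra_simps)
  \<comment> \<open>Multiplication by X shifts the index by one and by X^2 by two, so the two lowest
    coefficients are separate cases.\<close>
  consider "n = 0" | "n = 1" | k where "n = Suc (Suc k)"
    by (metis One_nat_def not0_implies_Suc)
  then show ?thesis
    by cases (simp_all add: 1 2 fps_deriv_nth del: fps_const_add fps_const_mult, simp_all add: algebra_simps)
qed

lemma hyp_fps_ode:
  assumes c: "c \<notin> \<int>\<^sub>\<le>\<^sub>0"
  shows "fps_X * (1 - fps_X) * fps_deriv (fps_deriv (hyp_fps a b c))
        + (fps_const c - fps_const (a + b + 1) * fps_X) * fps_deriv (hyp_fps a b c)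
        - fps_const (a * b) * hyp_fps a b c = 0"
  unfolding fps_eq_iff fps_nth_hyp_ode by (simp add: hyp_fps_rec[OF c])

text \<open>The recurrence determines coefficient n + 1 from coefficient n, because its factor (c +
  n)(n + 1) never vanishes when c is not a nonpositive integer.\<close>

lemma hyp_fps_unique:
  assumes c: "c \<notin> \<int>\<^sub>\<le>\<^sub>0" and F0: "fps_nth F 0 = 1"
    and ode: "fps_X * (1 - fps_X) * fps_deriv (fps_deriv F)
        + (fps_const c - fps_const (a + b + 1) * fps_X) * fps_deriv F - fps_const (a * b) * F = 0"
  shows "F = hyp_fps a b c"
proof -
  have "fps_nth F n = fps_nth (hyp_fps a b c) n" for n
  proof (induction n)
    case 0
    then show ?case by (simp add: F0)
  next
    case (Suc n)
    have nz: "c + of_nat n \<noteq> 0" "of_nat n + 1 \<noteq> (0::complex)"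
      using add_of_nat_neq_0[OF c] of_nat_neq_0[of n] by (auto simp: add.commute)
    have "(c + of_nat n) * (of_nat n + 1) * fps_nth F (Suc n)
        = (a + of_nat n) * (b + of_nat n) * fps_nth F n"
      using fps_nth_hyp_ode[of F c a b n] unfolding ode by simp
    also have "\<dots> = (c + of_nat n) * (of_nat n + 1) * fps_nth (hyp_fps a b c) (Suc n)"
      by (simp add: Suc.IH hyp_fps_rec[OF c])
    finally show ?case
      using nz by simp
  qed
  then show ?thesis by (simp add: fps_eq_iff)
qed

section \<open>Convergence in the open unit disc\<close>

lemma tendsto_add_of_nat_ratio: 
  "((\<lambda>n. (a + of_nat n) / (b + of_nat n)) \<longlongrightarrow> (1::complex)) sequentially"
proof -
  have "(\<lambda>n. (a / of_nat n + 1) / (b / of_nat n + 1)) \<longlonglongrightarrow> (0 + 1) / (0 + 1 :: complex)"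
    by (intro tendsto_intros tendsto_divide_0[OF tendsto_const] tendsto_of_nat) simp
  moreover have "\<forall>\<^sub>F n in sequentially. (a / of_nat n + 1) / (b / of_nat n + 1) = (a + of_nat n) / (b + of_nat n)"
    using eventually_gt_at_top[of 0] by eventually_elim (simp add: divide_add_eq_iff)
  ultimately show ?thesis by (simp add: tendsto_cong)
qed

lemma hyp_fps_summable:
  assumes c: "c \<notin> \<int>\<^sub>\<le>\<^sub>0" and w: "norm w < 1"
  shows "summable (\<lambda>n. fps_nth (hyp_fps a b c) n * w ^ n)"
proof -
  obtain r where r: "norm w < r" "r < 1" using w dense by blast
  have "(\<lambda>n. norm ((a + of_nat n) / (c + of_nat n) * ((b + of_nat n) / (1 + of_nat n)) * w)) \<longlonglongrightarrow> norm (1 * 1 * w)"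
    by (intro tendsto_intros tendsto_add_of_nat_ratio)
  then have "\<forall>\<^sub>F n in sequentially. norm ((a + of_nat n) / (c + of_nat n) * ((b + of_nat n) / (1 + of_nat n)) * w) < r"
    using r by (intro order_tendstoD) auto
  then obtain N where N: "\<And>n. n \<ge> N \<Longrightarrow> norm ((a + of_nat n) / (c + of_nat n) * ((b + of_nat n) / (1 + of_nat n)) * w) < r"
    by (auto simp: eventually_sequentially)
  show ?thesis
  proof (rule summable_ratio_test[OF r(2)])
    fix n assume "n \<ge> N"
    have "fps_nth (hyp_fps a b c) (Suc n) * w ^ Suc n
       = ((a + of_nat n) / (c + of_nat n) * ((b + of_nat n) / (1 + of_nat n)) * w) * (fps_nth (hyp_fps a b c) n * w ^ n)"
      by (simp add: hyp_fps_Suc[OF c] add_ac)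
    then show "norm (fps_nth (hyp_fps a b c) (Suc n) * w ^ Suc n) \<le> r * norm (fps_nth (hyp_fps a b c) n * w ^ n)"
      using N[OF \<open>n \<ge> N\<close>] by (simp only: norm_mult) (intro mult_right_mono; simp add: norm_mult)
  qed
qed

lemma hyp_fps_conv_radius:
  assumes c: "c \<notin> \<int>\<^sub>\<le>\<^sub>0"
  shows "fps_conv_radius (hyp_fps a b c) \<ge> 1"
  unfolding fps_conv_radius_def
  by (intro conv_radius_geI_ex' hyp_fps_summable c) auto

definition hyps :: "complex \<Rightarrow> complex \<Rightarrow> complex \<Rightarrow> complex \<Rightarrow> complex" where
  "hyps a b c = eval_fps (hyp_fps a b c)"

lemma hyps_0 [simp]: "hyps a b c 0 = 1"
  by (simp add: hyps_def eval_fps_at_0)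

text \<open>The derivatives are delivered as functions \<open>f1\<close> and \<open>f2\<close>
  instead of iterated \<open>deriv\<close>, so that the chain rule applies to them directly after a
  change of variable.\<close>

lemma hyps_ode:
  assumes c: "c \<notin> \<int>\<^sub>\<le>\<^sub>0"
  obtains f1 f2 where
    "\<And>w. norm w < 1 \<Longrightarrow> (hyps a b c has_field_derivative f1 w) (at w)"
    "\<And>w. norm w < 1 \<Longrightarrow> (f1 has_field_derivative f2 w) (at w)"
    "\<And>w. norm w < 1 \<Longrightarrow> w * (1 - w) * f2 w + (c - (a + b + 1) * w) * f1 w - a * b * hyps a b c w = 0"
proof -
  let ?F = "hyp_fps a b c"
  have r: "norm w < fps_conv_radius ?F" if "norm w < 1" for w :: complex
    using hyp_fps_conv_radius[OF c, of a b] that by (metis less_ereal.simps(1) less_le_trans one_ereal_def)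
  have r1: "norm w < fps_conv_radius (fps_deriv ?F)" if "norm w < 1" for w :: complex
    using fps_conv_radius_deriv[of ?F] r[OF that] by order
  have r2: "norm w < fps_conv_radius (fps_deriv (fps_deriv ?F))" if "norm w < 1" for w :: complex
    using fps_conv_radius_deriv[of "fps_deriv ?F"] r1[OF that] by order
  have hf: "hyps a b c has_fps_expansion ?F"
    unfolding hyps_def using r[of 0] by (intro eval_fps_has_fps_expansion) (simp add: zero_ereal_def)
  show ?thesis
  proof (rule that)
    fix w :: complex assume w: "norm w < 1"
    show "(hyps a b c has_field_derivative eval_fps (fps_deriv ?F) w) (at w)"
      unfolding hyps_def using r w by (intro has_field_derivative_eval_fps)
    show "(eval_fps (fps_deriv ?F) has_field_derivative eval_fps (fps_deriv (fps_deriv ?F)) w) (at w)"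
      using r1 w by (intro has_field_derivative_eval_fps)
    have "eval_fps (fps_X * (1 - fps_X) * fps_deriv (fps_deriv ?F)
        + (fps_const c - fps_const (a + b + 1) * fps_X) * fps_deriv ?F - fps_const (a * b) * ?F) w = 
       w * (1 - w) * eval_fps (fps_deriv (fps_deriv ?F)) w + (c - (a + b + 1) * w) * eval_fps (fps_deriv ?F) w - a * b * hyps a b c w"
      (is "eval_fps ?G w = ?g w")
    proof (rule has_fps_expansion_imp_eval_fps_eq[OF _ w])
      show "?g has_fps_expansion ?G"
        using r1[of 0] r2[of 0] hf by (intro fps_expansion_intros eval_fps_has_fps_expansion) (simp_all add: zero_ereal_def)
      show "?g holomorphic_on ball 0 1" unfolding hyps_def
        by (intro holomorphic_intros; use r r1 r2 in force)
    qed
    then show "?g w = 0" by (simp add: hyp_fps_ode[OF c])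
  qed
qed

section \<open>Quadratic transformation and analytic continuation\<close>

definition slit :: "complex set" where "slit = UNIV - complex_of_real ` {1..}"

lemma slit_iff: "w \<in> slit \<longleftrightarrow> 1 - w \<notin> \<real>\<^sub>\<le>\<^sub>0"
proof -
  have "w \<in> complex_of_real ` {1..} \<longleftrightarrow> Im w = 0 \<and> Re w \<ge> 1"
    by (auto simp: image_iff complex_eq_iff intro!: bexI[of _ "Re w"])
  then show ?thesis by (auto simp: slit_def complex_nonpos_Reals_iff)
qed

lemma open_slit: "open slit"
proof -
  have "slit = (\<lambda>w. 1 - w) -` (- \<real>\<^sub>\<le>\<^sub>0)" by (auto simp: slit_iff)
  moreover have "open ((\<lambda>w::complex. 1 - w) -` (- \<real>\<^sub>\<le>\<^sub>0))"
    by (intro continuous_open_vimage continuous_intros) auto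
  ultimately show ?thesis by simp
qed

lemma zero_in_slit [simp]: "0 \<in> slit"
  by (simp add: slit_iff complex_nonpos_Reals_iff)

lemma ball_subset_slit: "norm w < 1 \<Longrightarrow> w \<in> slit"
  using complex_Re_le_cmod[of w] by (auto simp: slit_iff complex_nonpos_Reals_iff)

lemma connected_slit: "connected slit"
proof -
  have "starlike slit"
    unfolding starlike_def
  proof (intro bexI[of _ 0] ballI subsetI)
    fix w z assume w: "w \<in> slit" and "z \<in> closed_segment 0 w"
    then obtain u :: real where u: "0 \<le> u" "u \<le> 1" "z = of_real u * w"
      by (auto simp: in_segment scaleR_conv_of_real)
    have "u * Re w < 1" if "Im w = 0" 
    proof (cases "Re w > 0")
      case True
      then have "u * Re w \<le> Re w" using u by (simp add: mult_left_le_one_le)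
      then show ?thesis using w that by (auto simp: slit_iff complex_nonpos_Reals_iff)
    next
      case False
      then have "u * Re w \<le> 0" using u by (simp add: mult_nonneg_nonpos)
      then show ?thesis by simp
    qed
    moreover have "Re w < 1" if "Im w = 0" using w that by (auto simp: slit_iff complex_nonpos_Reals_iff)
    ultimately show "z \<in> slit" using u by (auto simp: slit_iff complex_nonpos_Reals_iff)
  qed simp
  then show ?thesis by (rule starlike_imp_connected)
qed

text \<open>A principal square root has nonnegative real part, and the real part is 0 only if the
  square is a nonpositive real, which the cut excludes for 1 - w.\<close>

lemma slit_csqrt_pos: "w \<in> slit \<Longrightarrow> Re (csqrt (1 - w)) > 0"
  using csqrt_principal[of "1 - w"] csqrt_in_nonpos_Reals_iff
  by (smt (verit) slit_iff complex_nonpos_Reals_iff power2_csqrt Re_power2 Im_power2 mult_eq_0_iff zero_le_power2 power_zero_numeral)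

lemma norm_mobius_lt_1:
  assumes "Re s > 0"
  shows "norm ((1 - s) / (1 + s)) < 1"
proof -
  have "(norm (1 - s))\<^sup>2 < (norm (1 + s))\<^sup>2"
    unfolding cmod_power2 using assms by (simp add: power2_eq_square algebra_simps)
  then have "norm (1 - s) < norm (1 + s)" by (rule power_less_imp_less_base) simp
  then show ?thesis by (simp add: norm_divide divide_less_eq)
qed

text \<open>The quadratic transformation of ${}_2F_1(p/2,(p+1)/2;c;w)$. Its series argument has modulus
  less than 1 for every \<open>w\<close> off the cut, so this single series is the whole continuation.\<close>
definition hypQ :: "complex \<Rightarrow> complex \<Rightarrow> complex \<Rightarrow> complex" where
  "hypQ p c w = (let s = csqrt (1 - w) in
     ((1 + s) / 2) powr (- p) * hyps p (p - c + 1) c ((1 - s) / (1 + s)))"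

text \<open>The change of variable with the calculus removed. Here s stands for the root of 1 - w,
  \<open>g1\<close> is the logarithmic derivative in w of ((1 + s)/2)^(-p), \<open>g2\<close> is
  dt/dw, and \<open>d1\<close>, \<open>d2\<close> are the derivatives of \<open>g1\<close>,
  \<open>g2\<close>; \<phi>, \<phi>1, \<phi>2 are a function of t and its derivatives. The equation
  in w is a multiple of the one in t, and comparing the three coefficients separately leaves only
  rational identities in s.\<close>

lemma hypQ_ode_algebra:
  fixes s p c \<phi> \<phi>1 \<phi>2 P :: complex
  assumes nz: "s \<noteq> 0" "1 + s \<noteq> 0"
  defines "t \<equiv> (1 - s) / (1 + s)" and "w \<equiv> 1 - s\<^sup>2"
  defines "g1 \<equiv> p / (2 * s * (1 + s))" and "g2 \<equiv> 1 / (s * (1 + s)\<^sup>2)"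
  defines "d1 \<equiv> p * (1 + 2 * s) / (4 * s ^ 3 * (1 + s)\<^sup>2)" and "d2 \<equiv> (1 + 3 * s) / (2 * s ^ 3 * (1 + s) ^ 3)"
  assumes ode: "t * (1 - t) * \<phi>2 + (c - (p + (p - c + 1) + 1) * t) * \<phi>1 - p * (p - c + 1) * \<phi> = 0"
  shows "w * (1 - w) * (P * ((g1\<^sup>2 + d1) * \<phi> + (2 * g1 * g2 + d2) * \<phi>1 + g2\<^sup>2 * \<phi>2))
    + (c - (p / 2 + (p + 1) / 2 + 1) * w) * (P * (g1 * \<phi> + g2 * \<phi>1)) - p / 2 * ((p + 1) / 2) * (P * \<phi>) = 0"
proof -
  \<comment> \<open>The ratio of the two equations, read off from the coefficients of \<phi>2: w(1 -
    w) \<open>g2\<close>^2 = (1 - s)/(1 + s)^3 against t(1 - t) = 2s(1 - s)/(1 + s)^2.\<close>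
  define f where "f = 1 / (2 * s * (1 + s))"
  have k2: "w * (1 - w) * g2\<^sup>2 = f * (t * (1 - t))"
    unfolding w_def g2_def t_def f_def using nz by (simp add: divide_simps) algebra
  have k1: "w * (1 - w) * (2 * g1 * g2 + d2) + (c - (p / 2 + (p + 1) / 2 + 1) * w) * g2
      = f * (c - (p + (p - c + 1) + 1) * t)"
    unfolding w_def g1_def g2_def d2_def t_def f_def using nz by (simp add: divide_simps) algebra
  have k0: "w * (1 - w) * (g1\<^sup>2 + d1) + (c - (p / 2 + (p + 1) / 2 + 1) * w) * g1 - p / 2 * ((p + 1) / 2)
      = - f * (p * (p - c + 1))"
    unfolding w_def g1_def d1_def t_def f_def using nz by (simp add: divide_simps) algebra
  have ring: "W * (P * (A * \<phi> + B * \<phi>1 + C * \<phi>2)) + L * (P * (g1 * \<phi> + g2 * \<phi>1)) - K * (P * \<phi>)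
      = P * ((W * C) * \<phi>2 + (W * B + L * g2) * \<phi>1 + (W * A + L * g1 - K) * \<phi>)" for W A B C L K
    by (simp add: algebra_simps)
  have "w * (1 - w) * (P * ((g1\<^sup>2 + d1) * \<phi> + (2 * g1 * g2 + d2) * \<phi>1 + g2\<^sup>2 * \<phi>2))
    + (c - (p / 2 + (p + 1) / 2 + 1) * w) * (P * (g1 * \<phi> + g2 * \<phi>1)) - p / 2 * ((p + 1) / 2) * (P * \<phi>)
    = P * ((w * (1 - w) * g2\<^sup>2) * \<phi>2
      + (w * (1 - w) * (2 * g1 * g2 + d2) + (c - (p / 2 + (p + 1) / 2 + 1) * w) * g2) * \<phi>1
      + (w * (1 - w) * (g1\<^sup>2 + d1) + (c - (p / 2 + (p + 1) / 2 + 1) * w) * g1 - p / 2 * ((p + 1) / 2)) * \<phi>)"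
    by (rule ring)
  also have "\<dots> = P * (f * (t * (1 - t) * \<phi>2 + (c - (p + (p - c + 1) + 1) * t) * \<phi>1 - p * (p - c + 1) * \<phi>))"
    unfolding k0 k1 k2 by algebra
  also have "\<dots> = 0" unfolding ode by simp
  finally show ?thesis .
qed

lemma hypQ_ode:
  assumes c: "c \<notin> \<int>\<^sub>\<le>\<^sub>0"
  obtains f1 f2 where
    "\<And>w. w \<in> slit \<Longrightarrow> (hypQ p c has_field_derivative f1 w) (at w)"
    "\<And>w. w \<in> slit \<Longrightarrow> (f1 has_field_derivative f2 w) (at w)"
    "\<And>w. w \<in> slit \<Longrightarrow> w * (1 - w) * f2 w + (c - (p / 2 + (p + 1) / 2 + 1) * w) * f1 w
       - p / 2 * ((p + 1) / 2) * hypQ p c w = 0"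
proof -
  obtain \<phi>1 \<phi>2 where
    \<phi>: "\<And>w. norm w < 1 \<Longrightarrow> (hyps p (p - c + 1) c has_field_derivative \<phi>1 w) (at w)"
    "\<And>w. norm w < 1 \<Longrightarrow> (\<phi>1 has_field_derivative \<phi>2 w) (at w)"
    "\<And>w. norm w < 1 \<Longrightarrow> w * (1 - w) * \<phi>2 w + (c - (p + (p - c + 1) + 1) * w) * \<phi>1 w
       - p * (p - c + 1) * hyps p (p - c + 1) c w = 0"
    using hyps_ode[OF c] by blast
  define s where "s = (\<lambda>w::complex. csqrt (1 - w))"
  define P where "P = (\<lambda>w. ((1 + s w) / 2) powr (- p))"
  define t where "t = (\<lambda>w. (1 - s w) / (1 + s w))"
  define g1 where "g1 = (\<lambda>w. p / (2 * s w * (1 + s w)))"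
  define g2 where "g2 = (\<lambda>w. 1 / (s w * (1 + s w)\<^sup>2))"
  define d1 where "d1 = (\<lambda>w. p * (1 + 2 * s w) / (4 * s w ^ 3 * (1 + s w)\<^sup>2))"
  define d2 where "d2 = (\<lambda>w. (1 + 3 * s w) / (2 * s w ^ 3 * (1 + s w) ^ 3))"
  define h where "h = hyps p (p - c + 1) c"
  have hypQ_eq: "hypQ p c = (\<lambda>w. P w * h (t w))"
    by (simp add: hypQ_def P_def t_def s_def h_def Let_def fun_eq_iff)
  show ?thesis
  proof (rule that)
    fix w assume w: "w \<in> slit"
    have re: "Re (s w) > 0" using slit_csqrt_pos[OF w] by (simp add: s_def)
    then have nz: "s w \<noteq> 0" "1 + s w \<noteq> 0" by (auto simp: complex_eq_iff)
    have tn: "norm (t w) < 1" unfolding t_def using norm_mobius_lt_1[OF re] .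
    have ds: "(s has_field_derivative - 1 / (2 * s w)) (at w)"
      unfolding s_def using w by (auto intro!: derivative_eq_intros simp: slit_iff)
    have dP: "(P has_field_derivative P w * g1 w) (at w)"
    proof -
      have "(P has_field_derivative (- p) * ((1 + s w) / 2) powr (- p - 1) * ((- 1 / (2 * s w)) / 2)) (at w)"
        unfolding P_def
        by (rule DERIV_chain2[OF has_field_derivative_powr], use re in \<open>simp add: complex_nonpos_Reals_iff\<close>)
           (auto intro!: derivative_eq_intros ds)
      also have "(- p) * ((1 + s w) / 2) powr (- p - 1) * ((- 1 / (2 * s w)) / 2) = P w * g1 w"
        using nz by (simp add: powr_diff P_def g1_def field_simps)
      finally show ?thesis .
    qed
    have dt: "(t has_field_derivative g2 w) (at w)"
      unfolding t_def g2_def using nz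
      by (auto intro!: derivative_eq_intros ds) (simp add: divide_simps, algebra)
    have dg1: "(g1 has_field_derivative d1 w) (at w)"
      unfolding g1_def d1_def using nz
      by (auto intro!: derivative_eq_intros ds) (simp add: divide_simps, algebra)
    have dg2: "(g2 has_field_derivative d2 w) (at w)"
      unfolding g2_def d2_def using nz
      by (auto intro!: derivative_eq_intros ds) (simp add: divide_simps, algebra)
    have dh: "((\<lambda>w. h (t w)) has_field_derivative \<phi>1 (t w) * g2 w) (at w)"
      unfolding h_def by (rule DERIV_chain2[OF \<phi>(1) dt]) (rule tn)
    have dh1: "((\<lambda>w. \<phi>1 (t w)) has_field_derivative \<phi>2 (t w) * g2 w) (at w)"
      by (rule DERIV_chain2[OF \<phi>(2) dt]) (rule tn)
    show "(hypQ p c has_field_derivative P w * (g1 w * h (t w) + g2 w * \<phi>1 (t w))) (at w)"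
      unfolding hypQ_eq by (auto intro!: derivative_eq_intros dP dh simp: algebra_simps)
    show "((\<lambda>w. P w * (g1 w * h (t w) + g2 w * \<phi>1 (t w))) has_field_derivative
      P w * (((g1 w)\<^sup>2 + d1 w) * h (t w) + (2 * g1 w * g2 w + d2 w) * \<phi>1 (t w) + (g2 w)\<^sup>2 * \<phi>2 (t w))) (at w)"
      by (auto intro!: derivative_eq_intros dP dh dh1 dg1 dg2 simp: algebra_simps power2_eq_square)
    have "1 - (s w)\<^sup>2 = w" by (simp add: s_def)
    with hypQ_ode_algebra[OF nz \<phi>(3)[OF tn, unfolded t_def], of "P w"]
    show "w * (1 - w) * (P w * (((g1 w)\<^sup>2 + d1 w) * h (t w) + (2 * g1 w * g2 w + d2 w) * \<phi>1 (t w) + (g2 w)\<^sup>2 * \<phi>2 (t w)))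
        + (c - (p / 2 + (p + 1) / 2 + 1) * w) * (P w * (g1 w * h (t w) + g2 w * \<phi>1 (t w)))
        - p / 2 * ((p + 1) / 2) * hypQ p c w = 0"
      by (simp add: hypQ_eq g1_def g2_def d1_def d2_def t_def h_def)
  qed
qed

lemma hypQ_holomorphic [holomorphic_intros]:
  assumes "c \<notin> \<int>\<^sub>\<le>\<^sub>0" "g holomorphic_on A" "\<And>z. z \<in> A \<Longrightarrow> g z \<in> slit"
  shows "(\<lambda>z. hypQ p c (g z)) holomorphic_on A"
proof -
  have "hypQ p c holomorphic_on slit"
    using hypQ_ode[OF assms(1), of p] open_slit holomorphic_on_open by metis
  with assms(2,3) show ?thesis
    using holomorphic_on_compose_gen[unfolded o_def] by blast
qed

lemma hypQ_0 [simp]: "hypQ p c 0 = 1"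
  by (simp add: hypQ_def)

text \<open>The quadratic transformation is obtained without manipulating series:
  \<open>hypQ\<close> satisfies the hypergeometric equation near 0 and takes the value 1 there, so
  uniqueness of the power series solution identifies its Taylor coefficients.\<close>

lemma hypQ_fps:
  assumes c: "c \<notin> \<int>\<^sub>\<le>\<^sub>0"
  shows "hypQ p c has_fps_expansion hyp_fps (p / 2) ((p + 1) / 2) c"
proof -
  obtain f1 f2 where f:
    "\<And>w. w \<in> slit \<Longrightarrow> (hypQ p c has_field_derivative f1 w) (at w)"
    "\<And>w. w \<in> slit \<Longrightarrow> (f1 has_field_derivative f2 w) (at w)"
    "\<And>w. w \<in> slit \<Longrightarrow> w * (1 - w) * f2 w + (c - (p / 2 + (p + 1) / 2 + 1) * w) * f1 w
       - p / 2 * ((p + 1) / 2) * hypQ p c w = 0"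
    using hypQ_ode[OF c, of p] by blast
  have ev: "\<forall>\<^sub>F w in nhds 0. w \<in> slit"
    by (intro eventually_nhds_in_open open_slit) simp
  have ev1: "\<forall>\<^sub>F w in nhds 0. deriv (hypQ p c) w = f1 w"
    using ev by eventually_elim (intro DERIV_imp_deriv f)
  have ev2: "\<forall>\<^sub>F w in nhds 0. deriv (deriv (hypQ p c)) w = f2 w"
  proof -
    \<comment> \<open>Differentiating once more needs the first derivatives to agree in a
      neighbourhood of each nearby point, hence the nested filter.\<close>
    have "\<forall>\<^sub>F w in nhds 0. \<forall>\<^sub>F w in nhds w. deriv (hypQ p c) w = f1 w"
      using ev1 by (subst eventually_eventually)
    then show ?thesis
      using ev by eventually_elim (metis DERIV_imp_deriv f(2) deriv_cong_ev)
  qed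
  have "hypQ p c holomorphic_on slit" by (intro holomorphic_intros c) auto
  then have "hypQ p c has_fps_expansion fps_expansion (hypQ p c) 0" (is "_ has_fps_expansion ?F")
    using open_slit by (intro has_fps_expansion_fps_expansion) auto
  note F = this
  have "(\<lambda>w. w * (1 - w) * deriv (deriv (hypQ p c)) w + (c - (p / 2 + (p + 1) / 2 + 1) * w) * deriv (hypQ p c) w
       - p / 2 * ((p + 1) / 2) * hypQ p c w) has_fps_expansion
     fps_X * (1 - fps_X) * fps_deriv (fps_deriv ?F)
        + (fps_const c - fps_const (p / 2 + (p + 1) / 2 + 1) * fps_X) * fps_deriv ?F - fps_const (p / 2 * ((p + 1) / 2)) * ?F"
     (is "?f has_fps_expansion ?G")
    by (intro fps_expansion_intros F)
  also have "?f has_fps_expansion ?G \<longleftrightarrow> (\<lambda>_. 0) has_fps_expansion ?G"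
    by (intro has_fps_expansion_cong refl) (use ev ev1 ev2 in eventually_elim, simp only: f(3))
  finally have "?G = 0"
    using fps_expansion_unique_complex has_fps_expansion_0 by blast
  moreover have "fps_nth ?F 0 = 1"
    using fps_nth_fps_expansion[OF F, of 0] by simp
  ultimately have "?F = hyp_fps (p / 2) ((p + 1) / 2) c"
    using hyp_fps_unique[OF c] by blast
  with F show ?thesis by simp
qed

lemma slit_eqI:
  assumes "f has_fps_expansion F" "g has_fps_expansion F" "f holomorphic_on slit" "g holomorphic_on slit" "w \<in> slit"
  shows "f w = g w"
proof -
  have "(\<lambda>w. f w - g w) w = 0"
  proof (rule has_fps_expansion_0_analytic_continuation[where f = "\<lambda>w. f w - g w", OF _ _ open_slit connected_slit])
    show "(\<lambda>w. f w - g w) has_fps_expansion 0"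
      using has_fps_expansion_diff[OF assms(1,2)] by simp
  qed (use assms in \<open>auto intro!: holomorphic_intros\<close>)
  then show ?thesis by simp
qed

text \<open>\<open>hypQ\<close> is a witness for the property behind the choice, and by the identity
  theorem any other witness agrees with it off the cut. Both orders of the upper parameters occur:
  \<open>legendreQ\<close> and the theorem list them differently.\<close>

lemma hyp2F1_eq_hypQ:
  assumes c: "c \<notin> \<int>\<^sub>\<le>\<^sub>0" and w: "w \<in> slit"
  shows "hyp2F1 (p / 2) ((p + 1) / 2) c w = hypQ p c w"
    and "hyp2F1 ((p + 1) / 2) (p / 2) c w = hypQ p c w"
proof -
  have main: "g w = hypQ p c w" if g: "g holomorphic_on slit"
    and "\<And>w. norm w < 1 \<Longrightarrow> (\<lambda>n. pochhammer (p/2) n * pochhammer ((p+1)/2) n / pochhammer c n * w ^ n / fact n) sums g w"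
    for g
  proof (rule slit_eqI[OF _ hypQ_fps[OF c, of p] g _ w])
    show "hypQ p c holomorphic_on slit" by (intro holomorphic_intros c) auto
    have "\<forall>\<^sub>F u in nhds (0::complex). norm u < 1"
      using eventually_nhds_in_open[of "ball 0 1" "0::complex"] by simp
    then have "\<forall>\<^sub>F u in nhds 0. (\<lambda>n. fps_nth (hyp_fps (p / 2) ((p + 1) / 2) c) n * u ^ n) sums g u"
      by eventually_elim (use that(2) in \<open>simp add: hyp_fps_def\<close>)
    then show "g has_fps_expansion hyp_fps (p / 2) ((p + 1) / 2) c"
      by (rule has_fps_expansionI)
  qed
  let ?P = "\<lambda>a b f. f holomorphic_on slit \<and>
     (\<forall>w. norm w < 1 \<longrightarrow>
        (\<lambda>n. pochhammer a n * pochhammer b n / pochhammer c n * w ^ n / fact n) sums f w)"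
  have ex: "?P (p / 2) ((p + 1) / 2) (hypQ p c)"
  proof (intro conjI allI impI)
    show "hypQ p c holomorphic_on slit" by (intro holomorphic_intros c) auto
    fix w :: complex assume w: "norm w < 1"
    have "hypQ p c holomorphic_on eball 0 (ereal 1)" 
      by (intro holomorphic_intros c) (auto intro: ball_subset_slit)
    from has_fps_expansion_imp_sums_complex[OF hypQ_fps[OF c] this] w
    show "(\<lambda>n. pochhammer (p/2) n * pochhammer ((p+1)/2) n / pochhammer c n * w ^ n / fact n) sums hypQ p c w"
      by (simp add: hyp_fps_def)
  qed
  have "?P (p / 2) ((p + 1) / 2) (hyp2F1 (p / 2) ((p + 1) / 2) c)"
    unfolding hyp2F1_def slit_def[symmetric] using ex by (rule someI[of "?P (p / 2) ((p + 1) / 2)"])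
  then show *: "hyp2F1 (p / 2) ((p + 1) / 2) c w = hypQ p c w"
    by (intro main) auto
  have "hyp2F1 ((p + 1) / 2) (p / 2) = hyp2F1 (p / 2) ((p + 1) / 2)"
    by (intro ext) (simp add: hyp2F1_def mult.commute)
  with * show "hyp2F1 ((p + 1) / 2) (p / 2) c w = hypQ p c w" by simp
qed

section \<open>Contiguous relations\<close>

text \<open>Contiguous relations are verified on these Taylor coefficients and carried to the whole
  cut plane by \<open>slit_eqI\<close>, so that the continuation itself is never expanded.\<close>

definition quad_fps :: "complex \<Rightarrow> complex \<Rightarrow> complex fps" where
  "quad_fps p c = hyp_fps (p / 2) ((p + 1) / 2) c"

lemma quad_fps_0 [simp]: "fps_nth (quad_fps p c) 0 = 1"
  by (simp add: quad_fps_def)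

lemma quad_fps_Suc:
  assumes "c \<notin> \<int>\<^sub>\<le>\<^sub>0"
  shows "4 * (c + of_nat n) * (of_nat n + 1) * fps_nth (quad_fps p c) (Suc n) =
    (p + 2 * of_nat n) * (p + 1 + 2 * of_nat n) * fps_nth (quad_fps p c) n"
  using hyp_fps_rec[OF assms, of n "p / 2" "(p + 1) / 2"]
  unfolding quad_fps_def by (simp add: field_simps)

text \<open>Raising p by 1 turns the pair p/2, (p + 1)/2 into (p + 1)/2, p/2 + 1: one upper
  parameter is kept and the other moves by one. The factor p stays on the left so that p = 0 is
  covered.\<close>

lemma quad_fps_shift_p:
  "p * fps_nth (quad_fps (p + 1) c) n = (p + 2 * of_nat n) * fps_nth (quad_fps p c) n"
proof -
  define X Y B D where "X = pochhammer (p / 2) n" and "Y = pochhammer (p / 2 + 1) n"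
    and "B = pochhammer ((p + 1) / 2) n" and "D = pochhammer c n * fact n"
  have "p / 2 * Y = (p / 2 + of_nat n) * X"
    unfolding X_def Y_def using pochhammer_rec[of "p / 2" n] pochhammer_rec'[of "p / 2" n] by simp
  then have "p * Y = (p + 2 * of_nat n) * X" by (simp add: field_simps)
  then have "p * Y * (B / D) = (p + 2 * of_nat n) * X * (B / D)" by simp
  moreover have "quad_fps (p + 1) c = hyp_fps ((p + 1) / 2) (p / 2 + 1) c"
    by (simp add: quad_fps_def add_divide_distrib add_ac)
  ultimately show ?thesis
    unfolding quad_fps_def[of p] hyp_fps_def by (simp add: X_def Y_def B_def D_def mult_ac)
qed

lemma quad_fps_shift_c:
  assumes "c \<notin> \<int>\<^sub>\<le>\<^sub>0"
  shows "(c + of_nat n) * fps_nth (quad_fps p (c + 1)) n = c * fps_nth (quad_fps p c) n"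
proof -
  define C C' N where "C = pochhammer c n" and "C' = pochhammer (c + 1) n"
    and "N = pochhammer (p / 2) n * pochhammer ((p + 1) / 2) n / fact n"
  have "c * C' = (c + of_nat n) * C"
    unfolding C_def C'_def using pochhammer_rec[of c n] pochhammer_rec'[of c n] by simp
  moreover have "c + 1 \<notin> \<int>\<^sub>\<le>\<^sub>0" using assms by (metis plus_one_in_nonpos_Ints_imp)
  then have "C \<noteq> 0" "C' \<noteq> 0"
    unfolding C_def C'_def using assms pochhammer_eq_0_imp_nonpos_Int by blast+
  ultimately have "(c + of_nat n) / C' = c / C" by (simp add: divide_simps)
  then have "(c + of_nat n) / C' * N = c / C * N" by simp
  then show ?thesis
    unfolding quad_fps_def hyp_fps_def by (simp add: C_def C'_def N_def mult_ac)
qed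

lemma hypQ_quad_fps:
  "c \<notin> \<int>\<^sub>\<le>\<^sub>0 \<Longrightarrow> hypQ p c has_fps_expansion quad_fps p c"
  unfolding quad_fps_def by (rule hypQ_fps)

lemma hypQ_has_deriv:
  assumes "c \<notin> \<int>\<^sub>\<le>\<^sub>0" "w \<in> slit"
  shows "(hypQ p c has_field_derivative deriv (hypQ p c) w) (at w)"
proof -
  have "hypQ p c holomorphic_on slit" by (intro holomorphic_intros assms) auto
  then show ?thesis using open_slit assms(2) by (rule holomorphic_derivI)
qed

text \<open>The operator p + 2w d/dw multiplies coefficient n by p + 2n. It is the operator that
  appears when z^(-p) F(1/z^2) is differentiated in z.\<close>

lemma hypQ_deriv_rel:
  assumes c: "c \<notin> \<int>\<^sub>\<le>\<^sub>0" and w: "w \<in> slit"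
  shows "p * hypQ p c w + 2 * w * deriv (hypQ p c) w = p * hypQ (p + 1) c w"
proof -
  have "fps_const p * quad_fps p c + fps_const 2 * fps_X * fps_deriv (quad_fps p c) = fps_const p * quad_fps (p + 1) c"
  proof (rule fps_ext)
    fix n show "fps_nth (fps_const p * quad_fps p c + fps_const 2 * fps_X * fps_deriv (quad_fps p c)) n = fps_nth (fps_const p * quad_fps (p + 1) c) n"
      using quad_fps_shift_p[of p c n] by (cases n) (simp_all add: mult.assoc algebra_simps)
  qed
  moreover have "(\<lambda>w. p * hypQ p c w + 2 * w * deriv (hypQ p c) w) has_fps_expansion
     fps_const p * quad_fps p c + fps_const 2 * fps_X * fps_deriv (quad_fps p c)"
    by (intro fps_expansion_intros hypQ_quad_fps c)
  moreover have "(\<lambda>w. p * hypQ (p + 1) c w) has_fps_expansion fps_const p * quad_fps (p + 1) c"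
    by (intro fps_expansion_intros hypQ_quad_fps c)
  ultimately show ?thesis
    by (intro slit_eqI[OF _ _ _ _ w]) (auto intro!: holomorphic_intros c open_slit)
qed

text \<open>A differential equation in algebraic form: for \<open>legA\<close> the functions with p
  + 1 and p + 2 are the first and second derivatives up to the factors -p and p(p + 1).\<close>

lemma hypQ_three_term_p:
  assumes c: "c \<notin> \<int>\<^sub>\<le>\<^sub>0" and w: "w \<in> slit"
  shows "p * (p + 1) * (w - 1) * hypQ (p + 2) c w + (2 * p - 2 * c + 3) * p * hypQ (p + 1) c w
    + (2 * c - 2 - p) * p * hypQ p c w = 0"
proof -
  let ?G = "fps_const (p * (p + 1)) * (fps_X - 1) * quad_fps (p + 2) c + fps_const ((2 * p - 2 * c + 3) * p) * quad_fps (p + 1) c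
    + fps_const ((2 * c - 2 - p) * p) * quad_fps p c"
  have "fps_nth ?G n = 0" for n
  proof -
    define e where "e = fps_nth (quad_fps p c)"
    have e1: "p * fps_nth (quad_fps (p + 1) c) n = (p + 2 * of_nat n) * e n" for n
      unfolding e_def by (rule quad_fps_shift_p)
    have e2: "p * (p + 1) * fps_nth (quad_fps (p + 2) c) n = (p + 1 + 2 * of_nat n) * (p + 2 * of_nat n) * e n" for n
      using quad_fps_shift_p[of "p + 1" c n] e1[of n] by (simp add: add.assoc) algebra
    have "fps_const (p * (p + 1)) * (fps_X - 1) * quad_fps (p + 2) c
       = fps_X * (fps_const (p * (p + 1)) * quad_fps (p + 2) c) - fps_const (p * (p + 1)) * quad_fps (p + 2) c"
      by (simp add: algebra_simps)
    then have G: "fps_nth ?G n = (if n = 0 then 0 else p * (p + 1) * fps_nth (quad_fps (p + 2) c) (n - 1))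
       - p * (p + 1) * fps_nth (quad_fps (p + 2) c) n + (2 * p - 2 * c + 3) * (p * fps_nth (quad_fps (p + 1) c) n)
       + (2 * c - 2 - p) * p * e n"
      by (simp add: e_def)
    show ?thesis
    proof (cases n)
      case 0
      then show ?thesis unfolding G e1 e2 by (simp add: e_def algebra_simps)
    next
      case (Suc m)
      define m' :: complex where "m' = of_nat m"
      have e: "(p + 1 + 2 * m') * (p + 2 * m') * e m = 4 * (c + m') * (m' + 1) * e (Suc m)"
        using quad_fps_Suc[OF c, of m p] unfolding e_def m'_def by (simp add: mult_ac)
      have "fps_nth ?G n = (p + 1 + 2 * m') * (p + 2 * m') * e m
         - (p + 1 + 2 * (m' + 1)) * (p + 2 * (m' + 1)) * e (Suc m)
         + (2 * p - 2 * c + 3) * ((p + 2 * (m' + 1)) * e (Suc m)) + (2 * c - 2 - p) * p * e (Suc m)"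
        unfolding G e1 e2 by (simp add: Suc m'_def add_ac)
      also have "\<dots> = 0" unfolding e by (simp add: algebra_simps)
      finally show ?thesis .
    qed
  qed
  then have "?G = 0" by (simp add: fps_eq_iff)
  moreover have "(\<lambda>w. p * (p + 1) * (w - 1) * hypQ (p + 2) c w + (2 * p - 2 * c + 3) * p * hypQ (p + 1) c w
    + (2 * c - 2 - p) * p * hypQ p c w) has_fps_expansion ?G"
    by (intro fps_expansion_intros hypQ_quad_fps c)
  ultimately show ?thesis
    by (intro slit_eqI[OF _ has_fps_expansion_0 _ _ w]) (auto intro!: holomorphic_intros c open_slit)
qed

text \<open>Expresses the function at c + 1 by the function F at c and its derivative, the
  difference of the terms with p + 1 and p being 2wF'. It serves to transport the boundary value at
  0 from c + 1 down to c.\<close>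

lemma hypQ_shift_c:
  assumes c: "c \<notin> \<int>\<^sub>\<le>\<^sub>0" and w: "w \<in> slit"
  shows "(c - p / 2) * (c - (p + 1) / 2) * (w * hypQ p (c + 1) w) =
    c * ((1 - w) * (p * hypQ (p + 1) c w - p * hypQ p c w) / 2 + (c - p - 1 / 2) * (w * hypQ p c w))"
proof -
  have c1: "c + 1 \<notin> \<int>\<^sub>\<le>\<^sub>0" using c by (metis plus_one_in_nonpos_Ints_imp)
  define k1 where "k1 = (c - p / 2) * (c - (p + 1) / 2)"
  define k2 where "k2 = c * (c - p - 1 / 2)"
  \<comment> \<open>\<open>G\<close> is the series of c w F', written as a difference so that no
    derivative appears.\<close>
  define G where "G = fps_const (p * c / 2) * (quad_fps (p + 1) c - quad_fps p c)"
  have G: "fps_nth G n = c * of_nat n * fps_nth (quad_fps p c) n" for n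
    using quad_fps_shift_p[of p c n] unfolding G_def by (simp add: field_simps)
  have "fps_const k1 * fps_X * quad_fps p (c + 1) = (1 - fps_X) * G + fps_const k2 * fps_X * quad_fps p c"
  proof (rule fps_ext)
    fix n
    have 1: "fps_const k * fps_X * F = fps_X * (fps_const k * F)" "(1 - fps_X) * F = F - fps_X * F" for k and F :: "complex fps"
      by (simp_all add: algebra_simps)
    show "fps_nth (fps_const k1 * fps_X * quad_fps p (c + 1)) n =
        fps_nth ((1 - fps_X) * G + fps_const k2 * fps_X * quad_fps p c) n"
    proof (cases n)
      case (Suc m)
      define e e1 e' where "e = fps_nth (quad_fps p c) m" and "e1 = fps_nth (quad_fps p c) (Suc m)"
        and "e' = fps_nth (quad_fps p (c + 1)) m"
      define m' :: complex where "m' = of_nat m"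
      have nz: "c + m' \<noteq> 0" unfolding m'_def by (rule add_of_nat_neq_0[OF c])
      have r1: "(c + m') * e' = c * e"
        unfolding e'_def e_def m'_def by (rule quad_fps_shift_c[OF c])
      have r2: "4 * (c + m') * (m' + 1) * e1 = (p + 2 * m') * (p + 1 + 2 * m') * e"
        unfolding e1_def e_def m'_def by (rule quad_fps_Suc[OF c])
      have "(c + m') * (k1 * e') = (c + m') * (c * (1 + m') * e1 - c * m' * e + k2 * e)"
      proof -
        have "4 * k1 = (2 * c - p) * (2 * c - p - 1)" "2 * k2 = c * (2 * c - 2 * p - 1)"
          unfolding k1_def k2_def by (simp_all add: field_simps)
        then show ?thesis using r1 r2 by algebra
      qed
      then have "k1 * e' = c * (1 + m') * e1 - c * m' * e + k2 * e" using nz by simp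
      then show ?thesis
        unfolding 1 by (simp add: Suc G e_def e1_def e'_def m'_def)
    qed (simp add: 1 G)
  qed
  moreover have "(\<lambda>w. k1 * w * hypQ p (c + 1) w) has_fps_expansion fps_const k1 * fps_X * quad_fps p (c + 1)"
    by (intro fps_expansion_intros hypQ_quad_fps c1)
  moreover have "(\<lambda>w. (1 - w) * (p * c / 2 * (hypQ (p + 1) c w - hypQ p c w)) + k2 * w * hypQ p c w)
     has_fps_expansion (1 - fps_X) * G + fps_const k2 * fps_X * quad_fps p c"
    unfolding G_def by (intro fps_expansion_intros hypQ_quad_fps c)
  ultimately have "k1 * w * hypQ p (c + 1) w = (1 - w) * (p * c / 2 * (hypQ (p + 1) c w - hypQ p c w)) + k2 * w * hypQ p c w"
    by (intro slit_eqI[OF _ _ _ _ w]) (auto intro!: holomorphic_intros c c1 open_slit)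
  also have "\<dots> = c * ((1 - w) * (p * hypQ (p + 1) c w - p * hypQ p c w) / 2 + (c - p - 1 / 2) * (w * hypQ p c w))"
  proof -
    have "(1 - w) * (p * c / 2 * (G - F)) + (c * L) * w * F = c * ((1 - w) * (p * G - p * F) / 2 + L * (w * F))" for G F L
      by (simp add: field_simps)
    then show ?thesis unfolding k2_def by blast
  qed
  finally show ?thesis unfolding k1_def by (simp only: mult.assoc)
qed

text \<open>With \<open>p = \<nu> + \<mu> + 1\<close> and \<open>c = \<nu> + 3/2\<close> this is $Q_\nu^\mu(z)(z^2-1)^{-\mu/2}$ up to a constant; the
  second term of the theorem is the case \<open>p = \<mu> - \<nu>\<close>, \<open>c = 1/2 - \<nu>\<close>.\<close>
definition legA :: "complex \<Rightarrow> complex \<Rightarrow> complex \<Rightarrow> complex" where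
  "legA p c z = z powr (- p) * hypQ p c (1 / z\<^sup>2)"

section \<open>Derivative and contiguous relations in the variable z\<close>

lemma inverse_square_in_slit:
  assumes "Im z \<noteq> 0"
  shows "1 / z\<^sup>2 \<in> slit"
proof (rule ccontr)
  assume "1 / z\<^sup>2 \<notin> slit"
  then obtain r :: real where r: "r \<ge> 1" "1 / z\<^sup>2 = of_real r" by (auto simp: slit_def)
  have "z \<noteq> 0" using assms by auto
  then have "z\<^sup>2 = of_real (1 / r)" using r by (simp add: field_simps)
  then have "Im (z\<^sup>2) = 0" "Re (z\<^sup>2) > 0" using r by auto
  then show False using assms by (auto simp: Im_power2 Re_power2)
qed

lemma legA_deriv:
  assumes c: "c \<notin> \<int>\<^sub>\<le>\<^sub>0" and z: "Im z \<noteq> 0"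
  shows "(legA p c has_field_derivative - p * legA (p + 1) c z) (at z)"
proof -
  let ?w = "1 / z\<^sup>2"
  have [simp]: "z \<noteq> 0" using z by auto
  have zn: "z \<notin> \<real>\<^sub>\<le>\<^sub>0" using z by (auto simp: complex_nonpos_Reals_iff)
  have w: "?w \<in> slit" by (rule inverse_square_in_slit[OF z])
  have d: "((\<lambda>z. 1 / z\<^sup>2) has_field_derivative - 2 / z ^ 3) (at z)"
    by (auto intro!: derivative_eq_intros simp: field_simps power2_eq_square power3_eq_cube)
  have "((\<lambda>z. z powr (- p) * hypQ p c (1 / z\<^sup>2)) has_field_derivative
     (- p) * z powr (- p - 1) * hypQ p c ?w + z powr (- p) * (deriv (hypQ p c) ?w * (- 2 / z ^ 3))) (at z)"
    by (rule DERIV_cong[OF DERIV_mult'[OF has_field_derivative_powr[OF zn]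
          DERIV_chain2[where f = "hypQ p c" and g = "\<lambda>z. 1 / z\<^sup>2", OF hypQ_has_deriv[OF c w] d]]])
       (simp add: algebra_simps)
  also have "(- p) * z powr (- p - 1) * hypQ p c ?w + z powr (- p) * (deriv (hypQ p c) ?w * (- 2 / z ^ 3))
      = - (z powr (- p - 1)) * (p * hypQ p c ?w + 2 * ?w * deriv (hypQ p c) ?w)"
    by (simp add: powr_diff field_simps power2_eq_square power3_eq_cube)
  also have "\<dots> = - p * legA (p + 1) c z"
    unfolding hypQ_deriv_rel[OF c w] legA_def by simp
  finally show ?thesis by (simp add: legA_def[abs_def])
qed

lemma legA_three_term_p:
  assumes c: "c \<notin> \<int>\<^sub>\<le>\<^sub>0" and z: "Im z \<noteq> 0"
  shows "p * (p + 1) * (1 - z\<^sup>2) * legA (p + 2) c z + (2 * p - 2 * c + 3) * p * z * legA (p + 1) c z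
    + (2 * c - 2 - p) * p * legA p c z = 0"
proof -
  let ?w = "1 / z\<^sup>2"
  have [simp]: "z \<noteq> 0" using z by auto
  have w: "?w \<in> slit" by (rule inverse_square_in_slit[OF z])
  have 1: "z powr (- (p + 1)) = z powr (- p) / z" "z powr (- (p + 2)) = z powr (- p) * ?w"
    by (simp_all add: powr_diff powr_add minus_add_distrib powr_minus field_simps power2_eq_square)
  have "p * (p + 1) * (1 - z\<^sup>2) * legA (p + 2) c z + (2 * p - 2 * c + 3) * p * z * legA (p + 1) c z
    + (2 * c - 2 - p) * p * legA p c z = z powr (- p) * (p * (p + 1) * ((1 - z\<^sup>2) * ?w) * hypQ (p + 2) c ?w 
    + (2 * p - 2 * c + 3) * p * hypQ (p + 1) c ?w + (2 * c - 2 - p) * p * hypQ p c ?w)"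
  proof -
    have "a * t * (Z * w * F) + b * p * z * (Z / z * G) + d * (Z * H) = Z * (a * (t * w) * F + b * p * G + d * H)"
      for a b d t w Z F G H by (simp add: algebra_simps)
    then show ?thesis unfolding legA_def 1 by blast
  qed
  also have "(1 - z\<^sup>2) * ?w = ?w - 1" by (simp add: field_simps)
  finally show ?thesis unfolding hypQ_three_term_p[OF c w] by simp
qed

lemma legA_shift_c:
  assumes c: "c \<notin> \<int>\<^sub>\<le>\<^sub>0" and z: "Im z \<noteq> 0"
  shows "(c - p / 2) * (c - (p + 1) / 2) * legA p (c + 1) z =
    c * ((z\<^sup>2 - 1) * (z * (p * legA (p + 1) c z) - p * legA p c z) / 2 + (c - p - 1 / 2) * legA p c z)"
proof -
  let ?w = "1 / z\<^sup>2"
  have [simp]: "z \<noteq> 0" using z by auto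
  have w: "?w \<in> slit" by (rule inverse_square_in_slit[OF z])
  have 1: "z powr (- (p + 1)) = z powr (- p) / z"
    by (simp_all add: powr_diff powr_add minus_add_distrib powr_minus field_simps power2_eq_square)
  have "(c - p / 2) * (c - (p + 1) / 2) * legA p (c + 1) z = z\<^sup>2 * z powr (- p) * ((c - p / 2) * (c - (p + 1) / 2) * (?w * hypQ p (c + 1) ?w))"
    unfolding legA_def by simp
  also have "\<dots> = c * ((z\<^sup>2 * (1 - ?w)) * (z * (z powr (- p) / z * p * hypQ (p + 1) c ?w) - z powr (- p) * p * hypQ p c ?w) / 2 + (c - p - 1 / 2) * (z powr (- p) * hypQ p c ?w))"
    unfolding hypQ_shift_c[OF c w] by (simp add: field_simps)
  also have "z\<^sup>2 * (1 - ?w) = z\<^sup>2 - 1" by (simp add: field_simps)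
  finally show ?thesis unfolding legA_def 1 by (simp add: mult_ac)
qed

section \<open>Solutions of the Legendre-type equation near the origin\<close>

text \<open>The equation (1 - z^2) y'' = (p + q + 1) z y' + p q y, which for p = \<nu> + \<mu> + 1
  and q = \<mu> - \<nu> is Legendre's equation after removal of the factor (1 - z^2)^(\<mu>/2). The
  derivative is carried as a second function, so a solution is a solution of a first-order
  system.\<close>

definition legendre_sol :: "complex set \<Rightarrow> complex \<Rightarrow> complex \<Rightarrow> (complex \<Rightarrow> complex) \<Rightarrow> (complex \<Rightarrow> complex) \<Rightarrow> bool" where
  "legendre_sol S p q y y' \<longleftrightarrow> (\<forall>z\<in>S. (y has_field_derivative y' z) (at z) \<and>
     (y' has_field_derivative ((p + q + 1) * z * y' z + p * q * y z) / (1 - z\<^sup>2)) (at z))"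

lemma norm_square_less_one: "norm (z::complex) < 1 \<Longrightarrow> norm (z\<^sup>2) < 1"
  using mult_strict_mono[of "norm z" 1 "norm z" 1] by (simp add: norm_mult power2_eq_square)

lemma one_minus_square_nonpos:
  fixes z :: complex
  assumes "norm z < 1"
  shows "1 - z\<^sup>2 \<notin> \<real>\<^sub>\<le>\<^sub>0"
proof -
  have "norm (z\<^sup>2) < 1" by (rule norm_square_less_one[OF assms])
  then have "Re (z\<^sup>2) < 1" using complex_Re_le_cmod[of "z\<^sup>2"] by linarith
  then show ?thesis by (auto simp: complex_nonpos_Reals_iff)
qed

text \<open>Abel's identity: the Wronskian satisfies W' = (p + q + 1) z W / (1 - z^2), and the power
  of 1 - z^2 is the integrating factor. Inside the unit disc 1 - z^2 avoids the branch cut of the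
  power.\<close>

lemma legendre_wronskian_const:
  assumes y: "legendre_sol S p q y y'" and v: "legendre_sol S p q v v'"
    and S: "open S" "connected S" "S \<subseteq> ball 0 1"
  obtains k where "\<And>z. z \<in> S \<Longrightarrow> (1 - z\<^sup>2) powr ((p + q + 1) / 2) * (y z * v' z - y' z * v z) = k"
proof -
  define \<alpha> where "\<alpha> = (p + q + 1) / 2"
  define W where "W = (\<lambda>z. (1 - z\<^sup>2) powr \<alpha> * (y z * v' z - y' z * v z))"
  have "(W has_field_derivative 0) (at z)" if z: "z \<in> S" for z
  proof -
    have zn: "1 - z\<^sup>2 \<notin> \<real>\<^sub>\<le>\<^sub>0" using z S by (intro one_minus_square_nonpos) auto
    then have nz: "1 - z\<^sup>2 \<noteq> 0" by auto
    define R where "R = (1 - z\<^sup>2) powr \<alpha>"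
    define K L where "K = (p + q + 1) * z / (1 - z\<^sup>2)" and "L = p * q / (1 - z\<^sup>2)"
    have d1: "((\<lambda>z. (1 - z\<^sup>2) powr \<alpha>) has_field_derivative \<alpha> * (1 - z\<^sup>2) powr (\<alpha> - 1) * (- 2 * z)) (at z)"
      by (rule DERIV_chain2[where g = "\<lambda>z. 1 - z\<^sup>2", OF has_field_derivative_powr[OF zn]]) (auto intro!: derivative_eq_intros)
    have "\<alpha> * (1 - z\<^sup>2) powr (\<alpha> - 1) * (- 2 * z) = - (K * R)"
    proof -
      have "(1 - z\<^sup>2) powr (\<alpha> - 1) = R / (1 - z\<^sup>2)" using nz by (simp add: powr_diff R_def)
      moreover have "p + q + 1 = 2 * \<alpha>" by (simp add: \<alpha>_def)
      ultimately show ?thesis by (simp add: K_def)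
    qed
    with d1 have d1: "((\<lambda>z. (1 - z\<^sup>2) powr \<alpha>) has_field_derivative - (K * R)) (at z)" by simp
    have d2: "(y has_field_derivative y' z) (at z)" "(y' has_field_derivative K * y' z + L * y z) (at z)"
        "(v has_field_derivative v' z) (at z)" "(v' has_field_derivative K * v' z + L * v z) (at z)"
      using y v z unfolding legendre_sol_def K_def L_def by (auto simp: add_divide_distrib)
    have "(W has_field_derivative - (K * R) * (y z * v' z - y' z * v z)
        + (1 - z\<^sup>2) powr \<alpha> * ((y' z * v' z + y z * (K * v' z + L * v z)) - ((K * y' z + L * y z) * v z + y' z * v' z))) (at z)"
      unfolding W_def by (rule d1 d2 derivative_eq_intros refl | simp add: algebra_simps)+
    also have "- (K * R) * (y z * v' z - y' z * v z)
        + (1 - z\<^sup>2) powr \<alpha> * ((y' z * v' z + y z * (K * v' z + L * v z)) - ((K * y' z + L * y z) * v z + y' z * v' z)) = 0"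
      unfolding R_def[symmetric] by (simp add: algebra_simps)
    finally show ?thesis .
  qed
  then have "\<exists>k. \<forall>z\<in>S. W z = k"
    using has_field_derivative_0_imp_constant_on[of S W] S unfolding constant_on_def
    by (metis has_field_derivative_at_within)
  then show ?thesis using that unfolding W_def \<alpha>_def by blast
qed

lemma legendre_sol_subset: "legendre_sol S p q y y' \<Longrightarrow> T \<subseteq> S \<Longrightarrow> legendre_sol T p q y y'"
  by (auto simp: legendre_sol_def)

text \<open>Cramer's rule with constant determinants: the weighted Wronskian of \<open>E\<close> and
  \<open>H\<close> is 1, by evaluation at 0, and a, b are the weighted Wronskians of u with
  \<open>H\<close> and of \<open>E\<close> with u. In this way S need not contain 0, so a solution
  on the half-disc can be expanded without knowing that it extends to 0.\<close>

lemma legendre_sol_basis: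
  assumes E: "legendre_sol (ball 0 1) p q E E'" "E 0 = 1" "E' 0 = 0"
    and H: "legendre_sol (ball 0 1) p q H H'" "H 0 = 0" "H' 0 = 1"
    and u: "legendre_sol S p q u u'" and S: "open S" "connected S" "S \<subseteq> ball 0 1"
  obtains a b where "\<And>z. z \<in> S \<Longrightarrow> u z = a * E z + b * H z" "\<And>z. z \<in> S \<Longrightarrow> u' z = a * E' z + b * H' z"
proof -
  note ES = legendre_sol_subset[OF E(1) S(3)] and HS = legendre_sol_subset[OF H(1) S(3)]
  define R where "R = (\<lambda>z. (1 - z\<^sup>2) powr ((p + q + 1) / 2))"
  obtain k where k: "\<And>z. z \<in> ball 0 1 \<Longrightarrow> R z * (E z * H' z - E' z * H z) = k"
    using legendre_wronskian_const[OF E(1) H(1)] unfolding R_def by auto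
  have "k = 1" using k[of 0] E H by (simp add: R_def)
  with k S have k: "R z * (E z * H' z - E' z * H z) = 1" if "z \<in> S" for z using that by auto
  obtain a where a: "\<And>z. z \<in> S \<Longrightarrow> R z * (u z * H' z - u' z * H z) = a"
    using legendre_wronskian_const[OF u HS S] unfolding R_def by auto
  obtain b where b: "\<And>z. z \<in> S \<Longrightarrow> R z * (E z * u' z - E' z * u z) = b"
    using legendre_wronskian_const[OF ES u S] unfolding R_def by auto
  show ?thesis
  proof (rule that)
    fix z assume z: "z \<in> S"
    note z' = k[OF z] a[OF z] b[OF z]
    show "u z = a * E z + b * H z" using z' by algebra
    show "u' z = a * E' z + b * H' z" using z' by algebra
  qed
qed

text \<open>The substitution Z = z^2 leads to a hypergeometric equation with lower parameter 1/2.
  Its exponents 0 and 1/2 at Z = 0 correspond to the even solution and to the odd one, the latter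
  having upper parameters (p + 1)/2, (q + 1)/2 and lower parameter 3/2.\<close>

lemma legendre_even_sol:
  obtains E E' where "legendre_sol (ball 0 1) p q E E'" "E 0 = 1" "E' 0 = 0" "\<And>z. E (- z) = E z"
proof -
  have half: "1 / 2 \<notin> (\<int>\<^sub>\<le>\<^sub>0 :: complex set)"
    by (metis (no_types) complex_is_Real_iff nonpos_Ints_of_int Re_complex_of_real divide_numeral_1 
        fraction_not_in_Ints[of 2 1] even_Suc nonpos_Ints_Int of_int_1 odd_one of_int_numeral one_dvd zero_neq_numeral)
  obtain f1 f2 where f:
    "\<And>w. norm w < 1 \<Longrightarrow> (hyps (p / 2) (q / 2) (1 / 2) has_field_derivative f1 w) (at w)"
    "\<And>w. norm w < 1 \<Longrightarrow> (f1 has_field_derivative f2 w) (at w)"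
    "\<And>w. norm w < 1 \<Longrightarrow> w * (1 - w) * f2 w + (1 / 2 - (p / 2 + q / 2 + 1) * w) * f1 w
       - p / 2 * (q / 2) * hyps (p / 2) (q / 2) (1 / 2) w = 0"
    using hyps_ode[OF half] by blast
  define f where "f = hyps (p / 2) (q / 2) (1 / 2)"
  show ?thesis
  proof (rule that)
    show "legendre_sol (ball 0 1) p q (\<lambda>z. f (z\<^sup>2)) (\<lambda>z. 2 * z * f1 (z\<^sup>2))"
      unfolding legendre_sol_def
    proof (intro ballI conjI)
      fix z :: complex assume "z \<in> ball 0 1"
      then have z: "norm z < 1" by simp
      then have zz: "norm (z\<^sup>2) < 1" by (rule norm_square_less_one)
      have nz: "1 - z\<^sup>2 \<noteq> 0" using one_minus_square_nonpos[OF z] by auto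
      have d: "((\<lambda>z. z\<^sup>2) has_field_derivative 2 * z) (at z)" by (auto intro!: derivative_eq_intros)
      have d0: "((\<lambda>z. f (z\<^sup>2)) has_field_derivative f1 (z\<^sup>2) * (2 * z)) (at z)"
        unfolding f_def by (rule DERIV_chain2[OF f(1)[OF zz] d])
      then show "((\<lambda>z. f (z\<^sup>2)) has_field_derivative 2 * z * f1 (z\<^sup>2)) (at z)" by (simp add: mult_ac)
      have d1: "((\<lambda>z. f1 (z\<^sup>2)) has_field_derivative f2 (z\<^sup>2) * (2 * z)) (at z)"
        by (rule DERIV_chain2[OF f(2)[OF zz] d])
      define Z where "Z = z\<^sup>2"
      have "2 * (2 * Z * (1 - Z) * f2 Z) - (p + q + 2) * (2 * Z * f1 Z) + 2 * f1 Z - p * q * f Z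
          = 4 * (Z * (1 - Z) * f2 Z + (1 / 2 - (p / 2 + q / 2 + 1) * Z) * f1 Z - p / 2 * (q / 2) * f Z)"
        by (simp add: field_simps)
      also have "\<dots> = 0" using f(3)[OF zz] unfolding f_def Z_def by (simp only: mult_zero_right)
      finally have "(2 * f1 (z\<^sup>2) + 4 * z\<^sup>2 * f2 (z\<^sup>2)) * (1 - z\<^sup>2)
          = (p + q + 1) * z * (2 * z * f1 (z\<^sup>2)) + p * q * f (z\<^sup>2)"
        unfolding Z_def by algebra
      then have "2 * f1 (z\<^sup>2) + 4 * z\<^sup>2 * f2 (z\<^sup>2) = ((p + q + 1) * z * (2 * z * f1 (z\<^sup>2)) + p * q * f (z\<^sup>2)) / (1 - z\<^sup>2)"
        using nz by (simp add: eq_divide_eq)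
      moreover have "((\<lambda>z. 2 * z * f1 (z\<^sup>2)) has_field_derivative 2 * f1 (z\<^sup>2) + 4 * z\<^sup>2 * f2 (z\<^sup>2)) (at z)"
        by (rule d1 derivative_eq_intros refl | simp add: algebra_simps power2_eq_square)+
      ultimately show "((\<lambda>z. 2 * z * f1 (z\<^sup>2)) has_field_derivative
          ((p + q + 1) * z * (2 * z * f1 (z\<^sup>2)) + p * q * f (z\<^sup>2)) / (1 - z\<^sup>2)) (at z)" by simp
    qed
  qed (auto simp: f_def)
qed

lemma legendre_odd_sol:
  obtains H H' where "legendre_sol (ball 0 1) p q H H'" "H 0 = 0" "H' 0 = 1" "\<And>z. H (- z) = - H z"
proof -
  have half: "3 / 2 \<notin> (\<int>\<^sub>\<le>\<^sub>0 :: complex set)"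
    using nonpos_Ints_Int fraction_not_in_Ints[of 2 3] by auto
  obtain f1 f2 where f:
    "\<And>w. norm w < 1 \<Longrightarrow> (hyps ((p + 1) / 2) ((q + 1) / 2) (3 / 2) has_field_derivative f1 w) (at w)"
    "\<And>w. norm w < 1 \<Longrightarrow> (f1 has_field_derivative f2 w) (at w)"
    "\<And>w. norm w < 1 \<Longrightarrow> w * (1 - w) * f2 w + (3 / 2 - ((p + 1) / 2 + (q + 1) / 2 + 1) * w) * f1 w
       - (p + 1) / 2 * ((q + 1) / 2) * hyps ((p + 1) / 2) ((q + 1) / 2) (3 / 2) w = 0"
    using hyps_ode[OF half] by blast
  define f where "f = hyps ((p + 1) / 2) ((q + 1) / 2) (3 / 2)"
  let ?H' = "\<lambda>z. f (z\<^sup>2) + 2 * z\<^sup>2 * f1 (z\<^sup>2)"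
  show ?thesis
  proof (rule that)
    show "legendre_sol (ball 0 1) p q (\<lambda>z. z * f (z\<^sup>2)) ?H'"
      unfolding legendre_sol_def
    proof (intro ballI conjI)
      fix z :: complex assume "z \<in> ball 0 1"
      then have z: "norm z < 1" by simp
      then have zz: "norm (z\<^sup>2) < 1" by (rule norm_square_less_one)
      have nz: "1 - z\<^sup>2 \<noteq> 0" using one_minus_square_nonpos[OF z] by auto
      have d: "((\<lambda>z. z\<^sup>2) has_field_derivative 2 * z) (at z)" by (auto intro!: derivative_eq_intros)
      have d0: "((\<lambda>z. f (z\<^sup>2)) has_field_derivative f1 (z\<^sup>2) * (2 * z)) (at z)"
        unfolding f_def by (rule DERIV_chain2[OF f(1)[OF zz] d])
      show "((\<lambda>z. z * f (z\<^sup>2)) has_field_derivative ?H' z) (at z)"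
        by (rule d0 derivative_eq_intros refl | simp add: algebra_simps power2_eq_square)+
      have d1: "((\<lambda>z. f1 (z\<^sup>2)) has_field_derivative f2 (z\<^sup>2) * (2 * z)) (at z)"
        by (rule DERIV_chain2[OF f(2)[OF zz] d])
      define Z where "Z = z\<^sup>2"
      have "4 * (Z * (1 - Z) * f2 Z) - (2 * p + 2 * q + 8) * Z * f1 Z + 6 * f1 Z - (p + 1) * (q + 1) * f Z
          = 4 * (Z * (1 - Z) * f2 Z + (3 / 2 - ((p + 1) / 2 + (q + 1) / 2 + 1) * Z) * f1 Z - (p + 1) / 2 * ((q + 1) / 2) * f Z)"
        by (simp add: field_simps)
      also have "\<dots> = 0" using f(3)[OF zz] unfolding f_def Z_def by (simp only: mult_zero_right)
      finally have "(6 * f1 Z + 4 * Z * f2 Z) * (1 - Z)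
          = (p + q + 1) * (f Z + 2 * Z * f1 Z) + p * q * f Z"
        by algebra
      then have "(6 * z * f1 Z + 4 * z ^ 3 * f2 Z) * (1 - Z) = (p + q + 1) * z * (f Z + 2 * Z * f1 Z) + p * q * (z * f Z)"
        unfolding Z_def by algebra
      then have "6 * z * f1 (z\<^sup>2) + 4 * z ^ 3 * f2 (z\<^sup>2) = ((p + q + 1) * z * ?H' z + p * q * (z * f (z\<^sup>2))) / (1 - z\<^sup>2)"
        using nz by (simp add: eq_divide_eq Z_def)
      moreover have "(?H' has_field_derivative 6 * z * f1 (z\<^sup>2) + 4 * z ^ 3 * f2 (z\<^sup>2)) (at z)"
        by (rule d0 d1 derivative_eq_intros refl | simp add: algebra_simps power2_eq_square power3_eq_cube)+
      ultimately show "(?H' has_field_derivative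
          ((p + q + 1) * z * ?H' z + p * q * (z * f (z\<^sup>2))) / (1 - z\<^sup>2)) (at z)" by simp
    qed
  qed (auto simp: f_def)
qed

lemma legA_sol:
  assumes c: "c \<notin> \<int>\<^sub>\<le>\<^sub>0"
  shows "legendre_sol ({z. Im z > 0} \<inter> ball 0 1) p (p - 2 * c + 2) (legA p c) (\<lambda>z. - p * legA (p + 1) c z)"
  unfolding legendre_sol_def
proof (intro ballI conjI)
  fix z assume "z \<in> {z. Im z > 0} \<inter> ball 0 1"
  then have z: "Im z \<noteq> 0" "norm z < 1" by auto
  have nz: "1 - z\<^sup>2 \<noteq> 0" using one_minus_square_nonpos[OF z(2)] by auto
  show "(legA p c has_field_derivative - p * legA (p + 1) c z) (at z)"
    by (rule legA_deriv[OF c z(1)])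
  have "((\<lambda>z. - p * legA (p + 1) c z) has_field_derivative - p * (- (p + 1) * legA (p + 1 + 1) c z)) (at z)"
    by (rule DERIV_cmult legA_deriv[OF c z(1)])+
  moreover have "- p * (- (p + 1) * legA (p + 1 + 1) c z) * (1 - z\<^sup>2) =
     (p + (p - 2 * c + 2) + 1) * z * (- p * legA (p + 1) c z) + p * (p - 2 * c + 2) * legA p c z"
    using legA_three_term_p[OF c z(1), of p] by (simp add: algebra_simps)
  then have "- p * (- (p + 1) * legA (p + 1 + 1) c z) = ((p + (p - 2 * c + 2) + 1) * z * (- p * legA (p + 1) c z) + p * (p - 2 * c + 2) * legA p c z) / (1 - z\<^sup>2)"
    using nz by (simp only: eq_divide_eq) simp
  ultimately show "((\<lambda>z. - p * legA (p + 1) c z) has_field_derivative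
    ((p + (p - 2 * c + 2) + 1) * z * (- p * legA (p + 1) c z) + p * (p - 2 * c + 2) * legA p c z) / (1 - z\<^sup>2)) (at z)"
    by simp
qed

text \<open>The limits exist because \<open>E\<close>, \<open>H\<close> and their derivatives are
  continuous at 0, and the initial values there isolate a and b.\<close>

lemma legA_expansion:
  assumes c: "c \<notin> \<int>\<^sub>\<le>\<^sub>0"
    and E: "legendre_sol (ball 0 1) p (p - 2 * c + 2) E E'" "E 0 = 1" "E' 0 = 0"
    and H: "legendre_sol (ball 0 1) p (p - 2 * c + 2) H H'" "H 0 = 0" "H' 0 = 1"
  obtains a b where "\<And>z. Im z > 0 \<Longrightarrow> norm z < 1 \<Longrightarrow> legA p c z = a * E z + b * H z"
    "(legA p c \<longlongrightarrow> a) (at 0 within {z. Im z > 0})"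
    "((\<lambda>z. - p * legA (p + 1) c z) \<longlongrightarrow> b) (at 0 within {z. Im z > 0})"
proof -
  let ?S = "{z. Im z > 0} \<inter> ball 0 1"
  have S: "open ?S" "connected ?S" "?S \<subseteq> ball 0 1"
    by (auto intro!: open_Int open_halfspace_Im_gt convex_connected convex_Int convex_halfspace_Im_gt)
  obtain a b where ab: "\<And>z. z \<in> ?S \<Longrightarrow> legA p c z = a * E z + b * H z"
      "\<And>z. z \<in> ?S \<Longrightarrow> - p * legA (p + 1) c z = a * E' z + b * H' z"
    by (rule legendre_sol_basis[OF E H legA_sol[OF c] S]) blast
  have ev: "\<forall>\<^sub>F z in at 0 within {z. Im z > 0}. z \<in> ?S"
    using eventually_at_ball'[of 1 "0::complex" "{z. Im z > 0}"] by (auto elim!: eventually_mono)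
  have cont: "(y \<longlongrightarrow> y 0) (at 0 within {z. Im z > 0})" "(y' \<longlongrightarrow> y' 0) (at 0 within {z. Im z > 0})"
    if "legendre_sol (ball 0 1) p q y y'" for q y y'
  proof -
    have "isCont y 0" "isCont y' 0"
      using that unfolding legendre_sol_def by (auto intro: DERIV_isCont dest!: bspec[of _ _ 0])
    then show "(y \<longlongrightarrow> y 0) (at 0 within {z. Im z > 0})" "(y' \<longlongrightarrow> y' 0) (at 0 within {z. Im z > 0})"
      unfolding isCont_def using tendsto_within_subset by blast+
  qed
  show ?thesis
  proof (rule that)
    show "legA p c z = a * E z + b * H z" if "Im z > 0" "norm z < 1" for z using ab(1) that by auto
    have "((\<lambda>z. a * E z + b * H z) \<longlongrightarrow> a * E 0 + b * H 0) (at 0 within {z. Im z > 0})"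
      by (intro tendsto_intros cont[OF E(1)] cont[OF H(1)])
    moreover have "\<forall>\<^sub>F z in at 0 within {z. Im z > 0}. a * E z + b * H z = legA p c z"
      using ev by eventually_elim (simp add: ab)
    ultimately show "(legA p c \<longlongrightarrow> a) (at 0 within {z. Im z > 0})"
      using E H by (simp add: tendsto_cong)
    have "((\<lambda>z. a * E' z + b * H' z) \<longlongrightarrow> a * E' 0 + b * H' 0) (at 0 within {z. Im z > 0})"
      by (intro tendsto_intros cont[OF E(1)] cont[OF H(1)])
    moreover have "\<forall>\<^sub>F z in at 0 within {z. Im z > 0}. a * E' z + b * H' z = - p * legA (p + 1) c z"
      using ev by eventually_elim (simp only: ab)
    ultimately show "((\<lambda>z. - p * legA (p + 1) c z) \<longlongrightarrow> b) (at 0 within {z. Im z > 0})"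
      using E H by (simp add: tendsto_cong)
  qed
qed

section \<open>Kummer's sum\<close>

text \<open>The expansion |a + n|/n = 1 + Re a / n + o(1/n), in the form required by Raabe's
  test.\<close>

lemma norm_add_of_nat_asymp:
  fixes a :: complex
  shows "(\<lambda>n. real n * (norm (a + of_nat n) / real n - 1)) \<longlonglongrightarrow> Re a"
proof -
  have inv: "(\<lambda>n. 1 / real n) \<longlonglongrightarrow> 0" by (rule lim_1_over_n)
  have "(\<lambda>n. norm (a * of_real (1 / real n) + 1)) \<longlonglongrightarrow> norm (a * of_real 0 + 1)"
    by (intro tendsto_intros inv)
  \<comment> \<open>The square root in the modulus is removed by multiplying and dividing by |a/n +
    1| + 1.\<close>
  then have "(\<lambda>n. ((norm a)\<^sup>2 * (1 / real n) + 2 * Re a) / (norm (a * of_real (1 / real n) + 1) + 1))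
      \<longlonglongrightarrow> ((norm a)\<^sup>2 * 0 + 2 * Re a) / (norm (a * of_real 0 + 1) + 1)"
    by (intro tendsto_intros inv) auto
  moreover have "\<forall>\<^sub>F n in sequentially. ((norm a)\<^sup>2 * (1 / real n) + 2 * Re a) / (norm (a * of_real (1 / real n) + 1) + 1)
      = real n * (norm (a + of_nat n) / real n - 1)"
    using eventually_gt_at_top[of 0]
  proof eventually_elim
    case (elim n)
    define X where "X = norm (a + of_nat n)"
    have "a * of_real (1 / real n) + 1 = (a + of_nat n) / of_nat n" using elim by (simp add: field_simps)
    then have 1: "norm (a * of_real (1 / real n) + 1) = X / real n" by (simp add: norm_divide X_def)
    have X: "X \<ge> 0" by (simp add: X_def)
    have "X\<^sup>2 = (norm a)\<^sup>2 + 2 * real n * Re a + (real n)\<^sup>2"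
      unfolding X_def cmod_power2 by (simp add: power2_eq_square algebra_simps)
    then have 2: "(X - real n) * (X + real n) = (norm a)\<^sup>2 + 2 * real n * Re a"
      by (simp add: power2_eq_square algebra_simps)
    have "((norm a)\<^sup>2 * (1 / real n) + 2 * Re a) / (X / real n + 1) = ((norm a)\<^sup>2 + 2 * real n * Re a) / (X + real n)"
      using elim X by (simp add: divide_simps)
    also have "\<dots> = X - real n" using elim X unfolding 2[symmetric] by simp
    also have "\<dots> = real n * (X / real n - 1)" using elim by (simp add: field_simps)
    finally show ?case unfolding 1 X_def .
  qed
  ultimately show ?thesis by (simp add: tendsto_cong)
qed

lemma raabe_tendsto_ratio:
  fixes a b c d :: complex
  shows "(\<lambda>n. real n * (norm (c + of_nat n) * norm (d + of_nat n) / (norm (a + of_nat n) * norm (b + of_nat n)) - 1))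
    \<longlonglongrightarrow> Re (c + d - a - b)"
proof -
  define \<alpha> where "\<alpha> = (\<lambda>(a::complex) n. real n * (norm (a + of_nat n) / real n - 1))"
  have \<alpha>: "\<alpha> a \<longlonglongrightarrow> Re a" for a unfolding \<alpha>_def by (rule norm_add_of_nat_asymp)
  have inv: "(\<lambda>n. 1 / real n) \<longlonglongrightarrow> 0" by (rule lim_1_over_n)
  have A: "(\<lambda>n. 1 + \<alpha> a n * (1 / real n)) \<longlonglongrightarrow> 1 + Re a * 0" for a
    by (intro tendsto_intros \<alpha> inv)
  have "(\<lambda>n. (\<alpha> c n + \<alpha> d n + \<alpha> c n * \<alpha> d n * (1 / real n) - \<alpha> a n - \<alpha> b n - \<alpha> a n * \<alpha> b n * (1 / real n))
       / ((1 + \<alpha> a n * (1 / real n)) * (1 + \<alpha> b n * (1 / real n))))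
     \<longlonglongrightarrow> (Re c + Re d + Re c * Re d * 0 - Re a - Re b - Re a * Re b * 0) / ((1 + Re a * 0) * (1 + Re b * 0))"
    by (intro tendsto_intros \<alpha> A inv) auto
  moreover have "\<forall>\<^sub>F n in sequentially. a + of_nat n \<noteq> 0" for a :: complex
    using eventually_gt_at_top[of "nat \<lceil>norm a\<rceil>"]
  proof eventually_elim
    case (elim n)
    then have "norm a < real n" by linarith
    moreover have "norm a = real n" if "a + of_nat n = 0"
    proof -
      have "a = - of_nat n" using that by (simp add: add_eq_0_iff2)
      then show ?thesis by simp
    qed
    ultimately show ?case by auto
  qed
  then have "\<forall>\<^sub>F n in sequentially. n > 0 \<and> a + of_nat n \<noteq> 0 \<and> b + of_nat n \<noteq> 0"
    by (intro eventually_conj eventually_gt_at_top)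
  then have "\<forall>\<^sub>F n in sequentially. (\<alpha> c n + \<alpha> d n + \<alpha> c n * \<alpha> d n * (1 / real n) - \<alpha> a n - \<alpha> b n - \<alpha> a n * \<alpha> b n * (1 / real n))
       / ((1 + \<alpha> a n * (1 / real n)) * (1 + \<alpha> b n * (1 / real n)))
     = real n * (norm (c + of_nat n) * norm (d + of_nat n) / (norm (a + of_nat n) * norm (b + of_nat n)) - 1)"
  proof eventually_elim
    case (elim n)
    define A B C D N where "A = norm (a + of_nat n)" and "B = norm (b + of_nat n)"
      and "C = norm (c + of_nat n)" and "D = norm (d + of_nat n)"
      and "N = real n"
    have nz: "N \<noteq> 0" "A \<noteq> 0" "B \<noteq> 0" using elim by (auto simp: A_def B_def C_def D_def N_def)
    have \<alpha>': "\<alpha> a n = A - N" "\<alpha> b n = B - N" "\<alpha> c n = C - N" "\<alpha> d n = D - N"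
      using nz unfolding \<alpha>_def A_def B_def C_def D_def N_def by (auto simp: field_simps)
    have den: "1 + (X - N) * (1 / N) = X / N" for X using nz by (simp add: field_simps)
    have "(C - N + (D - N) + (C - N) * (D - N) * (1 / N) - (A - N) - (B - N) - (A - N) * (B - N) * (1 / N)) = (C * D - A * B) / N"
      using nz by (simp add: field_simps)
    then show ?case
      unfolding \<alpha>' A_def[symmetric] B_def[symmetric] C_def[symmetric] D_def[symmetric] N_def[symmetric] den using nz by (simp add: field_simps)
  qed
  ultimately show ?thesis by (simp add: tendsto_cong)
qed

text \<open>The Raabe limit is Re (c + 1 - a - b), which exceeds 1. The test divides by the terms,
  so the terminating series, where a or b is a nonpositive integer, are treated apart.\<close>

lemma hyp_fps_summable_norm:
  assumes c: "c \<notin> \<int>\<^sub>\<le>\<^sub>0" and re: "Re (c - a - b) > 0"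
  shows "summable (\<lambda>n. norm (fps_nth (hyp_fps a b c) n))"
proof (cases "a \<in> \<int>\<^sub>\<le>\<^sub>0 \<or> b \<in> \<int>\<^sub>\<le>\<^sub>0")
  case True
  then obtain k where k: "a = - of_nat k \<or> b = - of_nat k" by (auto elim!: nonpos_Ints_cases')
  have "norm (fps_nth (hyp_fps a b c) n) = 0" if "n \<notin> {..k}" for n
    using k that by (auto simp: hyp_fps_def pochhammer_of_nat_eq_0_iff)
  then show ?thesis by (intro summable_finite[of "{..k}"]) auto
next
  case False
  have nz: "fps_nth (hyp_fps a b c) n \<noteq> 0" for n
    using False c pochhammer_eq_0_imp_nonpos_Int unfolding hyp_fps_def by auto
  let ?f = "\<lambda>n. norm (fps_nth (hyp_fps a b c) n)"
  have eq: "?f n / ?f (Suc n) = norm (c + of_nat n) * norm (1 + of_nat n :: complex) / (norm (a + of_nat n) * norm (b + of_nat n))" for n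
    using nz[of n] unfolding hyp_fps_Suc[OF c] norm_mult norm_divide
    by (simp add: add.commute)
  have "(\<lambda>n. real n * (?f n / ?f (Suc n) - 1)) \<longlonglongrightarrow> Re (c + 1 - a - b)"
    unfolding eq by (rule raabe_tendsto_ratio)
  then have "(\<lambda>n. ereal (real n * (?f n / ?f (Suc n) - 1))) \<longlonglongrightarrow> ereal (Re (c + 1 - a - b))"
    by simp
  then have "liminf (\<lambda>n. ereal (real n * (?f n / ?f (Suc n) - 1))) = ereal (Re (c + 1 - a - b))"
    by (intro lim_imp_Liminf) auto
  then show ?thesis
    using re nz by (intro raabes_test_convergence) (auto simp: one_ereal_def)
qed

lemma continuous_on_cball_power_series:
  fixes f :: "nat \<Rightarrow> complex"
  assumes "summable (\<lambda>n. norm (f n))"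
  shows "continuous_on (cball 0 1) (\<lambda>w. \<Sum>n. f n * w ^ n)"
proof (rule uniform_limit_theorem)
  show "uniform_limit (cball 0 1) (\<lambda>N w. \<Sum>n<N. f n * w ^ n) (\<lambda>w. \<Sum>n. f n * w ^ n) sequentially"
    by (rule Weierstrass_m_test[OF _ assms]) (simp add: norm_mult norm_power mult_left_le power_le_one)
  show "\<forall>\<^sub>F N in sequentially. continuous_on (cball 0 1) (\<lambda>w. \<Sum>n<N. f n * w ^ n)"
    by (intro always_eventually allI continuous_intros)
qed simp

lemma tendsto_power_series_minus_one:
  fixes f :: "nat \<Rightarrow> complex"
  assumes f: "summable (\<lambda>n. norm (f n))" and t: "((t :: 'a \<Rightarrow> complex) \<longlongrightarrow> -1) F" "\<forall>\<^sub>F x in F. norm (t x) \<le> 1"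
  shows "((\<lambda>x. \<Sum>n. f n * t x ^ n) \<longlongrightarrow> (\<Sum>n. f n * (-1) ^ n)) F"
  using continuous_on_tendsto_compose[OF continuous_on_cball_power_series[OF f] t(1)] t(2) by simp


text \<open>Kummer's well-poised series 2F1(p, m; 1 + p - m; -1). The series inside
  \<open>hypQ\<close> is of this shape with m = p - c + 1.\<close>

definition kummerK :: "complex \<Rightarrow> complex \<Rightarrow> complex" where
  "kummerK p m = (\<Sum>n. fps_nth (hyp_fps p m (1 + p - m)) n * (-1) ^ n)"

lemma kummer_sums:
  assumes "1 + p - m \<notin> \<int>\<^sub>\<le>\<^sub>0" "Re m < 0"
  shows "(\<lambda>n. fps_nth (hyp_fps p m (1 + p - m)) n * (-1) ^ n) sums kummerK p m"
proof -
  have "summable (\<lambda>n. norm (fps_nth (hyp_fps p m (1 + p - m)) n))"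
    using assms by (intro hyp_fps_summable_norm) auto
  then have "summable (\<lambda>n. norm (fps_nth (hyp_fps p m (1 + p - m)) n * (-1) ^ n))"
    by (simp add: norm_mult norm_power)
  then show ?thesis unfolding kummerK_def by (intro summable_sums) (rule summable_norm_cancel)
qed

lemma add_nat_notin_nonpos_Ints: "(c::complex) \<notin> \<int>\<^sub>\<le>\<^sub>0 \<Longrightarrow> c + of_nat k \<notin> \<int>\<^sub>\<le>\<^sub>0"
proof (induction k)
  case (Suc k)
  moreover have "c + of_nat (Suc k) = (c + of_nat k) + 1" by simp
  ultimately show ?case using plus_one_in_nonpos_Ints_imp by metis
qed simp

text \<open>Telescoping identity found by the Wilf--Zeilberger method: \<open>m\<close> is fixed and \<open>p\<close>, \<open>c\<close> move by 2.\<close>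
lemma kummer_certificate:
  fixes p m :: complex
  defines "c \<equiv> 1 + p - m"
  defines "u \<equiv> fps_nth (hyp_fps p m c)" and "v \<equiv> fps_nth (hyp_fps (p + 2) m (c + 2))"
    and "h \<equiv> fps_nth (hyp_fps (p + 1) (m + 1) (c + 2))"
  assumes c: "c \<notin> \<int>\<^sub>\<le>\<^sub>0"
  shows "(2 + p - 2 * m) * (p + 1) * v (Suc k) - c * (c + 1) * u (Suc k) = m * (1 - m) * (h (Suc k) + h k)"
proof -
  define K where "K = (of_nat k :: complex)"
  have nz: "c \<noteq> 0" "c + 1 \<noteq> 0" "c + 1 + K \<noteq> 0" "c + 2 + K \<noteq> 0" "K + 1 \<noteq> 0"
    using add_of_nat_neq_0[OF c, of 0] add_of_nat_neq_0[OF c, of 1] add_of_nat_neq_0[OF c, of "1 + k"]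
      add_of_nat_neq_0[OF c, of "2 + k"] of_nat_neq_0[of k, where 'a = complex]
    unfolding K_def by (auto simp: add_ac)
  define P M C where "P = pochhammer (p + 1) k" and "M = pochhammer (m + 1) k" and "C = pochhammer (c + 2) k"
  have "c + 2 \<notin> \<int>\<^sub>\<le>\<^sub>0" using add_nat_notin_nonpos_Ints[OF c, of 2] by simp
  then have C: "C \<noteq> 0" unfolding C_def using pochhammer_eq_0_imp_nonpos_Int by blast
  have h: "h k = P * M / (C * fact k)" by (simp add: h_def hyp_fps_def P_def M_def C_def)
  have hS: "h (Suc k) * ((c + 2 + K) * (K + 1)) = (p + 1 + K) * (m + 1 + K) * h k"
    using hyp_fps_rec[of "c + 2" k "p + 1" "m + 1"] \<open>c + 2 \<notin> \<int>\<^sub>\<le>\<^sub>0\<close> unfolding h_def K_def by (simp add: mult_ac)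
  have pC: "c * (c + 1) * C = (c + 1 + K) * pochhammer c (Suc k)"
  proof -
    have "c * (c + 1) * C = pochhammer c (Suc (Suc k))"
      by (simp only: pochhammer_rec[of c] pochhammer_rec[of "c + 1"] C_def) (simp add: add.assoc)
    also have "\<dots> = (c + of_nat (Suc k)) * pochhammer c (Suc k)" by (rule pochhammer_rec')
    finally show ?thesis by (simp add: K_def add_ac)
  qed
  have pcn: "pochhammer c (Suc k) \<noteq> 0" using c pochhammer_eq_0_imp_nonpos_Int by blast
  \<comment> \<open>Here and in \<open>vS\<close> the two terms become rational multiples of
    \<open>h k\<close>, so that only a polynomial identity in p, m and K is left.\<close>
  have uS: "c * (c + 1) * u (Suc k) * (K + 1) = p * m * (c + 1 + K) * h k"
  proof -
    have "u (Suc k) * (K + 1) = p * P * (m * M) / (pochhammer c (Suc k) * fact k)"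
      using nz by (simp add: u_def hyp_fps_def pochhammer_rec[of p] pochhammer_rec[of m] P_def M_def K_def add.commute divide_simps)
    also have "\<dots> = p * m * P * M * (c + 1 + K) / (c * (c + 1) * C * fact k)"
      unfolding pC using nz by simp
    finally have "c * (c + 1) * (u (Suc k) * (K + 1)) = c * (c + 1) * (p * m * P * M * (c + 1 + K) / (c * (c + 1) * C * fact k))"
      by simp
    also have "\<dots> = p * m * P * M * (c + 1 + K) / (C * fact k)" using nz by simp
    finally show ?thesis unfolding h by (simp only: mult_ac times_divide_eq_right times_divide_eq_left)
  qed
  have pP: "(p + 1) * pochhammer (p + 2) (Suc k) = (p + 1 + K) * (p + 2 + K) * P"
  proof -
    have "(p + 1) * pochhammer (p + 2) (Suc k) = pochhammer (p + 1) (Suc (Suc k))"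
      by (simp only: pochhammer_rec[of "p + 1"]) (simp add: add.assoc)
    also have "\<dots> = (p + 1 + of_nat (Suc k)) * ((p + 1 + of_nat k) * P)"
      by (simp only: pochhammer_rec'[of "p + 1"] P_def)
    finally show ?thesis by (simp add: K_def add_ac mult_ac)
  qed
  have vS: "(p + 1) * v (Suc k) * ((c + 2 + K) * (K + 1)) = m * (p + 1 + K) * (p + 2 + K) * h k"
  proof -
    have "v (Suc k) * ((c + 2 + K) * (K + 1)) = pochhammer (p + 2) (Suc k) * (m * M) / (C * fact k)"
      using nz by (simp add: v_def hyp_fps_def pochhammer_rec[of m] pochhammer_rec'[of "c + 2"] M_def C_def K_def add.commute divide_simps)
    then have "(p + 1) * (v (Suc k) * ((c + 2 + K) * (K + 1))) = (p + 1) * (pochhammer (p + 2) (Suc k) * (m * M) / (C * fact k))"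
      by (simp only:)
    then have "(p + 1) * v (Suc k) * ((c + 2 + K) * (K + 1)) = ((p + 1) * pochhammer (p + 2) (Suc k)) * (m * M) / (C * fact k)"
      by (simp only: mult.assoc times_divide_eq_right)
    then show ?thesis unfolding pP h by (simp add: mult_ac)
  qed
  have "((2 + p - 2 * m) * (p + 1) * v (Suc k) - c * (c + 1) * u (Suc k)) * ((c + 2 + K) * (K + 1))
      = (2 + p - 2 * m) * ((p + 1) * v (Suc k) * ((c + 2 + K) * (K + 1))) - (c + 2 + K) * (c * (c + 1) * u (Suc k) * (K + 1))"
    by (simp add: algebra_simps)
  also have "\<dots> = m * (1 - m) * ((p + 1 + K) * (m + 1 + K) * h k + h k * ((c + 2 + K) * (K + 1)))"
    unfolding uS vS unfolding c_def by (simp add: algebra_simps)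
  also have "\<dots> = m * (1 - m) * (h (Suc k) + h k) * ((c + 2 + K) * (K + 1))"
    unfolding hS[symmetric] by (simp add: algebra_simps)
  finally show ?thesis using nz by simp
qed

text \<open>With the sign (-1)^n the certificate telescopes: the partial sums equal m(1 - m)(-1)^N
  h(N). This tends to 0 because h is absolutely summable, its parameter excess being 1 - 2m, of
  positive real part.\<close>

lemma kummer_rec:
  assumes c: "1 + p - m \<notin> \<int>\<^sub>\<le>\<^sub>0" and m: "Re m < 0"
  shows "(1 + p - m) * (2 + p - m) * kummerK p m = (2 + p - 2 * m) * (p + 1) * kummerK (p + 2) m"
proof -
  define c where "c = 1 + p - m"
  define u v h where "u = fps_nth (hyp_fps p m c)" and "v = fps_nth (hyp_fps (p + 2) m (c + 2))"
    and "h = fps_nth (hyp_fps (p + 1) (m + 1) (c + 2))"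
  have c2: "c + 2 \<notin> \<int>\<^sub>\<le>\<^sub>0" using add_nat_notin_nonpos_Ints[OF c, of 2] by (simp add: c_def)
  have c2': "1 + (p + 2) - m = c + 2" by (simp add: c_def)
  have "(\<lambda>n. (2 + p - 2 * m) * (p + 1) * (v n * (-1) ^ n) - c * (c + 1) * (u n * (-1) ^ n))
      sums ((2 + p - 2 * m) * (p + 1) * kummerK (p + 2) m - c * (c + 1) * kummerK p m)"
    using kummer_sums[of "p + 2" m] kummer_sums[of p m] c c2 m unfolding c2' u_def v_def c_def[symmetric]
    by (intro sums_diff sums_mult) auto
  \<comment> \<open>Shifted by one, because \<open>tel\<close> sums over the indices below
    \<open>Suc N\<close>.\<close>
  note lim = LIMSEQ_Suc[OF this[unfolded sums_def]]
  have tel: "(\<Sum>n<Suc N. (2 + p - 2 * m) * (p + 1) * (v n * (-1) ^ n) - c * (c + 1) * (u n * (-1) ^ n))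
      = m * (1 - m) * (h N * (-1) ^ N)" for N
  proof (induction N)
    case 0
    then show ?case by (simp add: u_def v_def h_def c_def algebra_simps)
  next
    case (Suc N)
    have "(2 + p - 2 * m) * (p + 1) * (v (Suc N) * (-1) ^ Suc N) - c * (c + 1) * (u (Suc N) * (-1) ^ Suc N)
       = (-1) ^ Suc N * ((2 + p - 2 * m) * (p + 1) * v (Suc N) - c * (c + 1) * u (Suc N))"
      by (simp add: algebra_simps)
    also have "\<dots> = (-1) ^ Suc N * (m * (1 - m) * (h (Suc N) + h N))"
      unfolding u_def v_def h_def c_def using c by (subst kummer_certificate) auto
    finally show ?case
      unfolding sum.lessThan_Suc[of _ "Suc N"] Suc.IH by (simp add: algebra_simps)
  qed
  have "(\<lambda>N. m * (1 - m) * (h N * (-1) ^ N)) \<longlonglongrightarrow> m * (1 - m) * 0"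
  proof (intro tendsto_intros)
    have "summable (\<lambda>n. norm (h n))"
      unfolding h_def using m by (intro hyp_fps_summable_norm c2) (simp add: c_def)
    then have "(\<lambda>n. norm (h n * (-1) ^ n)) \<longlonglongrightarrow> 0" 
      by (simp add: norm_mult norm_power summable_LIMSEQ_zero)
    then show "(\<lambda>n. h n * (-1) ^ n) \<longlonglongrightarrow> 0" by (simp only: tendsto_norm_zero_iff)
  qed
  with lim have "(2 + p - 2 * m) * (p + 1) * kummerK (p + 2) m - c * (c + 1) * kummerK p m = m * (1 - m) * 0"
    unfolding tel by (rule LIMSEQ_unique)
  then show ?thesis by (simp add: c_def algebra_simps)
qed

section \<open>The limit of the sum for large p, and its value\<close>

lemma two_powr_complex: "(2::complex) powr x = exp (x * of_real (ln 2))"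
  using Ln_of_real[of 2] by (simp add: powr_def)

text \<open>Abel summation: for 0 < x < 1 the binomial series gives (1 + x)^(-m), and absolute
  convergence at the boundary, valid for Re m < 0, lets x tend to 1.\<close>

lemma binomial_at_minus_one:
  assumes m: "Re m < 0"
  shows "(\<lambda>n. pochhammer m n / fact n * (-1) ^ n) sums (2 powr (- m))"
    and "summable (\<lambda>n. norm (pochhammer m n / fact n))"
proof -
  let ?f = "\<lambda>n. pochhammer m n / fact n"
  \<comment> \<open>Equal parameters 1 above and below cancel, which makes the summability criterion
    for hypergeometric series available.\<close>
  have f: "?f n = fps_nth (hyp_fps m 1 1) n" for n
    by (simp add: hyp_fps_def pochhammer_fact[symmetric])
  show s: "summable (\<lambda>n. norm (?f n))"
    unfolding f using m by (intro hyp_fps_summable_norm) auto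
  have "((\<lambda>x::real. \<Sum>n. ?f n * (- of_real x) ^ n) \<longlongrightarrow> (\<Sum>n. ?f n * (-1) ^ n)) (at_left 1)"
  proof (rule tendsto_power_series_minus_one[OF s])
    show "((\<lambda>x. - complex_of_real x) \<longlongrightarrow> -1) (at_left 1)"
      by (auto intro!: tendsto_eq_intros)
    show "\<forall>\<^sub>F x in at_left 1. norm (- complex_of_real x) \<le> 1"
      using eventually_at_left_real[of "-1" "1::real"] by (auto elim!: eventually_mono)
  qed
  moreover have "\<forall>\<^sub>F x in at_left 1. (\<Sum>n. ?f n * (- of_real x) ^ n) = (1 + complex_of_real x) powr (- m)"
    using eventually_at_left_real[of "0" "1::real", simplified]
  proof eventually_elim
    case (elim x)
    have "(\<lambda>n. (- m gchoose n) * of_real x ^ n) sums (1 + complex_of_real x) powr (- m)"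
      using elim by (intro gen_binomial_complex) auto
    moreover have "(- m gchoose n) * of_real x ^ n = ?f n * (- of_real x) ^ n" for n
      by (simp add: gbinomial_pochhammer power_minus[of "complex_of_real x"])
    ultimately show ?case by (simp add: sums_iff)
  qed
  ultimately have "((\<lambda>x. (1 + complex_of_real x) powr (- m)) \<longlongrightarrow> (\<Sum>n. ?f n * (-1) ^ n)) (at_left 1)"
    by (simp add: tendsto_cong)
  moreover have "((\<lambda>x. (1 + complex_of_real x) powr (- m)) \<longlongrightarrow> (1 + complex_of_real 1) powr (- m)) (at_left 1)"
    by (intro tendsto_intros) (auto simp: complex_nonpos_Reals_iff)
  ultimately have "(\<Sum>n. ?f n * (-1) ^ n) = 2 powr (- m)"
    using tendsto_unique[of "at_left (1::real)"] by fastforce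
  moreover have "summable (\<lambda>n. ?f n * (-1) ^ n)"
    by (rule summable_norm_cancel) (use s in \<open>simp add: norm_mult norm_power norm_divide\<close>)
  ultimately show "(\<lambda>n. ?f n * (-1) ^ n) sums (2 powr (- m))" by (simp add: sums_iff)
qed

text \<open>Used for domination: with \<delta> = 1 - m it bounds each factor (p + x)/(1 + p - m + x)
  by 1 in modulus once x is large.\<close>

lemma norm_add_real_mono:
  fixes p \<delta> :: complex
  assumes \<delta>: "Re \<delta> > 0"
  shows "\<forall>\<^sub>F x::real in at_top. norm (p + of_real x) \<le> norm (p + \<delta> + of_real x)"
  using eventually_ge_at_top[of "\<bar>Im \<delta> * Im p\<bar> / Re \<delta> - Re p"]
proof eventually_elim
  case (elim x)
  then have "\<bar>Im \<delta> * Im p\<bar> \<le> Re \<delta> * (Re p + x)" using \<delta> by (simp add: field_simps)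
  then have "0 \<le> 2 * (Re \<delta> * (Re p + x)) + 2 * (Im \<delta> * Im p) + (Re \<delta>)\<^sup>2 + (Im \<delta>)\<^sup>2"
    using zero_le_power2[of "Re \<delta>"] zero_le_power2[of "Im \<delta>"] by linarith
  then have "(norm (p + of_real x))\<^sup>2 \<le> (norm (p + \<delta> + of_real x))\<^sup>2"
    unfolding cmod_power2 by (simp add: power2_eq_square algebra_simps)
  then show ?case by (rule power2_le_imp_le) simp
qed

text \<open>When p grows, (p)_n / (1 + p - m)_n tends to 1 for each n, and the binomial series at -1
  remains. Tannery's theorem, the discrete form of dominated convergence, justifies the termwise
  limit.\<close>

lemma kummer_tendsto:
  assumes m: "Re m < 0"
  shows "(\<lambda>N. kummerK (p + 2 * of_nat N) m) \<longlonglongrightarrow> 2 powr (- m)"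
proof -
  define c where "c = 1 + p - m"
  have c_eq: "p + (1 - m) = c" by (simp add: c_def)
  define a where "a = (\<lambda>n N. fps_nth (hyp_fps (p + 2 * of_nat N) m (1 + (p + 2 * of_nat N) - m)) n * (-1) ^ n)"
  define r where "r = (\<lambda>n N. pochhammer (p + 2 * of_nat N) n / pochhammer (c + 2 * of_nat N) n)"
  have a_eq: "a n N = r n N * (pochhammer m n / fact n * (-1) ^ n)" for n N
    unfolding a_def r_def hyp_fps_def c_def by (simp add: algebra_simps)
  have r_prod: "r n N = (\<Prod>k<n. (p + of_nat k + of_nat (2 * N)) / (c + of_nat k + of_nat (2 * N)))" for n N
    unfolding r_def pochhammer_prod prod_dividef[symmetric] by (simp add: atLeast0LessThan add_ac)
  have "filterlim (\<lambda>N::nat. 2 * N) at_top sequentially"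
    by (rule filterlim_subseq) (auto simp: strict_mono_def)
  then have sub: "(\<lambda>N. (x + of_nat (2 * N)) / (y + of_nat (2 * N))) \<longlonglongrightarrow> (1::complex)" for x y
    by (rule filterlim_compose[OF tendsto_add_of_nat_ratio])
  have "r n \<longlonglongrightarrow> (\<Prod>k<n. 1)" for n
    unfolding r_prod[abs_def] by (intro tendsto_prod sub)
  then have lim: "a n \<longlonglongrightarrow> pochhammer m n / fact n * (-1) ^ n" for n
    unfolding a_eq[abs_def] by (auto intro!: tendsto_eq_intros)
  have "\<forall>\<^sub>F x::real in at_top. norm (p + of_real x) \<le> norm (p + (1 - m) + of_real x)"
    using m by (intro norm_add_real_mono) simp
  then obtain X where X: "\<And>x. x \<ge> X \<Longrightarrow> norm (p + of_real x) \<le> norm (c + of_real x)"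
    by (auto simp: eventually_at_top_linorder c_eq)
  \<comment> \<open>The threshold does not depend on n: the additional summands k only increase the
    real shift to which \<open>X\<close> applies.\<close>
  have bound: "norm (a n N) \<le> norm (pochhammer m n / fact n)" if "N \<ge> nat \<lceil>X\<rceil>" for n N
  proof -
    have "norm (r n N) \<le> 1"
      unfolding r_prod prod_norm[symmetric]
    proof (rule prod_le_1, intro conjI)
      fix k
      have "real k + 2 * real N \<ge> X" using that by linarith
      from X[OF this] have "norm (p + of_nat k + of_nat (2 * N)) \<le> norm (c + of_nat k + of_nat (2 * N))"
        by (simp add: add_ac)
      then show "norm ((p + of_nat k + of_nat (2 * N)) / (c + of_nat k + of_nat (2 * N))) \<le> 1"
        by (simp add: norm_divide divide_le_eq_1)
    qed simp
    then have "norm (r n N) * norm (pochhammer m n / fact n * (-1) ^ n) \<le> 1 * norm (pochhammer m n / fact n * (-1) ^ n)"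
      by (intro mult_right_mono) auto
    then show ?thesis by (simp add: a_eq norm_mult norm_power norm_divide)
  qed
  have "(\<lambda>N. \<Sum>n. a n N) \<longlonglongrightarrow> (\<Sum>n. pochhammer m n / fact n * (-1) ^ n)"
  proof -
    have "\<forall>\<^sub>F (n, N) in at_top \<times>\<^sub>F sequentially. norm (a n N) \<le> norm (pochhammer m n / fact n)"
      unfolding eventually_prod_filter
    proof (intro exI conjI allI impI)
      show "\<forall>\<^sub>F n in sequentially. True" by simp
      show "\<forall>\<^sub>F N in sequentially. N \<ge> nat \<lceil>X\<rceil>" by (rule eventually_ge_at_top)
    qed (use bound in simp)
    from tannerys_theorem[OF lim this binomial_at_minus_one(2)[OF m]] show ?thesis by simp
  qed
  then show ?thesis
    unfolding kummerK_def a_def sums_unique[OF binomial_at_minus_one(1)[OF m], symmetric] .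
qed

text \<open>N applications of \<open>kummer_rec\<close>. A step of 2 in p is a step of 1 in p/2,
  which is why the accumulated factors are Pochhammer symbols at halved arguments.\<close>

lemma kummer_iterate:
  assumes c: "1 + p - m \<notin> \<int>\<^sub>\<le>\<^sub>0" and m: "Re m < 0"
  shows "pochhammer ((1 + p - m) / 2) N * pochhammer ((1 + p - m) / 2 + 1 / 2) N * kummerK p m
    = pochhammer ((1 + p) / 2) N * pochhammer (1 + p / 2 - m) N * kummerK (p + 2 * of_nat N) m"
proof (induction N)
  case (Suc N)
  define A B C D n where "A = (1 + p) / 2" and "B = 1 + p / 2 - m" and "C = (1 + p - m) / 2"
    and "D = (1 + p - m) / 2 + 1 / 2" and "n = (of_nat N :: complex)"
  have "1 + (p + 2 * of_nat N) - m \<notin> \<int>\<^sub>\<le>\<^sub>0"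
    using add_nat_notin_nonpos_Ints[OF c, of "2 * N"] by (simp add: algebra_simps)
  note rec = kummer_rec[OF this m]
  have "4 * ((C + n) * (D + n)) = (1 + (p + 2 * of_nat N) - m) * (2 + (p + 2 * of_nat N) - m)"
    "4 * ((A + n) * (B + n)) = (2 + (p + 2 * of_nat N) - 2 * m) * ((p + 2 * of_nat N) + 1)"
    unfolding A_def B_def C_def D_def n_def by (simp_all add: field_simps)
  moreover have "p + 2 * of_nat N + 2 = p + 2 * (n + 1)" by (simp add: n_def)
  ultimately have "4 * ((C + n) * (D + n)) * kummerK (p + 2 * n) m = 4 * ((A + n) * (B + n)) * kummerK (p + 2 * (n + 1)) m"
    using rec unfolding n_def by (simp only:)
  then have step: "((C + n) * (D + n)) * kummerK (p + 2 * n) m = ((A + n) * (B + n)) * kummerK (p + 2 * (n + 1)) m"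
    by (simp only: mult.assoc mult_cancel_left) simp
  have IH: "pochhammer C N * pochhammer D N * kummerK p m = pochhammer A N * pochhammer B N * kummerK (p + 2 * n) m"
    using Suc.IH unfolding A_def B_def C_def D_def n_def .
  have "pochhammer C (Suc N) * pochhammer D (Suc N) * kummerK p m
      = ((C + n) * (D + n)) * (pochhammer C N * pochhammer D N * kummerK p m)"
    by (simp add: pochhammer_rec' n_def)
  also have "\<dots> = pochhammer A N * pochhammer B N * (((C + n) * (D + n)) * kummerK (p + 2 * n) m)"
    unfolding IH by (simp only: mult_ac)
  also have "\<dots> = pochhammer A (Suc N) * pochhammer B (Suc N) * kummerK (p + 2 * of_nat (Suc N)) m"
    unfolding step by (simp add: pochhammer_rec' n_def add_ac)
  finally show ?case unfolding A_def B_def C_def D_def .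
qed simp

text \<open>The recurrence is run to infinity. Gauss's limit turns the Pochhammer quotients into
  reciprocal Gamma values, the powers of n cancelling because A + B = C + D, and the remaining sum
  tends to 2^(-m). Since D = C + 1/2, duplication merges the other two Gamma factors into Gamma(1 +
  p - m).\<close>

lemma kummer_value:
  assumes c: "1 + p - m \<notin> \<int>\<^sub>\<le>\<^sub>0" and m: "Re m < 0"
  shows "kummerK p m = of_real (sqrt pi) * 2 powr (- p) * Gamma (1 + p - m) * rGamma ((1 + p) / 2) * rGamma (1 + p / 2 - m)"
proof -
  define A B C D where "A = (1 + p) / 2" and "B = 1 + p / 2 - m" and "C = (1 + p - m) / 2"
    and "D = (1 + p - m) / 2 + 1 / 2"
  have nonpos: "C \<notin> \<int>\<^sub>\<le>\<^sub>0" "D \<notin> \<int>\<^sub>\<le>\<^sub>0"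
  proof -
    have "1 + p - m = - of_nat (2 * k)" if "C = - of_nat k" for k
      using that unfolding C_def by (simp add: field_simps)
    then show "C \<notin> \<int>\<^sub>\<le>\<^sub>0" using c by (metis minus_of_nat_in_nonpos_Ints nonpos_Ints_cases')
    have "1 + p - m = - of_nat (2 * k + 1)" if "D = - of_nat k" for k
      using that unfolding D_def by (simp add: field_simps)
    then show "D \<notin> \<int>\<^sub>\<le>\<^sub>0" using c by (metis minus_of_nat_in_nonpos_Ints nonpos_Ints_cases')
  qed
  \<comment> \<open>The index is \<open>Suc n\<close> because \<open>rGamma_series\<close> at n
    contains \<open>pochhammer\<close> of length \<open>Suc n\<close>.\<close>
  have rs: "kummerK p m = (rGamma_series A n * rGamma_series B n) / (rGamma_series C n * rGamma_series D n) * kummerK (p + 2 * of_nat (Suc n)) m" for n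
  proof -
    let ?l = "complex_of_real (ln (of_nat n))"
    have "A + B = C + D" by (simp add: A_def B_def C_def D_def field_simps)
    then have e: "exp (A * ?l) * exp (B * ?l) = exp (C * ?l) * exp (D * ?l)"
      by (simp only: exp_add[symmetric] ring_distribs(2)[symmetric])
    have nz: "pochhammer C (Suc n) \<noteq> 0" "pochhammer D (Suc n) \<noteq> 0"
      using nonpos pochhammer_eq_0_imp_nonpos_Int by blast+
    have it: "pochhammer C (Suc n) * pochhammer D (Suc n) * kummerK p m
      = pochhammer A (Suc n) * pochhammer B (Suc n) * kummerK (p + 2 * of_nat (Suc n)) m"
      unfolding A_def B_def C_def D_def by (rule kummer_iterate[OF c m])
    have "(rGamma_series A n * rGamma_series B n) / (rGamma_series C n * rGamma_series D n)
       = (pochhammer A (Suc n) * pochhammer B (Suc n) / (exp (A * ?l) * exp (B * ?l))) / 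
         (pochhammer C (Suc n) * pochhammer D (Suc n) / (exp (C * ?l) * exp (D * ?l)))"
      unfolding rGamma_series_def by (simp del: pochhammer_Suc add: field_simps)
    also have "\<dots> = pochhammer A (Suc n) * pochhammer B (Suc n) / (pochhammer C (Suc n) * pochhammer D (Suc n))"
      unfolding e by (simp del: pochhammer_Suc)
    finally have q: "(rGamma_series A n * rGamma_series B n) / (rGamma_series C n * rGamma_series D n)
       = pochhammer A (Suc n) * pochhammer B (Suc n) / (pochhammer C (Suc n) * pochhammer D (Suc n))" .
    show ?thesis unfolding q using it nz by (simp del: pochhammer_Suc add: eq_divide_eq mult_ac)
  qed
  have rnz: "rGamma C \<noteq> 0" "rGamma D \<noteq> 0" using nonpos by (auto simp: rGamma_eq_zero_iff)
  have "(\<lambda>n. (rGamma_series A n * rGamma_series B n) / (rGamma_series C n * rGamma_series D n) * kummerK (p + 2 * of_nat (Suc n)) m)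
     \<longlonglongrightarrow> (rGamma A * rGamma B) / (rGamma C * rGamma D) * 2 powr (- m)"
    using rnz by (intro tendsto_intros LIMSEQ_Suc kummer_tendsto m) auto
  then have "kummerK p m = (rGamma A * rGamma B) / (rGamma C * rGamma D) * 2 powr (- m)"
    unfolding rs[symmetric] by (simp add: LIMSEQ_const_iff)
  also have "\<dots> = rGamma A * rGamma B * (Gamma C * Gamma D) * 2 powr (- m)"
    by (simp add: rGamma_inverse_Gamma field_simps)
  also have "Gamma C * Gamma D = exp ((1 - (1 + p - m)) * of_real (ln 2)) * of_real (sqrt pi) * Gamma (1 + p - m)"
  proof -
    have "2 * C = 1 + p - m" by (simp add: C_def field_simps)
    then show ?thesis using Gamma_legendre_duplication[of C] nonpos unfolding D_def C_def[symmetric] by simp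
  qed
  also have "rGamma A * rGamma B * (exp ((1 - (1 + p - m)) * of_real (ln 2)) * of_real (sqrt pi) * Gamma (1 + p - m)) * 2 powr (- m)
     = of_real (sqrt pi) * (exp ((1 - (1 + p - m)) * of_real (ln 2)) * exp (- m * of_real (ln 2))) * Gamma (1 + p - m) * rGamma A * rGamma B"
    unfolding two_powr_complex by (simp only: mult_ac)
  also have "exp ((1 - (1 + p - m)) * of_real (ln 2)) * exp (- m * of_real (ln 2)) = (2::complex) powr (- p)"
    unfolding two_powr_complex exp_add[symmetric] by (simp add: algebra_simps)
  finally show ?thesis unfolding A_def B_def .
qed

section \<open>Boundary value at the origin\<close>

text \<open>The limit of \<open>legA p c\<close> at 0 from the upper half-plane without its phase
  e^(-i pi p/2), which is the value of i^(-p). Reciprocal Gammas allow it to vanish.\<close>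

definition legA0 :: "complex \<Rightarrow> complex \<Rightarrow> complex" where
  "legA0 p c = of_real (sqrt pi) * Gamma c * rGamma ((1 + p) / 2) * rGamma (c - p / 2)"

lemma Ln_imaginary: "y > 0 \<Longrightarrow> Ln (\<i> * of_real y) = of_real (ln y) + \<i> * of_real pi / 2"
  using Ln_times_of_real[of y \<i>] Ln_of_real[of y] by (simp add: mult.commute)

lemma csqrt_imaginary:
  assumes "y > 0"
  shows "csqrt (1 - 1 / (\<i> * of_real y)\<^sup>2) = of_real (sqrt (y\<^sup>2 + 1) / y)"
proof -
  have "1 - 1 / (\<i> * of_real y)\<^sup>2 = complex_of_real ((y\<^sup>2 + 1) / y\<^sup>2)"
    using assms by (simp add: power_mult_distrib field_simps)
  moreover have "sqrt ((y\<^sup>2 + 1) / y\<^sup>2) = sqrt (y\<^sup>2 + 1) / y"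
    using assms by (simp add: real_sqrt_divide)
  ultimately show ?thesis
    using of_real_sqrt[of "(y\<^sup>2 + 1) / y\<^sup>2"] by simp
qed

text \<open>On the imaginary axis the root s is the real number r/y. The factors y^(-p) and ((1 +
  s)/2)^(-p), each singular or degenerate as y tends to 0, merge into ((y + r)/2)^(-p), which is
  regular there.\<close>

lemma legA_imaginary:
  assumes y: "y > 0"
  defines "r \<equiv> sqrt (y\<^sup>2 + 1)"
  shows "legA p c (\<i> * of_real y) = exp (- p * (\<i> * of_real pi / 2 + of_real (ln ((y + r) / 2))))
    * hyps p (p - c + 1) c (of_real ((y - r) / (y + r)))"
proof -
  have r: "r > 0" unfolding r_def by (simp add: add_nonneg_pos)
  have s: "csqrt (1 - 1 / (\<i> * of_real y)\<^sup>2) = of_real (r / y)"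
    unfolding r_def by (rule csqrt_imaginary[OF y])
  have t: "(1 - complex_of_real (r / y)) / (1 + complex_of_real (r / y)) = of_real ((y - r) / (y + r))"
  proof -
    have "1 - r / y = (y - r) / y" "1 + r / y = (y + r) / y" using y by (simp_all add: field_simps)
    then have "(1 - r / y) / (1 + r / y) = (y - r) / (y + r)" using y by simp
    then show ?thesis by (metis of_real_1 of_real_add of_real_diff of_real_divide)
  qed
  have pos: "(1 + r / y) / 2 > 0" using y r by (simp add: add_pos_pos)
  have "(\<i> * of_real y) powr (- p) * ((1 + complex_of_real (r / y)) / 2) powr (- p)
      = exp (- p * (\<i> * of_real pi / 2 + of_real (ln y + ln ((1 + r / y) / 2))))"
  proof -
    have "(1 + complex_of_real (r / y)) / 2 = of_real ((1 + r / y) / 2)" by simp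
    then have "Ln ((1 + complex_of_real (r / y)) / 2) = of_real (ln ((1 + r / y) / 2))"
      using Ln_of_real[OF pos] by (simp only:)
    moreover have "(1 + complex_of_real (r / y)) / 2 \<noteq> 0"
      using pos \<open>(1 + complex_of_real (r / y)) / 2 = of_real ((1 + r / y) / 2)\<close> by (metis less_irrefl of_real_eq_0_iff)
    ultimately show ?thesis
      using y by (simp add: powr_def Ln_imaginary exp_add[symmetric] algebra_simps del: of_real_divide)
  qed
  also have "ln y + ln ((1 + r / y) / 2) = ln ((y + r) / 2)"
  proof -
    have "ln (y * ((1 + r / y) / 2)) = ln y + ln ((1 + r / y) / 2)" using y pos by (intro ln_mult_pos)
    moreover have "y * ((1 + r / y) / 2) = (y + r) / 2" using y by (simp add: field_simps)
    ultimately show ?thesis by simp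
  qed
  finally show ?thesis
    unfolding legA_def hypQ_def Let_def s t by (simp only: mult.assoc[symmetric])
qed

lemma filterlim_imaginary: "filterlim (\<lambda>y. \<i> * of_real y) (at 0 within {z. Im z > 0}) (at_right 0)"
  unfolding filterlim_at
proof
  show "\<forall>\<^sub>F y in at_right 0. \<i> * of_real y \<in> {z. Im z > 0} \<and> \<i> * of_real y \<noteq> 0"
    using eventually_at_right_less[of "0::real"] by eventually_elim simp
  show "((\<lambda>y. \<i> * of_real y) \<longlongrightarrow> 0) (at_right 0)" by (auto intro!: tendsto_eq_intros)
qed

text \<open>The series argument (y - r)/(y + r) tends to -1 inside the closed disc, and absolute
  convergence gives Kummer's sum. The prefactor tends to 2^p times the phase, and 2^p cancels
  against the power of 2 in Kummer's value.\<close>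

lemma legA_limit_base:
  assumes c: "c \<notin> \<int>\<^sub>\<le>\<^sub>0" and re: "Re (p - c + 1) < 0"
  shows "((\<lambda>y. legA p c (\<i> * of_real y)) \<longlongrightarrow> exp (- p * (\<i> * of_real pi / 2)) * legA0 p c) (at_right 0)"
proof -
  define m where "m = p - c + 1"
  have cm: "c = 1 + p - m" by (simp add: m_def)
  have m: "Re m < 0" using re by (simp add: m_def)
  define r where "r = (\<lambda>y. sqrt (y\<^sup>2 + 1))"
  have r: "r y > 0" "y \<le> r y" "r y > 0 \<Longrightarrow> \<bar>y - r y\<bar> \<le> y + r y" if "y > 0" for y
  proof -
    show "r y > 0" unfolding r_def by (simp add: add_nonneg_pos)
    show "y \<le> r y" unfolding r_def by (rule real_le_rsqrt) simp
    then show "\<bar>y - r y\<bar> \<le> y + r y" using that by simp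
  qed
  have r0: "(r \<longlongrightarrow> 1) (at_right 0)"
  proof -
    have "(r \<longlongrightarrow> sqrt (0\<^sup>2 + 1)) (at_right 0)" unfolding r_def by (intro tendsto_intros)
    then show ?thesis by simp
  qed
  have t: "((\<lambda>y. complex_of_real ((y - r y) / (y + r y))) \<longlongrightarrow> -1) (at_right 0)"
  proof -
    have "((\<lambda>y. complex_of_real ((y - r y) / (y + r y))) \<longlongrightarrow> of_real ((0 - 1) / (0 + 1))) (at_right 0)"
      by (intro tendsto_intros r0) auto
    then show ?thesis by simp
  qed
  have tn: "\<forall>\<^sub>F y in at_right 0. norm (complex_of_real ((y - r y) / (y + r y))) \<le> 1"
    using eventually_at_right_less[of "0::real"]
  proof eventually_elim
    case (elim y)
    have "\<bar>y - r y\<bar> / \<bar>y + r y\<bar> \<le> 1" using r[OF elim] elim by simp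
    then show ?case unfolding norm_of_real abs_divide .
  qed
  have sm: "summable (\<lambda>n. norm (fps_nth (hyp_fps p m c) n))"
    using m by (intro hyp_fps_summable_norm c) (simp add: cm)
  have h: "((\<lambda>y. hyps p m c (of_real ((y - r y) / (y + r y)))) \<longlongrightarrow> kummerK p m) (at_right 0)"
    unfolding hyps_def eval_fps_def kummerK_def cm[symmetric]
    by (rule tendsto_power_series_minus_one[OF sm t tn])
  have "((\<lambda>y. exp (- p * (\<i> * of_real pi / 2 + of_real (ln ((y + r y) / 2)))) * hyps p m c (of_real ((y - r y) / (y + r y))))
      \<longlongrightarrow> exp (- p * (\<i> * of_real pi / 2 + of_real (ln ((0 + 1) / 2)))) * kummerK p m) (at_right 0)"
    by (intro tendsto_intros r0 h) auto
  moreover have "\<forall>\<^sub>F y in at_right 0. exp (- p * (\<i> * of_real pi / 2 + of_real (ln ((y + r y) / 2)))) * hyps p m c (of_real ((y - r y) / (y + r y)))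
      = legA p c (\<i> * of_real y)"
    using eventually_at_right_less[of "0::real"]
    by eventually_elim (simp only: legA_imaginary r_def m_def)
  ultimately have "((\<lambda>y. legA p c (\<i> * of_real y)) \<longlongrightarrow> exp (- p * (\<i> * of_real pi / 2 + of_real (ln ((0 + 1) / 2)))) * kummerK p m) (at_right 0)"
    by (rule Lim_transform_eventually)
  also have "exp (- p * (\<i> * of_real pi / 2 + of_real (ln ((0 + 1) / 2)))) = exp (- p * (\<i> * of_real pi / 2)) * 2 powr p"
    unfolding two_powr_complex exp_add[symmetric] by (simp add: ln_div algebra_simps)
  also have "exp (- p * (\<i> * of_real pi / 2)) * 2 powr p * kummerK p m = exp (- p * (\<i> * of_real pi / 2)) * legA0 p c"
  proof -
    have 1: "1 + p / 2 - m = c - p / 2" by (simp add: m_def field_simps)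
    have "1 + p - m \<notin> \<int>\<^sub>\<le>\<^sub>0" using c cm by simp
    from kummer_value[OF this m] have "kummerK p m = 2 powr (- p) * legA0 p c"
      unfolding legA0_def 1 cm[symmetric] by (simp only: mult_ac)
    then show ?thesis by (simp add: powr_minus)
  qed
  finally show ?thesis .
qed

text \<open>The case in which the shift of \<open>c\<close> by one carries no information: there the hypergeometric
  series collapses to a binomial series.\<close>
lemma legA_limit_binomial:
  assumes c: "c \<notin> \<int>\<^sub>\<le>\<^sub>0" and cp: "c = (p + 1) / 2"
  shows "((\<lambda>y. legA p c (\<i> * of_real y)) \<longlongrightarrow> exp (- p * (\<i> * of_real pi / 2)) * legA0 p c) (at_right 0)"
proof -
  have hypQ: "hypQ p c w = (1 - w) powr (- p / 2)" if w: "w \<in> slit" for w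
  proof (rule slit_eqI[OF hypQ_fps[OF c] _ _ _ w])
    have "\<forall>\<^sub>F u in nhds (0::complex). norm u < 1"
      using eventually_nhds_in_open[of "ball 0 1" "0::complex"] by simp
    then have "\<forall>\<^sub>F u in nhds 0. (\<lambda>n. fps_nth (hyp_fps (p / 2) ((p + 1) / 2) c) n * u ^ n) sums (1 - u) powr (- p / 2)"
    proof eventually_elim
      case (elim u)
      have "(\<lambda>n. (- p / 2 gchoose n) * (- u) ^ n) sums (1 + (- u)) powr (- p / 2)"
        using elim by (intro gen_binomial_complex) auto
      moreover have "(- p / 2 gchoose n) * (- u) ^ n = fps_nth (hyp_fps (p / 2) ((p + 1) / 2) c) n * u ^ n" for n
      proof -
        have "pochhammer c n \<noteq> 0" using c pochhammer_eq_0_imp_nonpos_Int by blast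
        then show ?thesis
          by (simp add: gbinomial_pochhammer hyp_fps_def cp[symmetric] power_minus[of u])
      qed
      ultimately show ?case by simp
    qed
    then show "(\<lambda>w. (1 - w) powr (- p / 2)) has_fps_expansion hyp_fps (p / 2) ((p + 1) / 2) c"
      by (rule has_fps_expansionI)
    show "(\<lambda>w. (1 - w) powr (- p / 2)) holomorphic_on slit"
      by (intro holomorphic_intros) (auto simp: slit_iff)
  qed (auto intro!: holomorphic_intros c)
  have eq: "legA p c (\<i> * of_real y) = exp (- p * (\<i> * of_real pi / 2 + of_real (ln (y\<^sup>2 + 1) / 2)))" if y: "y > 0" for y
  proof -
    have w: "1 / (\<i> * of_real y)\<^sup>2 \<in> slit" using y by (intro inverse_square_in_slit) simp
    have "1 - 1 / (\<i> * of_real y)\<^sup>2 = complex_of_real ((y\<^sup>2 + 1) / y\<^sup>2)"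
      using y by (simp add: power_mult_distrib field_simps)
    moreover have pos: "(y\<^sup>2 + 1) / y\<^sup>2 > 0" using y by (simp add: add_nonneg_pos)
    ultimately have "(1 - 1 / (\<i> * of_real y)\<^sup>2) powr (- p / 2) = exp (- p / 2 * of_real (ln ((y\<^sup>2 + 1) / y\<^sup>2)))"
      using Ln_of_real[OF pos] by (simp only: powr_def of_real_eq_0_iff) auto
    also have "ln ((y\<^sup>2 + 1) / y\<^sup>2) = ln (y\<^sup>2 + 1) - 2 * ln y"
    proof -
      have "y\<^sup>2 + 1 > 0" by (simp add: add_nonneg_pos)
      then show ?thesis using y ln_realpow[of y 2] by (simp add: ln_div)
    qed
    finally have "legA p c (\<i> * of_real y) = exp (- p * (of_real (ln y) + \<i> * of_real pi / 2)) * exp (- p / 2 * of_real (ln (y\<^sup>2 + 1) - 2 * ln y))"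
      using y unfolding legA_def hypQ[OF w] by (simp add: powr_def Ln_imaginary)
    then show ?thesis by (simp add: exp_add[symmetric] field_simps)
  qed
  have "((\<lambda>y::real. exp (- p * (\<i> * of_real pi / 2 + of_real (ln (y\<^sup>2 + 1) / 2)))) \<longlongrightarrow>
      exp (- p * (\<i> * of_real pi / 2 + of_real (ln (0\<^sup>2 + 1) / 2)))) (at_right 0)"
    by (intro tendsto_intros) auto
  moreover have "\<forall>\<^sub>F y in at_right 0. exp (- p * (\<i> * of_real pi / 2 + of_real (ln (y\<^sup>2 + 1) / 2))) = legA p c (\<i> * of_real y)"
    using eventually_at_right_less[of "0::real"] by eventually_elim (simp only: eq)
  ultimately have "((\<lambda>y. legA p c (\<i> * of_real y)) \<longlongrightarrow> exp (- p * (\<i> * of_real pi / 2 + of_real (ln (0\<^sup>2 + 1) / 2)))) (at_right 0)"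
    by (rule Lim_transform_eventually)
  moreover have "legA0 p c = 1"
  proof -
    have 1: "(1 + p) / 2 = c" "c - p / 2 = 1 / 2" by (simp_all add: cp field_simps)
    have "Gamma c * rGamma c = 1" using c by (simp add: rGamma_inverse_Gamma Gamma_eq_zero_iff)
    moreover have "complex_of_real (sqrt pi) * rGamma (1 / 2) = 1"
      by (simp add: rGamma_inverse_Gamma Gamma_one_half_complex)
    ultimately show ?thesis unfolding legA0_def 1 by (metis (no_types, opaque_lifting) mult.assoc mult.commute mult_1)
  qed
  ultimately show ?thesis by simp
qed

text \<open>Uniqueness of limits needs a nontrivial filter; the sign of s selects the
  half-plane.\<close>

lemma at_within_half_plane_ne_bot:
  assumes "s \<noteq> 0"
  shows "at (of_real t) within {z. s * Im z > 0} \<noteq> bot"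
proof -
  have "of_real t islimpt {z. s * Im z > 0}"
    unfolding islimpt_approachable
  proof (intro allI impI)
    fix e :: real assume e: "e > 0"
    define z where "z = of_real t + \<i> * of_real (sgn s * e / 2)"
    have eq: "z - of_real t = \<i> * of_real (sgn s * e / 2)" by (simp add: z_def)
    have "dist z (of_real t) = e / 2"
      unfolding dist_norm eq norm_mult norm_of_real using e assms by (auto simp: sgn_if)
    then have "dist z (of_real t) < e" "z \<noteq> of_real t" using e by auto
    moreover have "s * Im z > 0"
      using e assms mult_neg_pos[of s e] by (auto simp: z_def sgn_if)
    ultimately show "\<exists>z\<in>{z. s * Im z > 0}. z \<noteq> of_real t \<and> dist z (of_real t) < e" by blast
  qed
  then show ?thesis by (simp add: trivial_limit_within)
qed

text \<open>Induction on an upper bound k of Re(p - c + 1), which drops by one when c is raised by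
  one. At z = 0 the derivative term of the contiguous relation disappears, because it carries the
  factor z, and both sides keep a common factor c - (p + 1)/2. Cancelling it yields the value at c
  from that at c + 1; where it vanishes, the binomial case applies.\<close>

lemma legA_limit:
  assumes c: "c \<notin> \<int>\<^sub>\<le>\<^sub>0"
  shows "(legA p c \<longlongrightarrow> exp (- p * (\<i> * of_real pi / 2)) * legA0 p c) (at 0 within {z. Im z > 0})"
proof -
  let ?U = "at 0 within {z::complex. Im z > 0}"
  let ?e = "exp (- p * (\<i> * of_real pi / 2))"
  have ne: "?U \<noteq> bot"
    using at_within_half_plane_ne_bot[of 1 0] by simp
  have ex: "\<exists>a b. (legA p c \<longlongrightarrow> a) ?U \<and> ((\<lambda>z. - p * legA (p + 1) c z) \<longlongrightarrow> b) ?U" if "c \<notin> \<int>\<^sub>\<le>\<^sub>0" for c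
  proof -
    obtain E E' where E: "legendre_sol (ball 0 1) p (p - 2 * c + 2) E E'" "E 0 = 1" "E' 0 = 0"
      by (rule legendre_even_sol)
    obtain H H' where H: "legendre_sol (ball 0 1) p (p - 2 * c + 2) H H'" "H 0 = 0" "H' 0 = 1"
      by (rule legendre_odd_sol)
    show ?thesis using legA_expansion[OF that E H] by metis
  qed
  have via: "(legA p c \<longlongrightarrow> ?e * legA0 p c) ?U"
    if c: "c \<notin> \<int>\<^sub>\<le>\<^sub>0" and l: "((\<lambda>y. legA p c (\<i> * of_real y)) \<longlongrightarrow> ?e * legA0 p c) (at_right 0)" for c
  proof -
    obtain a where a: "(legA p c \<longlongrightarrow> a) ?U" using ex[OF c] by blast
    have "((\<lambda>y. legA p c (\<i> * of_real y)) \<longlongrightarrow> a) (at_right 0)"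
      by (rule filterlim_compose[OF a filterlim_imaginary])
    then have "a = ?e * legA0 p c" using l by (rule tendsto_unique[rotated]) simp
    then show ?thesis using a by simp
  qed
  have "(legA p c \<longlongrightarrow> ?e * legA0 p c) ?U" if "Re (p - c + 1) < real k" "c \<notin> \<int>\<^sub>\<le>\<^sub>0" for k c
    using that
  proof (induction k arbitrary: c)
    case 0
    then show ?case using via legA_limit_base by simp
  next
    case (Suc k)
    note c = Suc.prems(2)
    show ?case
    proof (cases "c = (p + 1) / 2")
      case True
      then show ?thesis using via[OF c] legA_limit_binomial[OF c] by blast
    next
      case False
      obtain a b where ab: "(legA p c \<longlongrightarrow> a) ?U" "((\<lambda>z. - p * legA (p + 1) c z) \<longlongrightarrow> b) ?U"
        using ex[OF c] by blast
      have c1: "c + 1 \<notin> \<int>\<^sub>\<le>\<^sub>0" using add_nat_notin_nonpos_Ints[OF c, of 1] by simp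
      have "(legA p (c + 1) \<longlongrightarrow> ?e * legA0 p (c + 1)) ?U"
        using Suc.prems c1 by (intro Suc.IH) auto
      then have l1: "((\<lambda>z. (c - p / 2) * (c - (p + 1) / 2) * legA p (c + 1) z) \<longlongrightarrow>
          (c - p / 2) * (c - (p + 1) / 2) * (?e * legA0 p (c + 1))) ?U"
        by (intro tendsto_intros)
      \<comment> \<open>The product -p * \<open>legA (p + 1) c\<close> is kept together, since it is
        the function whose limit b is known.\<close>
      have "((\<lambda>z. c * ((z\<^sup>2 - 1) * (- z * (- p * legA (p + 1) c z) - p * legA p c z) / 2 + (c - p - 1 / 2) * legA p c z)) \<longlongrightarrow>
          c * ((0\<^sup>2 - 1) * (- 0 * b - p * a) / 2 + (c - p - 1 / 2) * a)) ?U"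
        by (intro tendsto_intros ab) auto
      moreover have "\<forall>\<^sub>F z in ?U. c * ((z\<^sup>2 - 1) * (- z * (- p * legA (p + 1) c z) - p * legA p c z) / 2 + (c - p - 1 / 2) * legA p c z)
         = (c - p / 2) * (c - (p + 1) / 2) * legA p (c + 1) z"
        unfolding eventually_at_filter
      proof (intro always_eventually allI impI)
        fix z assume "z \<in> {z::complex. Im z > 0}"
        then have z: "Im z \<noteq> 0" by simp
        show "c * ((z\<^sup>2 - 1) * (- z * (- p * legA (p + 1) c z) - p * legA p c z) / 2 + (c - p - 1 / 2) * legA p c z)
           = (c - p / 2) * (c - (p + 1) / 2) * legA p (c + 1) z"
          unfolding legA_shift_c[OF c z] by simp
      qed
      ultimately have "((\<lambda>z. (c - p / 2) * (c - (p + 1) / 2) * legA p (c + 1) z) \<longlongrightarrow> c * ((0\<^sup>2 - 1) * (- 0 * b - p * a) / 2 + (c - p - 1 / 2) * a)) ?U"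
        by (rule Lim_transform_eventually)
      with l1 have "(c - p / 2) * (c - (p + 1) / 2) * (?e * legA0 p (c + 1)) = c * ((0\<^sup>2 - 1) * (- 0 * b - p * a) / 2 + (c - p - 1 / 2) * a)"
        by (rule tendsto_unique[OF ne])
      also have "\<dots> = (c - (p + 1) / 2) * (c * a)" by (simp add: field_simps)
      finally have "(c - p / 2) * (?e * legA0 p (c + 1)) = c * a" using False by simp
      moreover have "(c - p / 2) * legA0 p (c + 1) = c * legA0 p c"
      proof -
        have "(c - p / 2) * rGamma (c + 1 - p / 2) = rGamma (c - p / 2)"
          using rGamma_plus1[of "c - p / 2"] by (simp add: algebra_simps)
        moreover have "Gamma (c + 1) = c * Gamma c" using c by (intro Gamma_plus1) auto
        moreover have "k * (S * (c * G) * R * R') = c * (S * G * R * (k * R'))" for k S G R R' :: complex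
          by (simp only: mult_ac)
        ultimately show ?thesis unfolding legA0_def by metis
      qed
      ultimately have "c * a = c * (?e * legA0 p c)" by (metis mult.left_commute)
      moreover have "c \<noteq> 0" using c by auto
      ultimately show ?thesis using ab by simp
    qed
  qed
  moreover obtain k where "Re (p - c + 1) < real k" using reals_Archimedean2 by blast
  ultimately show ?thesis using c by blast
qed

section \<open>Connection coefficients\<close>

text \<open>Written with 1/Gamma the duplication formula has no exceptional points: where one of the
  factors on the right has a zero, so does the left side.\<close>

lemma rGamma_legendre_duplication:
  fixes z :: complex
  shows "rGamma (2 * z) = 2 powr (1 - 2 * z) * of_real (sqrt pi) * rGamma z * rGamma (z + 1 / 2)"
proof (cases "z \<in> \<int>\<^sub>\<le>\<^sub>0 \<or> z + 1 / 2 \<in> \<int>\<^sub>\<le>\<^sub>0")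
  case True
  have "2 * z \<in> \<int>\<^sub>\<le>\<^sub>0"
  proof -
    have "2 * z = - of_nat (2 * k)" if "z = - of_nat k" for k using that by simp
    moreover have "2 * z = - of_nat (2 * k + 1)" if "z + 1 / 2 = - of_nat k" for k
      using that by (simp add: eq_diff_eq[symmetric])
    ultimately show ?thesis using True by (metis minus_of_nat_in_nonpos_Ints nonpos_Ints_cases')
  qed
  then have "rGamma (2 * z) = 0" by (simp add: rGamma_eq_zero_iff)
  moreover have "rGamma z = 0 \<or> rGamma (z + 1 / 2) = 0" using True by (simp only: rGamma_eq_zero_iff)
  ultimately show ?thesis by auto
next
  case False
  then have nz: "rGamma z \<noteq> 0" "rGamma (z + 1 / 2) \<noteq> 0" by (simp_all add: rGamma_eq_zero_iff)
  have eq: "inverse (rGamma z) * inverse (rGamma (z + 1 / 2)) = 2 powr (1 - 2 * z) * of_real (sqrt pi) * inverse (rGamma (2 * z))"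
    using Gamma_legendre_duplication[of z] False
    by (simp add: rGamma_inverse_Gamma two_powr_complex)
  have "rGamma (2 * z) \<noteq> 0"
  proof
    assume "rGamma (2 * z) = 0"
    then show False using eq nz by simp
  qed
  then show ?thesis using eq nz by (simp add: field_simps)
qed

lemma sqrt_pi_sq: "complex_of_real (sqrt pi) * complex_of_real (sqrt pi) = of_real pi"
  by (simp flip: of_real_mult)

lemma pi_powr_three_halves: "complex_of_real (pi powr (3 / 2)) = of_real pi * of_real (sqrt pi)"
proof -
  have "pi powr (3 / 2) = pi powr (1 + 1 / 2)" by simp
  also have "\<dots> = pi * sqrt pi" by (subst powr_add) (simp add: powr_half_sqrt)
  finally show ?thesis by simp
qed

text \<open>The constants in front are those of the second and of the first term of the theorem.
  Duplication of 1/Gamma at p and at 1 - q leaves Gamma factors that pair up by reflection, so the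
  even coefficients of the two functions differ by a trigonometric factor only.\<close>

lemma gamma_connection_even:
  fixes \<nu> \<mu> :: complex
  defines "p \<equiv> \<nu> + \<mu> + 1" and "c \<equiv> \<nu> + 3 / 2" and "q \<equiv> \<mu> - \<nu>" and "d \<equiv> 1 / 2 - \<nu>"
  assumes p: "p \<notin> \<int>\<^sub>\<le>\<^sub>0" and c: "c \<notin> \<int>\<^sub>\<le>\<^sub>0" and d: "d \<notin> \<int>\<^sub>\<le>\<^sub>0"
  shows "of_real (pi powr (3 / 2)) * 2 powr (\<nu> - 1) * rGamma (1 - q) * rGamma d * legA0 q d
     = of_real (sqrt pi) * 2 powr (- \<nu> - 1) * Gamma p * rGamma c * legA0 p c * (cos (of_real pi * q / 2) * sin (of_real pi * p / 2))"
proof -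
  define S where "S = complex_of_real (sqrt pi)"
  define \<pi> where "\<pi> = complex_of_real pi"
  have S: "S * S = \<pi>" unfolding S_def \<pi>_def by (rule sqrt_pi_sq)
  have pi0: "\<pi> \<noteq> 0" by (simp add: \<pi>_def)
  have inv: "Gamma p * rGamma p = 1" "Gamma c * rGamma c = 1" "Gamma d * rGamma d = 1"
    using p c d by (simp_all add: rGamma_inverse_Gamma Gamma_eq_zero_iff)
  define P P2 Q Q1 Q2 where "P = rGamma (p / 2)" and "P2 = rGamma ((1 + p) / 2)"
    and "Q = rGamma (1 - q / 2)" and "Q1 = rGamma ((1 - q) / 2)" and "Q2 = rGamma ((1 + q) / 2)"
  have dup1: "rGamma p = 2 powr (1 - p) * S * P * P2"
    using rGamma_legendre_duplication[of "p / 2"] unfolding P_def P2_def S_def by (simp add: add_divide_distrib add_ac)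
  have dup2: "rGamma (1 - q) = 2 powr q * S * Q1 * Q"
    using rGamma_legendre_duplication[of "(1 - q) / 2"] unfolding Q1_def Q_def S_def by (simp add: add_divide_distrib diff_divide_distrib)
  have ref1: "P * rGamma (1 - p / 2) * \<pi> = sin (\<pi> * p / 2)"
    using rGamma_reflection_complex[of "p / 2"] unfolding P_def \<pi>_def by (simp add: field_simps)
  have ref2: "Q1 * Q2 * \<pi> = cos (\<pi> * q / 2)"
  proof -
    have "rGamma ((1 - q) / 2) * rGamma (1 - (1 - q) / 2) = sin (\<pi> * ((1 - q) / 2)) / \<pi>"
      unfolding \<pi>_def by (rule rGamma_reflection_complex)
    moreover have "1 - (1 - q) / 2 = (1 + q) / 2" by (simp add: field_simps)
    moreover have "\<pi> * ((1 - q) / 2) = of_real pi / 2 - \<pi> * q / 2" by (simp add: \<pi>_def field_simps)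
    moreover have "sin (of_real pi / 2 - \<pi> * q / 2) = cos (\<pi> * q / 2)" by (simp add: sin_diff)
    ultimately show ?thesis unfolding Q1_def Q2_def using pi0 by (simp add: field_simps)
  qed
  have args: "d - q / 2 = 1 - p / 2" "c - p / 2 = 1 - q / 2" by (simp_all add: p_def c_def q_def d_def field_simps)
  have pw: "2 powr (1 - p) * 2 powr (\<nu> - 1) * 2 powr q = (2 powr (- \<nu> - 1) :: complex)"
  proof -
    have "1 - p + (\<nu> - 1) + q = - \<nu> - 1" by (simp add: p_def q_def)
    then show ?thesis unfolding powr_add[symmetric] by (simp only:)
  qed
  have Lq: "rGamma d * legA0 q d = S * Q2 * rGamma (1 - p / 2)"
    using inv(3) unfolding legA0_def args Q2_def S_def by (simp add: mult_ac)
  have Lp: "rGamma c * legA0 p c = S * P2 * Q"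
    using inv(2) unfolding legA0_def args P2_def Q_def S_def by (simp add: mult_ac)
  \<comment> \<open>Both sides are multiplied by the nonzero \<open>rGamma p\<close>, so that its
    duplication can be used; the factor is cancelled at the end.\<close>
  have "rGamma p * (of_real (pi powr (3 / 2)) * 2 powr (\<nu> - 1) * rGamma (1 - q) * (rGamma d * legA0 q d))
     = (2 powr (1 - p) * S * P * P2) * ((\<pi> * S) * 2 powr (\<nu> - 1) * (2 powr q * S * Q1 * Q) * (S * Q2 * rGamma (1 - p / 2)))"
    unfolding Lq dup2 unfolding dup1 pi_powr_three_halves S_def \<pi>_def ..
  also have "\<dots> = (2 powr (1 - p) * 2 powr (\<nu> - 1) * 2 powr q) * ((S * S) * (S * S) * \<pi>) * (P * rGamma (1 - p / 2)) * (Q1 * Q2) * P2 * Q"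
    by (simp only: mult_ac)
  also have "\<dots> = 2 powr (- \<nu> - 1) * \<pi> * (P * rGamma (1 - p / 2) * \<pi>) * (Q1 * Q2 * \<pi>) * P2 * Q"
    unfolding pw S by (simp only: mult_ac)
  also have "\<dots> = (Gamma p * rGamma p) * (2 powr (- \<nu> - 1) * (S * S) * sin (\<pi> * p / 2) * cos (\<pi> * q / 2) * P2 * Q)"
    unfolding ref1 ref2 inv S by simp
  also have "\<dots> = rGamma p * (S * 2 powr (- \<nu> - 1) * Gamma p * (rGamma c * legA0 p c) * (cos (\<pi> * q / 2) * sin (\<pi> * p / 2)))"
    unfolding Lp by (simp only: mult_ac)
  finally have "of_real (pi powr (3 / 2)) * 2 powr (\<nu> - 1) * rGamma (1 - q) * (rGamma d * legA0 q d)
     = S * 2 powr (- \<nu> - 1) * Gamma p * (rGamma c * legA0 p c) * (cos (\<pi> * q / 2) * sin (\<pi> * p / 2))"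
    using p by (simp add: rGamma_eq_zero_iff)
  then show ?thesis unfolding S_def \<pi>_def by (simp only: mult.assoc)
qed

text \<open>The same computation for the odd coefficients. The extra factors p and q come from
  differentiating A and are absorbed by the functional equation of 1/Gamma, so q = 0 needs no
  separate treatment.\<close>

lemma gamma_connection_odd:
  fixes \<nu> \<mu> :: complex
  defines "p \<equiv> \<nu> + \<mu> + 1" and "c \<equiv> \<nu> + 3 / 2" and "q \<equiv> \<mu> - \<nu>" and "d \<equiv> 1 / 2 - \<nu>"
  assumes p: "p \<notin> \<int>\<^sub>\<le>\<^sub>0" and c: "c \<notin> \<int>\<^sub>\<le>\<^sub>0" and d: "d \<notin> \<int>\<^sub>\<le>\<^sub>0"
  shows "of_real (pi powr (3 / 2)) * 2 powr (\<nu> - 1) * rGamma (1 - q) * rGamma d * (q * legA0 (q + 1) d)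
     = of_real (sqrt pi) * 2 powr (- \<nu> - 1) * Gamma p * rGamma c * (p * legA0 (p + 1) c) * (sin (of_real pi * q / 2) * cos (of_real pi * p / 2))"
proof -
  define S where "S = complex_of_real (sqrt pi)"
  define \<pi> where "\<pi> = complex_of_real pi"
  have S: "S * S = \<pi>" unfolding S_def \<pi>_def by (rule sqrt_pi_sq)
  have pi0: "\<pi> \<noteq> 0" by (simp add: \<pi>_def)
  have inv: "Gamma p * rGamma p = 1" "Gamma c * rGamma c = 1" "Gamma d * rGamma d = 1"
    using p c d by (simp_all add: rGamma_inverse_Gamma Gamma_eq_zero_iff)
  define P P2 P3 Q Q1 Q2 where "P = rGamma (p / 2)" and "P2 = rGamma ((1 + p) / 2)" and "P3 = rGamma ((1 - p) / 2)"
    and "Q = rGamma (1 + q / 2)" and "Q1 = rGamma ((1 - q) / 2)" and "Q2 = rGamma (- q / 2)"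
  have dup1: "rGamma p = 2 powr (1 - p) * S * P * P2"
    using rGamma_legendre_duplication[of "p / 2"] unfolding P_def P2_def S_def by (simp add: add_divide_distrib add_ac)
  have dup2: "q * rGamma (1 - q) = - (2 powr (1 + q) * S * Q2 * Q1)"
  proof -
    have "- q * rGamma (- q + 1) = rGamma (- q)" by (rule rGamma_plus1)
    moreover have "rGamma (- q) = 2 powr (1 + q) * S * Q2 * Q1"
      using rGamma_legendre_duplication[of "- q / 2"] unfolding Q1_def Q2_def S_def by (simp add: add_divide_distrib diff_divide_distrib)
    ultimately show ?thesis by (metis minus_mult_left minus_minus add.commute diff_conv_add_uminus)
  qed
  have ref1: "P2 * P3 * \<pi> = cos (\<pi> * p / 2)"
  proof -
    have "rGamma ((1 - p) / 2) * rGamma (1 - (1 - p) / 2) = sin (\<pi> * ((1 - p) / 2)) / \<pi>"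
      unfolding \<pi>_def by (rule rGamma_reflection_complex)
    moreover have "1 - (1 - p) / 2 = (1 + p) / 2" by (simp add: field_simps)
    moreover have "\<pi> * ((1 - p) / 2) = of_real pi / 2 - \<pi> * p / 2" by (simp add: \<pi>_def field_simps)
    moreover have "sin (of_real pi / 2 - \<pi> * p / 2) = cos (\<pi> * p / 2)" by (simp add: sin_diff)
    ultimately show ?thesis unfolding P2_def P3_def using pi0 by (simp add: field_simps)
  qed
  have ref2: "Q2 * Q * \<pi> = - sin (\<pi> * q / 2)"
    using rGamma_reflection_complex[of "- q / 2"] unfolding Q_def Q2_def \<pi>_def by (simp add: field_simps)
  have args: "d - (q + 1) / 2 = (1 - p) / 2" "c - (p + 1) / 2 = (1 - q) / 2" "(1 + (q + 1)) / 2 = 1 + q / 2" "(1 + (p + 1)) / 2 = p / 2 + 1"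
    by (simp_all add: p_def c_def q_def d_def field_simps)
  have pw: "2 powr (1 - p) * 2 powr (\<nu> - 1) * 2 powr (1 + q) = 2 * (2 powr (- \<nu> - 1) :: complex)"
  proof -
    have "2 * (2 powr (- \<nu> - 1) :: complex) = 2 powr 1 * 2 powr (- \<nu> - 1)" by simp
    then show ?thesis unfolding powr_add[symmetric] by (simp add: p_def q_def algebra_simps)
  qed
  have Lq: "rGamma d * legA0 (q + 1) d = S * Q * P3"
    using inv(3) unfolding legA0_def args Q_def S_def P3_def by (simp add: mult_ac)
  have Lp: "rGamma c * (p * legA0 (p + 1) c) = 2 * S * P * Q1"
  proof -
    have 1: "p * rGamma (p / 2 + 1) = 2 * P"
      using rGamma_plus1[of "p / 2"] unfolding P_def by (simp add: field_simps)
    have "rGamma c * (p * legA0 (p + 1) c) = (Gamma c * rGamma c) * S * (p * rGamma (p / 2 + 1)) * Q1"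
      unfolding legA0_def args Q1_def[symmetric] S_def[symmetric] by (simp only: mult_ac)
    then show ?thesis unfolding inv 1 by (simp add: mult_ac)
  qed
  have "rGamma p * (of_real (pi powr (3 / 2)) * 2 powr (\<nu> - 1) * (q * rGamma (1 - q)) * (rGamma d * legA0 (q + 1) d))
     = (2 powr (1 - p) * S * P * P2) * ((\<pi> * S) * 2 powr (\<nu> - 1) * - (2 powr (1 + q) * S * Q2 * Q1) * (S * Q * P3))"
    unfolding Lq dup2 unfolding dup1 pi_powr_three_halves S_def \<pi>_def ..
  also have "\<dots> = - ((2 powr (1 - p) * 2 powr (\<nu> - 1) * 2 powr (1 + q)) * ((S * S) * (S * S) * \<pi>) * (P2 * P3) * (Q2 * Q) * P * Q1)"
    by (simp only: mult_ac mult_minus_left mult_minus_right)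
  also have "\<dots> = - (2 * 2 powr (- \<nu> - 1) * \<pi> * (P2 * P3 * \<pi>) * (Q2 * Q * \<pi>) * P * Q1)"
    unfolding pw S by (simp only: mult_ac)
  also have "\<dots> = (Gamma p * rGamma p) * (2 * 2 powr (- \<nu> - 1) * (S * S) * sin (\<pi> * q / 2) * cos (\<pi> * p / 2) * P * Q1)"
    unfolding ref1 ref2 inv S by simp
  also have "\<dots> = rGamma p * (S * 2 powr (- \<nu> - 1) * Gamma p * (rGamma c * (p * legA0 (p + 1) c)) * (sin (\<pi> * q / 2) * cos (\<pi> * p / 2)))"
    unfolding Lp by (simp only: mult_ac)
  finally have "of_real (pi powr (3 / 2)) * 2 powr (\<nu> - 1) * (q * rGamma (1 - q)) * (rGamma d * legA0 (q + 1) d)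
     = S * 2 powr (- \<nu> - 1) * Gamma p * (rGamma c * (p * legA0 (p + 1) c)) * (sin (\<pi> * q / 2) * cos (\<pi> * p / 2))"
    using p by (simp add: rGamma_eq_zero_iff)
  moreover have "of_real (pi powr (3 / 2)) * 2 powr (\<nu> - 1) * rGamma (1 - q) * rGamma d * (q * legA0 (q + 1) d)
     = of_real (pi powr (3 / 2)) * 2 powr (\<nu> - 1) * (q * rGamma (1 - q)) * (rGamma d * legA0 (q + 1) d)"
    by (simp only: mult_ac)
  ultimately show ?thesis unfolding S_def \<pi>_def by (simp only: mult.assoc)
qed

text \<open>\<open>k1\<close> and \<open>k2\<close> are the coefficients of the theorem, and the two
  identities say that they reproduce the even and odd coefficients of the mean of the boundary
  values. Writing \<sigma> for s i, only Euler's formula and \<sigma>^2 = -1 are used, so both signs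
  are treated at once. In the half angles a and b, and after multiplication by cos(2a), everything
  is a polynomial identity modulo the two Pythagorean relations.\<close>

lemma trig_connection:
  fixes \<nu> \<mu> :: complex and s :: real
  defines "p \<equiv> \<nu> + \<mu> + 1" and "q \<equiv> \<mu> - \<nu>"
  defines "k1 \<equiv> exp (s * \<i> * pi * \<mu>) * (cos (pi * \<mu>) - s * \<i> * (sin (pi * (\<mu> - \<nu>)) / (2 * cos (pi * \<nu>))))"
    and "k2 \<equiv> exp (s * pi * \<i> * (1 / 2 + \<mu>)) * (1 / cos (pi * \<nu>))"
  assumes s: "s = 1 \<or> s = -1" and cs: "cos (pi * \<nu>) \<noteq> 0"
  shows "k1 * exp (- (s * \<i> * pi * p / 2)) + k2 * exp (- (s * \<i> * pi * q / 2)) * (cos (of_real pi * q / 2) * sin (of_real pi * p / 2))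
      = cos (of_real pi * p / 2)" (is ?even)
    and "s * \<i> * (k1 * exp (- (s * \<i> * pi * p / 2)) + k2 * exp (- (s * \<i> * pi * q / 2)) * (sin (of_real pi * q / 2) * cos (of_real pi * p / 2)))
      = sin (of_real pi * p / 2)" (is ?odd)
proof -
  define a b where "a = pi * \<nu> / 2" and "b = pi * \<mu> / 2"
  define \<sigma> where "\<sigma> = s * \<i>"
  have \<sigma>: "\<sigma> * \<sigma> = -1" using s by (auto simp: \<sigma>_def)
  have \<sigma>2: "\<sigma> * (\<sigma> * z) = - z" for z using \<sigma> by (simp flip: mult.assoc)
  have euler: "exp (\<sigma> * z) = cos z + \<sigma> * sin z" for z
    using s exp_Euler[of z] exp_minus_Euler[of z] unfolding \<sigma>_def by auto
  define ca sa cb sb where "ca = cos a" and "sa = sin a" and "cb = cos b" and "sb = sin b"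
  have pyth: "ca\<^sup>2 + sa\<^sup>2 = 1" "cb\<^sup>2 + sb\<^sup>2 = 1"
    by (simp_all add: ca_def sa_def cb_def sb_def add.commute)
  have ab: "pi * \<mu> = 2 * b" "pi * \<nu> = 2 * a" "pi * (\<mu> - \<nu>) = 2 * (b - a)" "of_real pi * q / 2 = b - a"
      "of_real pi * p / 2 = (a + b) + of_real pi / 2"
    unfolding a_def b_def p_def q_def by (simp_all add: field_simps)
  have trig: "cos (of_real pi * p / 2) = - sin (a + b)" "sin (of_real pi * p / 2) = cos (a + b)"
    unfolding ab by (simp_all add: cos_add sin_add)
  have e1: "exp (s * \<i> * pi * \<mu>) = cos (2 * b) + \<sigma> * sin (2 * b)"
    unfolding euler[symmetric] by (simp add: \<sigma>_def b_def mult_ac)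
  have e2: "exp (- (s * \<i> * pi * p / 2)) = - \<sigma> * (cos (a + b) - \<sigma> * sin (a + b))"
  proof -
    have eq: "- (s * \<i> * pi * p / 2) = \<sigma> * (- ((a + b) + of_real pi / 2))"
      unfolding ab(5)[symmetric] by (simp add: \<sigma>_def mult_ac)
    show ?thesis unfolding eq euler cos_minus sin_minus by (simp add: cos_add sin_add algebra_simps \<sigma>2)
  qed
  have e3: "exp (- (s * \<i> * pi * q / 2)) = cos (b - a) - \<sigma> * sin (b - a)"
  proof -
    have eq: "- (s * \<i> * pi * q / 2) = \<sigma> * (- (b - a))"
      unfolding ab(4)[symmetric] by (simp add: \<sigma>_def mult_ac)
    show ?thesis unfolding eq euler cos_minus sin_minus by simp
  qed
  have e4: "exp (s * pi * \<i> * (1 / 2 + \<mu>)) = \<sigma> * (cos (2 * b) + \<sigma> * sin (2 * b))"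
  proof -
    have eq: "s * pi * \<i> * (1 / 2 + \<mu>) = \<sigma> * (of_real pi / 2 + 2 * b)"
      unfolding ab(1)[symmetric] by (simp add: \<sigma>_def algebra_simps)
    show ?thesis unfolding eq euler cos_minus sin_minus by (simp add: cos_add sin_add algebra_simps \<sigma>2)
  qed
  define C where "C = cos (2 * a)"
  have C: "C \<noteq> 0" using cs unfolding C_def ab .
  have ex: "C = ca\<^sup>2 - sa\<^sup>2" "cos (2 * b) = cb\<^sup>2 - sb\<^sup>2" "sin (2 * b) = 2 * sb * cb"
      "cos (b - a) = cb * ca + sb * sa" "sin (b - a) = sb * ca - cb * sa"
      "cos (a + b) = ca * cb - sa * sb" "sin (a + b) = sa * cb + ca * sb"
      "sin (2 * (b - a)) = 2 * ((sb * ca - cb * sa) * (cb * ca + sb * sa))"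
    unfolding C_def ca_def sa_def cb_def sb_def sin_double[of "b - a"]
    by (simp_all add: cos_double sin_double cos_diff sin_diff cos_add sin_add)
  have k1: "k1 * C = (cos (2 * b) + \<sigma> * sin (2 * b)) * (cos (2 * b) * C - \<sigma> * ((sb * ca - cb * sa) * (cb * ca + sb * sa)))"
  proof -
    have "k1 = (cos (2 * b) + \<sigma> * sin (2 * b)) * (cos (2 * b) - \<sigma> * (2 * ((sb * ca - cb * sa) * (cb * ca + sb * sa)) / (2 * C)))"
      unfolding k1_def e1 unfolding ab \<sigma>_def[symmetric] C_def[symmetric] ex(8) ..
    moreover have "A * (B - \<sigma> * (2 * T / (2 * C))) * C = A * (B * C - \<sigma> * T)" for A B T
      using C by (simp add: field_simps)
    ultimately show ?thesis by (simp only:)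
  qed
  have k2: "k2 * C = \<sigma> * (cos (2 * b) + \<sigma> * sin (2 * b))"
    unfolding k2_def e4 unfolding ab C_def[symmetric] using C by simp
  have "C * (k1 * exp (- (s * \<i> * pi * p / 2)) + k2 * exp (- (s * \<i> * pi * q / 2)) * (cos (of_real pi * q / 2) * sin (of_real pi * p / 2)))
     = (k1 * C) * exp (- (s * \<i> * pi * p / 2)) + (k2 * C) * exp (- (s * \<i> * pi * q / 2)) * (cos (of_real pi * q / 2) * sin (of_real pi * p / 2))"
    by (simp only: ring_distribs mult_ac)
  also have "\<dots> = C * cos (of_real pi * p / 2)"
    unfolding k1 k2 unfolding e2 e3 trig ab(4) ex using \<sigma> pyth by algebra
  finally show ?even using C by simp
  have "C * (s * \<i> * (k1 * exp (- (s * \<i> * pi * p / 2)) + k2 * exp (- (s * \<i> * pi * q / 2)) * (sin (of_real pi * q / 2) * cos (of_real pi * p / 2))))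
     = \<sigma> * ((k1 * C) * exp (- (s * \<i> * pi * p / 2)) + (k2 * C) * exp (- (s * \<i> * pi * q / 2)) * (sin (of_real pi * q / 2) * cos (of_real pi * p / 2)))"
    unfolding \<sigma>_def by (simp only: ring_distribs mult_ac)
  also have "\<dots> = C * sin (of_real pi * p / 2)"
    unfolding k1 k2 unfolding e2 e3 trig ab(4) ex using \<sigma> pyth by algebra
  finally show ?odd using C by simp
qed

section \<open>Ferrers function\<close>

lemma legA_reflect:
  assumes "Im z < 0"
  shows "legA p c z = exp (\<i> * of_real pi * p) * legA p c (- z)"
proof -
  have nz: "z \<noteq> 0" using assms by auto
  have "Ln (- z) = Ln z + \<i> * of_real pi" using assms nz by (simp add: Ln_minus)
  then have "z powr (- p) = exp (\<i> * of_real pi * p) * (- z) powr (- p)"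
    using nz by (simp add: powr_def exp_add[symmetric] algebra_simps)
  then show ?thesis by (simp add: legA_def)
qed

text \<open>The factor i comes from the additional phase e^(-i pi/2) in the limit of A with p + 1.
  For s = -1 the reflection phase e^(i pi p) turns e^(-i pi p/2) into its inverse, and oddness of
  \<open>H\<close> changes the sign of the second term.\<close>

lemma legA_half_plane:
  fixes s :: real
  assumes c: "c \<notin> \<int>\<^sub>\<le>\<^sub>0"
    and E: "legendre_sol (ball 0 1) p (p - 2 * c + 2) E E'" "E 0 = 1" "E' 0 = 0" "\<And>z. E (- z) = E z"
    and H: "legendre_sol (ball 0 1) p (p - 2 * c + 2) H H'" "H 0 = 0" "H' 0 = 1" "\<And>z. H (- z) = - H z"
    and s: "s = 1 \<or> s = -1" and z: "s * Im z > 0" "norm z < 1"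
  shows "legA p c z = exp (- (s * \<i> * pi * p / 2)) * (legA0 p c * E z + s * \<i> * (p * legA0 (p + 1) c) * H z)"
proof -
  let ?U = "at 0 within {z::complex. Im z > 0}"
  have ne: "?U \<noteq> bot" using at_within_half_plane_ne_bot[of 1 0] by simp
  obtain a b where ab: "\<And>z. Im z > 0 \<Longrightarrow> norm z < 1 \<Longrightarrow> legA p c z = a * E z + b * H z"
    "(legA p c \<longlongrightarrow> a) ?U" "((\<lambda>z. - p * legA (p + 1) c z) \<longlongrightarrow> b) ?U"
    by (rule legA_expansion[OF c E(1-3) H(1-3)]) blast
  have a: "a = exp (- p * (\<i> * of_real pi / 2)) * legA0 p c"
    by (rule tendsto_unique[OF ne ab(2) legA_limit[OF c]])
  have "((\<lambda>z. - p * legA (p + 1) c z) \<longlongrightarrow> - p * (exp (- (p + 1) * (\<i> * of_real pi / 2)) * legA0 (p + 1) c)) ?U"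
    by (intro tendsto_intros legA_limit c)
  with ne ab(3) have b: "b = - p * (exp (- (p + 1) * (\<i> * of_real pi / 2)) * legA0 (p + 1) c)"
    by (rule tendsto_unique)
  have e: "exp (- (p + 1) * (\<i> * of_real pi / 2)) = exp (- p * (\<i> * of_real pi / 2)) * (- \<i>)"
  proof -
    have "- (p + 1) * (\<i> * of_real pi / 2) = - p * (\<i> * of_real pi / 2) + - (\<i> * (of_real pi / 2))"
      by (simp add: field_simps)
    moreover have "exp (- (\<i> * (complex_of_real pi / 2))) = - \<i>"
      unfolding exp_minus_Euler by simp
    ultimately show ?thesis by (simp only: exp_add)
  qed
  have up: "legA p c z = exp (- p * (\<i> * of_real pi / 2)) * (legA0 p c * E z + \<i> * (p * legA0 (p + 1) c) * H z)"
    if "Im z > 0" "norm z < 1" for z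
    unfolding ab(1)[OF that] a b e by (simp add: algebra_simps)
  show ?thesis
  proof (cases "s = 1")
    case True
    then show ?thesis using up[of z] z by (simp add: mult_ac)
  next
    case False
    then have s: "s = -1" using s by simp
    then have "Im (- z) > 0" "norm (- z) < 1" using z by auto
    note up[OF this]
    moreover have "legA p c z = exp (\<i> * of_real pi * p) * legA p c (- z)"
      using z s by (intro legA_reflect) simp
    moreover have "exp (\<i> * of_real pi * p) * exp (- p * (\<i> * of_real pi / 2)) = exp (\<i> * of_real pi * p / 2)"
      unfolding exp_add[symmetric] by (simp add: field_simps)
    ultimately have "legA p c z = exp (\<i> * of_real pi * p / 2) * (legA0 p c * E z - \<i> * (p * legA0 (p + 1) c) * H z)"
      by (simp add: E H mult.assoc[symmetric])
    then show ?thesis using s by simp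
  qed
qed

section \<open>Principal powers in the two half-planes\<close>

lemma Im_Ln_half_plane:
  assumes "Im z > 0"
  shows "0 < Im (Ln z)" "Im (Ln z) < pi" "Ln (- z) = Ln z - \<i> * of_real pi"
proof -
  show "0 < Im (Ln z)" "Im (Ln z) < pi" using Im_Ln_pos_lt_imp[OF assms] by auto
  have "z \<noteq> 0" using assms by auto
  then show "Ln (- z) = Ln z - \<i> * of_real pi" using assms by (simp add: Ln_minus)
qed

text \<open>Off the real axis 1 + z and 1 - z have imaginary parts of opposite sign, so the sum of
  their arguments stays between -pi and pi and the principal logarithms add.\<close>

lemma one_minus_square_powr:
  assumes "Im z \<noteq> 0"
  shows "(1 - z\<^sup>2) powr a = (1 + z) powr a * (1 - z) powr a"
proof -
  have nz: "1 + z \<noteq> 0" "1 - z \<noteq> 0" using assms by (auto simp: complex_eq_iff)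
  have bnd: "- pi < Im (Ln (1 + z) + Ln (1 - z)) \<and> Im (Ln (1 + z) + Ln (1 - z)) \<le> pi"
  proof (cases "Im z > 0")
    case True
    then show ?thesis using Im_Ln_half_plane[of "1 + z"] Im_Ln_half_plane[of "z - 1"] by simp
  next
    case False
    then have "Im z < 0" using assms by simp
    then have "Ln (1 + z) = Ln (- 1 - z) - \<i> * of_real pi"
      using Im_Ln_half_plane(3)[of "- 1 - z"] by (simp add: add.commute)
    then show ?thesis
      using \<open>Im z < 0\<close> Im_Ln_half_plane(1,2)[of "1 - z"] Im_Ln_half_plane(1,2)[of "- 1 - z"] by simp
  qed
  have prod: "1 - z\<^sup>2 = (1 + z) * (1 - z)" by (simp add: power2_eq_square algebra_simps)
  have "Ln ((1 + z) * (1 - z)) = Ln (1 + z) + Ln (1 - z)"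
    using bnd nz by (simp add: Ln_times)
  then show ?thesis
    unfolding prod powr_def using nz by (simp add: exp_add[symmetric] distrib_left)
qed

text \<open>The logarithms of z - 1 and 1 - z differ by s i pi. For a = \<mu>/2 the resulting phase
  is the one that the definition of the Ferrers function compensates.\<close>

lemma legendre_prefactor:
  fixes s :: real
  assumes s: "s = 1 \<or> s = -1" and z: "s * Im z > 0"
  shows "(z + 1) powr a * (z - 1) powr a = exp (s * \<i> * pi * a) * (1 - z\<^sup>2) powr a"
proof -
  have im: "Im z \<noteq> 0" using z by auto
  have nz: "z - 1 \<noteq> 0" "1 - z \<noteq> 0" using im by (auto simp: complex_eq_iff)
  have "Ln (z - 1) = Ln (1 - z) + s * \<i> * pi"
  proof (cases "s = 1")
    case True
    then have "Im (z - 1) > 0" using z by simp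
    from Im_Ln_half_plane(3)[OF this] show ?thesis using True by simp
  next
    case False
    then have "s = -1" "Im (1 - z) > 0" using s z by auto
    with Im_Ln_half_plane(3)[of "1 - z"] show ?thesis by simp
  qed
  then have "(z - 1) powr a = exp (s * \<i> * pi * a) * (1 - z) powr a"
    using nz by (simp add: powr_def exp_add[symmetric] algebra_simps)
  then show ?thesis unfolding one_minus_square_powr[OF im] by (simp add: mult_ac add_ac)
qed

lemma legendreQ_half_plane:
  fixes s :: real
  assumes c: "\<nu> + 3 / 2 \<notin> \<int>\<^sub>\<le>\<^sub>0" and s: "s = 1 \<or> s = -1" and z: "s * Im z > 0"
  shows "legendreQ \<nu> \<mu> z = exp (\<i> * pi * \<mu>) * exp (s * \<i> * pi * \<mu> / 2) * (1 - z\<^sup>2) powr (\<mu> / 2)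
    * (of_real (sqrt pi) * 2 powr (- \<nu> - 1) * Gamma (\<nu> + \<mu> + 1) * rGamma (\<nu> + 3 / 2)) * legA (\<nu> + \<mu> + 1) (\<nu> + 3 / 2) z"
proof -
  have im: "Im z \<noteq> 0" using z by auto
  define p where "p = \<nu> + \<mu> + 1"
  have eq: "\<nu> + \<mu> + 2 = p + 1" "\<nu> + \<mu> + 1 = p" by (simp_all add: p_def)
  have h: "hyp2F1 ((\<nu> + \<mu> + 2) / 2) ((\<nu> + \<mu> + 1) / 2) (\<nu> + 3 / 2) (1 / z\<^sup>2) = hypQ p (\<nu> + 3 / 2) (1 / z\<^sup>2)"
    unfolding eq by (rule hyp2F1_eq_hypQ(2)[OF c inverse_square_in_slit[OF im]])
  have pw: "2 powr (- \<nu> - 1) = inverse ((2::complex) powr (\<nu> + 1))" "z powr (- p) = inverse (z powr p)"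
    using powr_minus[of "2::complex" "\<nu> + 1"] by (simp_all add: powr_minus)
  have ring: "S * e * G * (f * W) * r / (T * Z) * h = e * f * W * (S * inverse T * G * r) * (inverse Z * h)"
    for S e G f W r T Z h :: complex
    by (simp add: divide_inverse mult_ac)
  have "legendreQ \<nu> \<mu> z = complex_of_real (sqrt pi) * exp (\<i> * pi * \<mu>) * Gamma p
       * (exp (s * \<i> * pi * (\<mu> / 2)) * (1 - z\<^sup>2) powr (\<mu> / 2))
       * rGamma (\<nu> + 3 / 2) / (2 powr (\<nu> + 1) * z powr p) * hypQ p (\<nu> + 3 / 2) (1 / z\<^sup>2)"
    unfolding legendreQ_def legendre_prefactor[OF s z] h unfolding eq ..
  also have "s * \<i> * pi * (\<mu> / 2) = s * \<i> * pi * \<mu> / 2" by simp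
  finally show ?thesis
    unfolding legA_def eq pw ring .
qed

section \<open>The doubly cut plane and uniqueness of the extension to it\<close>

definition slit2 :: "complex set" where "slit2 = UNIV - complex_of_real ` ({..-1} \<union> {1..})"

lemma slit2_iff: "z \<in> slit2 \<longleftrightarrow> (Im z = 0 \<longrightarrow> -1 < Re z \<and> Re z < 1)"
proof -
  have "z \<in> complex_of_real ` ({..-1} \<union> {1..}) \<longleftrightarrow> Im z = 0 \<and> (Re z \<le> -1 \<or> 1 \<le> Re z)"
    by (auto simp: image_iff complex_eq_iff intro!: bexI[of _ "Re z"])
  then show ?thesis by (auto simp: slit2_def)
qed

text \<open>These three open pieces give openness and connectedness, and they are the pieces from
  which the analytic extension is glued.\<close>

lemma slit2_eq: "slit2 = ball 0 1 \<union> {z. Im z > 0} \<union> {z. Im z < 0}"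
proof (intro equalityI subsetI)
  fix z assume z: "z \<in> slit2"
  show "z \<in> ball 0 1 \<union> {z. Im z > 0} \<union> {z. Im z < 0}"
  proof (cases "Im z = 0")
    case True
    then have "norm z = \<bar>Re z\<bar>" by (simp add: cmod_def)
    then show ?thesis using z True by (auto simp: slit2_iff abs_less_iff)
  qed auto
next
  fix z assume "z \<in> ball 0 1 \<union> {z. Im z > 0} \<union> {z. Im z < 0}"
  then show "z \<in> slit2" using abs_Re_le_cmod[of z] by (auto simp: slit2_iff)
qed

lemma open_slit2: "open slit2"
  unfolding slit2_eq by (intro open_Un open_ball open_halfspace_Im_gt open_halfspace_Im_lt)

lemma connected_slit2: "connected slit2"
proof -
  have b: "ball 0 1 \<inter> {z. s * Im z > 0} \<noteq> {}" if "s = 1 \<or> s = -1" for s :: real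
  proof -
    have "\<i> * of_real (s / 2) \<in> ball 0 1 \<inter> {z. s * Im z > 0}"
      using that by (auto simp: norm_mult)
    then show ?thesis by blast
  qed
  have 1: "connected (ball 0 1 \<union> {z::complex. Im z > 0})"
    using b[of 1] by (intro connected_Un convex_connected convex_halfspace_Im_gt) auto
  have "connected ((ball 0 1 \<union> {z. Im z > 0}) \<union> {z::complex. Im z < 0})"
    by (rule connected_Un[OF 1 convex_connected[OF convex_halfspace_Im_lt]]) (use b[of "-1"] in auto)
  then show ?thesis by (simp only: slit2_eq)
qed

lemma slit2_square: "z \<in> slit2 \<Longrightarrow> 1 - z\<^sup>2 \<notin> \<real>\<^sub>\<le>\<^sub>0"
proof
  assume z: "z \<in> slit2" and "1 - z\<^sup>2 \<in> \<real>\<^sub>\<le>\<^sub>0"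
  then have "Im (z\<^sup>2) = 0" "Re (z\<^sup>2) \<ge> 1" by (auto simp: complex_nonpos_Reals_iff)
  then have *: "Re z = 0 \<or> Im z = 0" "(Re z)\<^sup>2 - (Im z)\<^sup>2 \<ge> 1" by (auto simp: Im_power2 Re_power2)
  have "Im z = 0"
  proof (rule ccontr)
    assume "Im z \<noteq> 0"
    then have "(Re z)\<^sup>2 - (Im z)\<^sup>2 < 0" using * by simp
    then show False using * by simp
  qed
  then have "(Re z)\<^sup>2 \<ge> 1" "\<bar>Re z\<bar> < 1" using * z by (auto simp: slit2_iff)
  then show False by (simp add: abs_square_less_1[symmetric])
qed

lemma legA_holomorphic:
  assumes "c \<notin> \<int>\<^sub>\<le>\<^sub>0" "\<And>z. z \<in> A \<Longrightarrow> Im z \<noteq> 0" "open A"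
  shows "legA p c holomorphic_on A"
  using legA_deriv[OF assms(1)] assms(2,3) by (metis holomorphic_on_open)

text \<open>One holomorphic function with the correct values on (-1, 1) both shows that the choice
  in \<open>ferrersQ\<close> is realised and, by the identity theorem, determines it.\<close>

lemma ferrersQ_eqI:
  assumes F: "F holomorphic_on slit2" and val: "\<And>t. -1 < t \<Longrightarrow> t < 1 \<Longrightarrow> F (of_real t) = ferrersQ_interval \<nu> \<mu> t"
    and x: "x \<in> slit2"
  shows "ferrersQ \<nu> \<mu> x = F x"
proof -
  let ?P = "\<lambda>f. f holomorphic_on slit2 \<and> (\<forall>t. -1 < t \<and> t < 1 \<longrightarrow> f (complex_of_real t) = ferrersQ_interval \<nu> \<mu> t)"
  have "?P (ferrersQ \<nu> \<mu>)"
    unfolding ferrersQ_def slit2_def[symmetric] using F val by (intro someI[of ?P F]) auto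
  then have hol: "ferrersQ \<nu> \<mu> holomorphic_on slit2"
    and v: "\<And>t. -1 < t \<Longrightarrow> t < 1 \<Longrightarrow> ferrersQ \<nu> \<mu> (of_real t) = ferrersQ_interval \<nu> \<mu> t" by auto
  have "(\<lambda>x. ferrersQ \<nu> \<mu> x - F x) x = 0"
  proof (rule analytic_continuation[where f = "\<lambda>x. ferrersQ \<nu> \<mu> x - F x" and U = "complex_of_real ` {-1<..<1}" and \<xi> = 0, OF _ open_slit2 connected_slit2])
    show "(\<lambda>x. ferrersQ \<nu> \<mu> x - F x) holomorphic_on slit2" by (intro holomorphic_intros hol F)
    show "complex_of_real ` {-1<..<1} \<subseteq> slit2" by (auto simp: slit2_iff)
    show "0 islimpt complex_of_real ` {-1<..<1}"
      unfolding islimpt_approachable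
    proof (intro allI impI)
      fix e :: real assume "e > 0"
      then show "\<exists>z\<in>complex_of_real ` {-1<..<1}. z \<noteq> 0 \<and> dist z 0 < e"
        by (intro bexI[of _ "of_real (min (1/2) (e/2))"]) auto
    qed
  qed (use x v val in \<open>auto simp: slit2_iff\<close>)
  then show ?thesis by simp
qed

text \<open>The second function of the theorem has p and q exchanged; this lets it be expanded in
  the same even and odd solutions.\<close>

lemma legendre_sol_commute: "legendre_sol S p q y y' \<longleftrightarrow> legendre_sol S q p y y'"
  unfolding legendre_sol_def by (simp only: mult.commute[of p q] add.commute[of p q])

lemma cos_pi_nonzero:
  fixes \<nu> :: complex
  assumes "\<nu> + 1 / 2 \<notin> \<int>"
  shows "cos (of_real pi * \<nu>) \<noteq> 0"
proof
  assume "cos (of_real pi * \<nu>) = 0"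
  then have "sin (of_real pi * \<nu> + of_real pi / 2) = 0" by (simp add: sin_add)
  then obtain n :: int where "of_real pi * \<nu> + of_real pi / 2 = of_real (of_int n * pi)"
    unfolding sin_eq_0 by auto
  then have "of_real pi * (\<nu> + 1 / 2) = of_real pi * of_int n" by (simp add: field_simps)
  then have "\<nu> + 1 / 2 = of_int n" by simp
  then show False using assms by simp
qed

theorem theorem4p4:
  fixes \<nu> \<mu> x :: complex and s :: real
  assumes "\<nu> + \<mu> \<notin> {- of_nat n | n :: nat. n \<ge> 1}"
    and "\<nu> + 1 / 2 \<notin> \<int>"
    and "(Im x > 0 \<and> s = 1) \<or> (Im x < 0 \<and> s = -1)"
  shows "ferrersQ \<nu> \<mu> x =
      complex_of_real (sqrt pi) * 2 powr (- \<nu> - 1) * exp (s * \<i> * pi * \<mu>)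
        * (cos (pi * \<mu>) - s * \<i> * (sin (pi * (\<mu> - \<nu>)) / (2 * cos (pi * \<nu>))))
        * (Gamma (\<nu> + \<mu> + 1) * rGamma (\<nu> + 3 / 2))
        * x powr (- \<nu> - \<mu> - 1) * (1 - x ^ 2) powr (\<mu> / 2)
        * hyp2F1 ((\<nu> + \<mu> + 1) / 2) ((\<nu> + \<mu> + 2) / 2) (\<nu> + 3 / 2) (1 / x ^ 2)
    + complex_of_real (pi powr (3 / 2)) * 2 powr (\<nu> - 1)
        * (exp (s * pi * \<i> * (1 / 2 + \<mu>)) * (1 / cos (pi * \<nu>)))
        * (rGamma (\<nu> - \<mu> + 1) * rGamma (1 / 2 - \<nu>))
        * x powr (\<nu> - \<mu>) * (1 - x ^ 2) powr (\<mu> / 2)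
        * hyp2F1 ((\<mu> - \<nu>) / 2) ((\<mu> - \<nu> + 1) / 2) (1 / 2 - \<nu>) (1 / x ^ 2)"
proof -
  define p c q d where "p = \<nu> + \<mu> + 1" and "c = \<nu> + 3 / 2" and "q = \<mu> - \<nu>" and "d = 1 / 2 - \<nu>"
  have p: "p \<notin> \<int>\<^sub>\<le>\<^sub>0"
  proof
    assume "p \<in> \<int>\<^sub>\<le>\<^sub>0"
    then obtain k where "p = - of_nat k" by (elim nonpos_Ints_cases')
    then have "\<nu> + \<mu> = - of_nat (Suc k)" by (simp add: p_def eq_diff_eq[symmetric])
    then show False using assms(1) by (metis (mono_tags, lifting) mem_Collect_eq le_add1 plus_1_eq_Suc)
  qed
  have c: "c \<notin> \<int>\<^sub>\<le>\<^sub>0"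
  proof
    assume "c \<in> \<int>\<^sub>\<le>\<^sub>0"
    then have "c - 1 \<in> \<int>" using nonpos_Ints_Int[of c] by simp
    moreover have "c - 1 = \<nu> + 1 / 2" by (simp add: c_def)
    ultimately show False using assms(2) by simp
  qed
  have d: "d \<notin> \<int>\<^sub>\<le>\<^sub>0"
  proof
    assume "d \<in> \<int>\<^sub>\<le>\<^sub>0"
    then have "1 - d \<in> \<int>" using nonpos_Ints_Int[of d] by simp
    moreover have "1 - d = \<nu> + 1 / 2" by (simp add: d_def)
    ultimately show False using assms(2) by simp
  qed
  \<comment> \<open>Passing from (p, c) to (q, d) exchanges p and q, so both functions solve the
    same equation.\<close>
  have pq: "p - 2 * c + 2 = q" "q - 2 * d + 2 = p"
    by (simp_all add: p_def c_def q_def d_def)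
  obtain E E' where E: "legendre_sol (ball 0 1) p q E E'" "E 0 = 1" "E' 0 = 0" "\<And>z. E (- z) = E z"
    using legendre_even_sol[of p q] by blast
  obtain H H' where H: "legendre_sol (ball 0 1) p q H H'" "H 0 = 0" "H' 0 = 1" "\<And>z. H (- z) = - H z"
    using legendre_odd_sol[of p q] by blast
  have EH_hol: "E holomorphic_on ball 0 1" "H holomorphic_on ball 0 1"
    using E(1) H(1) unfolding legendre_sol_def by (metis holomorphic_on_open open_ball)+
  define \<alpha> \<gamma> where "\<alpha> = legA0 p c" and "\<gamma> = p * legA0 (p + 1) c"
  define \<alpha>' \<gamma>' where "\<alpha>' = legA0 q d" and "\<gamma>' = q * legA0 (q + 1) d"
  define \<theta> where "\<theta> = of_real pi * p / 2"
  define N where "N = complex_of_real (sqrt pi) * 2 powr (- \<nu> - 1) * Gamma p * rGamma c"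
  define M where "M = complex_of_real (pi powr (3 / 2)) * 2 powr (\<nu> - 1) * rGamma (1 - q) * rGamma d"
  define k1 k2 :: "real \<Rightarrow> complex" where
    "k1 = (\<lambda>s. exp (s * \<i> * pi * \<mu>) * (cos (pi * \<mu>) - s * \<i> * (sin (pi * (\<mu> - \<nu>)) / (2 * cos (pi * \<nu>)))))"
    and "k2 = (\<lambda>s. exp (s * pi * \<i> * (1 / 2 + \<mu>)) * (1 / cos (pi * \<nu>)))"
  \<comment> \<open>\<open>outer\<close> is the right-hand side of the theorem divided by (1 -
    x^2)^(\<mu>/2). \<open>inner\<close> is the mean of the two boundary values, expanded in the
    disc: cos and sin arise from adding the phases e^(-i \<theta>) and e^(i \<theta>).\<close>
  define outer where "outer = (\<lambda>s x. N * k1 s * legA p c x + M * k2 s * legA q d x)"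
  define inner where "inner = (\<lambda>x. N * (cos \<theta> * \<alpha> * E x + sin \<theta> * \<gamma> * H x))"

  have A: "legA p c z = exp (- (s * \<i> * pi * p / 2)) * (\<alpha> * E z + s * \<i> * \<gamma> * H z)"
    "legA q d z = exp (- (s * \<i> * pi * q / 2)) * (\<alpha>' * E z + s * \<i> * \<gamma>' * H z)"
    if "s = 1 \<or> s = -1" "s * Im z > 0" "norm z < 1" for s :: real and z
  proof -
    note E_swap = E(1)[unfolded legendre_sol_commute[of _ p]] and H_swap = H(1)[unfolded legendre_sol_commute[of _ p]]
    show "legA p c z = exp (- (s * \<i> * pi * p / 2)) * (\<alpha> * E z + s * \<i> * \<gamma> * H z)"
      unfolding \<alpha>_def \<gamma>_def
      by (rule legA_half_plane[OF c, of p, unfolded pq(1), OF E(1-3) _ H(1-3) _ that]) (simp_all only: E H)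
    show "legA q d z = exp (- (s * \<i> * pi * q / 2)) * (\<alpha>' * E z + s * \<i> * \<gamma>' * H z)"
      unfolding \<alpha>'_def \<gamma>'_def
      by (rule legA_half_plane[OF d, of q, unfolded pq(2), OF E_swap E(2-3) _ H_swap H(2-3) _ that]) (simp_all only: E H)
  qed

  have gamma: "M * \<alpha>' = N * \<alpha> * (cos (of_real pi * q / 2) * sin \<theta>)"
    "M * \<gamma>' = N * \<gamma> * (sin (of_real pi * q / 2) * cos \<theta>)"
    using gamma_connection_even[of \<nu> \<mu>] gamma_connection_odd[of \<nu> \<mu>] p c d
    unfolding M_def N_def \<alpha>_def \<gamma>_def \<alpha>'_def \<gamma>'_def \<theta>_def p_def c_def q_def d_def by blast+

  \<comment> \<open>\<open>gamma\<close> rewrites both coefficients of the second function in terms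
    of those of the first; the even and odd parts then match by the two trigonometric
    identities.\<close>
  have connection: "outer s z = inner z" if s: "s = 1 \<or> s = -1" "s * Im z > 0" "norm z < 1" for s z
  proof -
    define e1 e2 where "e1 = exp (- (s * \<i> * pi * p / 2))" and "e2 = exp (- (s * \<i> * pi * q / 2))"
    define u v where "u = cos (of_real pi * q / 2) * sin \<theta>" and "v = sin (of_real pi * q / 2) * cos \<theta>"
    have t: "k1 s * e1 + k2 s * e2 * u = cos \<theta>" "s * \<i> * (k1 s * e1 + k2 s * e2 * v) = sin \<theta>"
      using trig_connection[OF s(1) cos_pi_nonzero[OF assms(2)], of \<mu>]
      unfolding k1_def k2_def e1_def e2_def u_def v_def \<theta>_def p_def q_def by blast+
    have "outer s z = N * k1 s * (e1 * (\<alpha> * E z + s * \<i> * \<gamma> * H z)) + M * k2 s * (e2 * (\<alpha>' * E z + s * \<i> * \<gamma>' * H z))"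
      unfolding outer_def A[OF s] e1_def e2_def ..
    also have "\<dots> = N * k1 s * e1 * (\<alpha> * E z) + k2 s * e2 * (M * \<alpha>') * E z
        + s * \<i> * (N * k1 s * e1 * \<gamma> * H z + k2 s * e2 * (M * \<gamma>') * H z)"
      by (simp add: algebra_simps)
    also have "\<dots> = N * ((k1 s * e1 + k2 s * e2 * u) * \<alpha> * E z + (s * \<i> * (k1 s * e1 + k2 s * e2 * v)) * \<gamma> * H z)"
      unfolding gamma u_def[symmetric] v_def[symmetric] by (simp add: algebra_simps)
    also have "\<dots> = inner z" unfolding t inner_def ..
    finally show ?thesis .
  qed

  \<comment> \<open>Gluing: the expansion inside the unit disc, the formula of the theorem outside
    it. On the overlaps with the half-planes the two agree by \<open>connection\<close>.\<close>
  define G where "G = (\<lambda>z. if norm z < 1 then inner z else if Im z > 0 then outer 1 z else outer (-1) z)"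
  define F where "F = (\<lambda>z. (1 - z\<^sup>2) powr (\<mu> / 2) * G z)"
  have G_outer: "G z = outer s z" if "s = 1 \<or> s = -1" "s * Im z > 0" for s z
    using connection[OF that] that by (auto simp: G_def)
  have "G holomorphic_on slit2"
    unfolding slit2_eq
  proof (intro holomorphic_on_Un open_Un open_ball open_halfspace_Im_gt open_halfspace_Im_lt)
    have "inner holomorphic_on ball 0 1"
      unfolding inner_def by (intro holomorphic_intros EH_hol)
    then show "G holomorphic_on ball 0 1" by (rule holomorphic_transform) (simp add: G_def)
    have "outer s holomorphic_on {z. Im z > 0}" "outer s holomorphic_on {z. Im z < 0}" for s
      unfolding outer_def
      by (intro holomorphic_intros legA_holomorphic c d open_halfspace_Im_gt open_halfspace_Im_lt; auto)+
    note outer_hol = this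
    show "G holomorphic_on {z. Im z > 0}"
      by (rule holomorphic_transform[OF outer_hol(1)[of 1]]) (simp add: G_outer[of 1])
    show "G holomorphic_on {z. Im z < 0}"
      by (rule holomorphic_transform[OF outer_hol(2)[of "-1"]]) (simp add: G_outer[of "-1"])
  qed
  then have F_hol: "F holomorphic_on slit2"
    unfolding F_def by (intro holomorphic_intros) (auto dest: slit2_square)

  have F_interval: "F (of_real t) = ferrersQ_interval \<nu> \<mu> t" if t: "-1 < t" "t < 1" for t
  proof -
    define W where "W = (\<lambda>z::complex. (1 - z\<^sup>2) powr (\<mu> / 2))"
    have tn: "norm (complex_of_real t) < 1" using t by simp
    \<comment> \<open>\<open>legendreQ\<close> on the half-disc of sign s, with the expansion in
      \<open>E\<close> and \<open>H\<close> inserted. Unlike \<open>legendreQ\<close> it is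
      holomorphic on the full disc, so the boundary value at t is its value at t.\<close>
    define B where "B = (\<lambda>(s::real) z. exp (\<i> * pi * \<mu>) * exp (s * \<i> * pi * \<mu> / 2) * W z * N
        * (exp (- (s * \<i> * pi * p / 2)) * (\<alpha> * E z + s * \<i> * \<gamma> * H z)))"
    have lim: "Lim (at (of_real t) within {z. s * Im z > 0}) (legendreQ \<nu> \<mu>) = B s (of_real t)"
      if s: "s = 1 \<or> s = -1" for s :: real
    proof (rule tendsto_Lim)
      show "at (complex_of_real t) within {z. s * Im z > 0} \<noteq> bot"
        using s by (intro at_within_half_plane_ne_bot) auto
      have "B s holomorphic_on ball 0 1"
        unfolding B_def W_def by (intro holomorphic_intros EH_hol) (use one_minus_square_nonpos in auto)
      then have "\<forall>z\<in>ball 0 1. isCont (B s) z"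
        using holomorphic_on_imp_continuous_on continuous_on_eq_continuous_at[OF open_ball] by blast
      then have "isCont (B s) (of_real t)"
        using tn by simp
      then have "(B s \<longlongrightarrow> B s (of_real t)) (at (of_real t) within {z. s * Im z > 0})"
        unfolding isCont_def by (rule tendsto_within_subset) simp
      moreover have "\<forall>\<^sub>F z in at (of_real t) within {z. s * Im z > 0}. B s z = legendreQ \<nu> \<mu> z"
      proof -
        have "\<forall>\<^sub>F z in nhds (complex_of_real t). z \<in> ball 0 1"
          using tn by (intro eventually_nhds_in_open) auto
        then show ?thesis
          unfolding eventually_at_filter
        proof eventually_elim
          case (elim z)
          show ?case
          proof (intro impI)
            assume "z \<in> {z. s * Im z > 0}"
            then have z: "s * Im z > 0" by simp
            have zn: "norm z < 1" using elim by simp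
            show "B s z = legendreQ \<nu> \<mu> z"
              unfolding legendreQ_half_plane[OF c[unfolded c_def] s z]
              unfolding p_def[symmetric] c_def[symmetric] A(1)[OF s z zn] B_def N_def W_def ..
          qed
        qed
      qed
      ultimately show "(legendreQ \<nu> \<mu> \<longlongrightarrow> B s (of_real t)) (at (of_real t) within {z. s * Im z > 0})"
        by (rule Lim_transform_eventually)
    qed
    define a b where "a = \<alpha> * E (of_real t)" and "b = \<i> * \<gamma> * H (of_real t)"
    have "{z. - 1 * Im z > 0} = {z. Im z < 0}" "{z. 1 * Im z > 0} = {z. Im z > 0}" by auto
    then have lim1: "Lim (at (complex_of_real t) within {z. Im z > 0}) (legendreQ \<nu> \<mu>) = B 1 (of_real t)"
      and lim2: "Lim (at (complex_of_real t) within {z. Im z < 0}) (legendreQ \<nu> \<mu>) = B (-1) (of_real t)"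
      using lim[of 1] lim[of "-1"] by simp_all
    have B1: "B 1 (of_real t) = exp (\<i> * pi * \<mu>) * exp (\<i> * pi * \<mu> / 2) * W (of_real t) * N * (exp (- (\<i> * \<theta>)) * (a + b))"
      and B2: "B (-1) (of_real t) = exp (\<i> * pi * \<mu>) * exp (- (\<i> * pi * \<mu> / 2)) * W (of_real t) * N * (exp (\<i> * \<theta>) * (a - b))"
      unfolding B_def a_def b_def \<theta>_def by (simp_all add: mult_ac)
    have can: "exp (\<i> * pi * \<mu>) * exp (- (\<i> * pi * \<mu>)) = 1" "exp (\<i> * pi * \<mu> / 2) * exp (- (\<i> * pi * \<mu> / 2)) = 1"
      by (simp_all flip: exp_add)
    have "ferrersQ_interval \<nu> \<mu> t = 1 / 2 * (exp (- (\<i> * pi * \<mu> / 2)) * exp (- (\<i> * pi * \<mu>)) * B 1 (of_real t)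
        + exp (\<i> * pi * \<mu> / 2) * exp (- (\<i> * pi * \<mu>)) * B (-1) (of_real t))"
      unfolding ferrersQ_interval_def lim1 lim2 by simp
    \<comment> \<open>The phases of the definition cancel e^(i pi \<mu>) and the phases of the
      prefactor on either side; what survives of the boundary values is e^(-i \<theta>) and e^(i
      \<theta>).\<close>
    also have "\<dots> = 1 / 2 * ((exp (\<i> * pi * \<mu>) * exp (- (\<i> * pi * \<mu>))) * (exp (\<i> * pi * \<mu> / 2) * exp (- (\<i> * pi * \<mu> / 2)))
         * (W (of_real t) * N * (exp (- (\<i> * \<theta>)) * (a + b) + exp (\<i> * \<theta>) * (a - b))))"
      unfolding B1 B2 by (simp only: distrib_left mult_ac)
    also have "\<dots> = W (of_real t) * N * (cos \<theta> * a - \<i> * sin \<theta> * b)"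
      unfolding can exp_Euler exp_minus_Euler by (simp add: algebra_simps)
    also have "\<i> * sin \<theta> * b = - (sin \<theta> * \<gamma> * H (of_real t))"
      by (simp add: b_def mult_ac)
    also have "W (of_real t) * N * (cos \<theta> * a - - (sin \<theta> * \<gamma> * H (of_real t))) = F (of_real t)"
      using tn by (simp add: F_def G_def inner_def W_def a_def mult_ac)
    finally show ?thesis ..
  qed

  have s: "s = 1 \<or> s = -1" "s * Im x > 0" using assms(3) by auto
  have im: "Im x \<noteq> 0" using s by auto
  have slit: "1 / x\<^sup>2 \<in> slit" by (rule inverse_square_in_slit[OF im])
  have "ferrersQ \<nu> \<mu> x = F x"
    using F_hol F_interval by (rule ferrersQ_eqI) (use im in \<open>simp_all add: slit2_iff\<close>)
  also have "\<dots> = (1 - x\<^sup>2) powr (\<mu> / 2) * (N * k1 s * legA p c x + M * k2 s * legA q d x)"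
    by (simp add: F_def G_outer[OF s] outer_def)
  also have "\<dots> = complex_of_real (sqrt pi) * 2 powr (- \<nu> - 1) * exp (s * \<i> * pi * \<mu>)
        * (cos (pi * \<mu>) - s * \<i> * (sin (pi * (\<mu> - \<nu>)) / (2 * cos (pi * \<nu>))))
        * (Gamma p * rGamma c) * x powr (- p) * (1 - x ^ 2) powr (\<mu> / 2) * hyp2F1 (p / 2) ((p + 1) / 2) c (1 / x ^ 2)
    + complex_of_real (pi powr (3 / 2)) * 2 powr (\<nu> - 1)
        * (exp (s * pi * \<i> * (1 / 2 + \<mu>)) * (1 / cos (pi * \<nu>)))
        * (rGamma (1 - q) * rGamma d) * x powr (- q) * (1 - x ^ 2) powr (\<mu> / 2) * hyp2F1 (q / 2) ((q + 1) / 2) d (1 / x ^ 2)"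
    unfolding hyp2F1_eq_hypQ(1)[OF c slit] hyp2F1_eq_hypQ(1)[OF d slit] legA_def N_def M_def k1_def k2_def
    by (simp only: distrib_left mult_ac)
  finally have *: "ferrersQ \<nu> \<mu> x = \<dots>" .
  have args: "\<nu> + \<mu> + 1 = p" "\<nu> + \<mu> + 2 = p + 1" "- \<nu> - \<mu> - 1 = - p" "\<nu> - \<mu> = - q" "- q + 1 = 1 - q"
    "\<nu> + 3 / 2 = c" "1 / 2 - \<nu> = d"
    by (simp_all add: p_def q_def c_def d_def)
  show ?thesis
    unfolding * args q_def[symmetric] ..
qed

end
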